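(* Let $\Omega\subset\mathbb{P}^n$ be a properly convex, strictly convex open set with $C^1$ boundary, and let $M=\Omega/\Gamma$ be a quotient manifold, with $\Gamma$ non-elementary. Then the geodesic flow of $M$ is topologically mixing on its non-wandering set $NW$.
   Context: $\mathbb{P}^n$ is real projective space. An open set $\Omega\subset\mathbb{P}^n$ is properly convex if its closure lies in an affine chart in which $\Omega$ is convex; it is strictly convex if $\partial\Omega$ contains no nontrivial segment. The Hilbert distance is $d_\Omega(x,y)=\frac12\ln\frac{|qy|\,|px|}{|qx|\,|py|}$ for $x\neq y$, where $q,p$ are the intersections of the line $(xy)$ with $\partial\Omega$, in the order $q,x,y,p$ ($|\cdot|$ any Euclidean norm on an affine chart containing $\overline\Omega$). $\mathrm{Aut}(\Omega)=\{g\in \mathrm{SL}_{n+1}(\mathbb{R}): g\Omega=\Omega\}$. $\Gamma$ is a discrete torsion-free subgroup of $\mathrm{Aut}(\Omega)$; its limit set is $\Lambda_\Gamma=\overline{\Gamma x}\smallsetminus\Gamma x\subset\partial\Omega$ ($x\in\Omega$ arbitrary), and $\Gamma$ is non-elementary if $\Lambda_\Gamma$ is infinite. $H\Omega=(T\Omega\smallsetminus\{0\})/\mathbb{R}_+^*$ and $HM=H\Omega/\Gamma$. For $w=(x,[\xi])\in H\Omega$, $\varphi^t(w)$ is obtained by following for $d_\Omega$-time $t$ the straight line from $x$ in the direction $[\xi]$; $x^+,x^-\in\partial\Omega$ are the forward and backward endpoints of this line. This induces the geodesic flow $\varphi^t$ on $HM$. The non-wandering set $NW\subset HM$ is the projection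 of $\{w\in H\Omega: x^+,x^-\in\Lambda_\Gamma\}$. A flow $\varphi^t$ on a topological space $Y$ is topologically mixing if for all nonempty open sets $U,V\subset Y$ there is $T\in\mathbb{R}$ such that $\varphi^t(U)\cap V\neq\emptyset$ for all $t\geq T$. *)

theory Defs
  imports "HOL-Analysis.Analysis" "HOL-Algebra.Group"
begin

section \<open>Quotient topologies\<close>

definition quotient_topology :: "'a topology \<Rightarrow> ('a \<Rightarrow> 'b) \<Rightarrow> 'b topology" where
  "quotient_topology X f =
     topology (\<lambda>U. U \<subseteq> f ` topspace X \<and> openin X {x \<in> topspace X. f x \<in> U})"

lemma openin_quotient_topology:
  "openin (quotient_topology X f) U \<longleftrightarrow>
     U \<subseteq> f ` topspace X \<and> openin X {x \<in> topspace X. f x \<in> U}"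
proof -
  let ?L = "\<lambda>U. U \<subseteq> f ` topspace X \<and> openin X {x \<in> topspace X. f x \<in> U}"
  have "?L (S \<inter> T)" if "?L S" "?L T" for S T
  proof -
    have "{x \<in> topspace X. f x \<in> S \<inter> T} =
        {x \<in> topspace X. f x \<in> S} \<inter> {x \<in> topspace X. f x \<in> T}" by blast
    with that show ?thesis by (simp add: openin_Int le_infI1)
  qed
  moreover have "?L (\<Union>K)" if K: "\<forall>S\<in>K. ?L S" for K
  proof -
    have "{x \<in> topspace X. f x \<in> \<Union>K} = \<Union>((\<lambda>S. {x \<in> topspace X. f x \<in> S}) ` K)" by blast
    moreover have "openin X (\<Union>((\<lambda>S. {x \<in> topspace X. f x \<in> S}) ` K))"
      using K by (intro openin_Union) blast
    moreover have "\<Union>K \<subseteq> f ` topspace X" using K by (intro Union_least) blast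
    ultimately show ?thesis by simp
  qed
  ultimately have "istopology ?L"
    unfolding istopology_def by blast
  then show ?thesis
    unfolding quotient_topology_def by (subst topology_inverse') (assumption, rule refl)
qed

lemma topspace_quotient_topology: "topspace (quotient_topology X f) = f ` topspace X"
proof (rule antisym)
  have "{x \<in> topspace X. f x \<in> f ` topspace X} = topspace X" by blast
  then have "openin (quotient_topology X f) (f ` topspace X)"
    by (simp add: openin_quotient_topology)
  then show "f ` topspace X \<subseteq> topspace (quotient_topology X f)" by (rule openin_subset)
  have "openin (quotient_topology X f) (topspace (quotient_topology X f))"
    by (rule openin_topspace)
  then show "topspace (quotient_topology X f) \<subseteq> f ` topspace X"
    unfolding openin_quotient_topology by (rule conjunct1)
qed

lemma quotient_map_quotient_topology: "quotient_map X (quotient_topology X f) f"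
  unfolding quotient_map_def topspace_quotient_topology openin_quotient_topology by simp


section \<open>Real projective space\<close>

text \<open>Projective \<open>n\<close>-space is the projectivisation of \<open>real^'m\<close> with \<open>CARD('m) = n + 1\<close>.
  A point is a line through the origin with the origin removed.\<close>

definition pt :: "real^'m \<Rightarrow> (real^'m) set" where
  "pt v = {c *\<^sub>R v | c. c \<noteq> 0}"

definition proj_space :: "(real^'m) set topology" where
  "proj_space = quotient_topology (top_of_set (- {0})) pt"

text \<open>A nonzero linear form \<open>v \<mapsto> a \<bullet> v\<close> gives the affine chart \<open>{[v]. a \<bullet> v \<noteq> 0}\<close>, identified with
  the affine hyperplane \<open>{v. a \<bullet> v = 1}\<close>.\<close>

definition affine_chart :: "real^'m \<Rightarrow> (real^'m) set set" where
  "affine_chart a = {pt v | v. a \<bullet> v \<noteq> 0}"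

definition in_chart :: "real^'m \<Rightarrow> (real^'m) set set \<Rightarrow> (real^'m) set" where
  "in_chart a S = {v. a \<bullet> v = 1 \<and> pt v \<in> S}"

definition chart_coord :: "real^'m \<Rightarrow> (real^'m) set \<Rightarrow> real^'m" where
  "chart_coord a p = (THE v. v \<in> p \<and> a \<bullet> v = 1)"

abbreviation proj_boundary :: "(real^'m) set set \<Rightarrow> (real^'m) set set" where
  "proj_boundary \<Omega> \<equiv> proj_space frontier_of \<Omega>"

definition chart_contains_closure :: "real^'m \<Rightarrow> (real^'m) set set \<Rightarrow> bool" where
  "chart_contains_closure a \<Omega> \<longleftrightarrow> a \<noteq> 0 \<and> proj_space closure_of \<Omega> \<subseteq> affine_chart a"

definition properly_convex :: "(real^'m) set set \<Rightarrow> bool" where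
  "properly_convex \<Omega> \<longleftrightarrow> (\<exists>a. chart_contains_closure a \<Omega> \<and> convex (in_chart a \<Omega>))"

text \<open>The segments with distinct end points lying in some affine chart are exactly the sets
  \<open>pt ` closed_segment u v\<close> with \<open>u\<close>, \<open>v\<close> nonzero and \<open>[u] \<noteq> [v]\<close>.\<close>

definition proj_strictly_convex :: "(real^'m) set set \<Rightarrow> bool" where
  "proj_strictly_convex \<Omega> \<longleftrightarrow>
     \<not> (\<exists>u v. u \<noteq> 0 \<and> v \<noteq> 0 \<and> pt u \<noteq> pt v \<and> pt ` closed_segment u v \<subseteq> proj_boundary \<Omega>)"

text \<open>In every affine chart the boundary is locally the zero set, within the hyperplane
  \<open>{x. a \<bullet> x = 1}\<close>, of a \<open>C\<^sup>1\<close> function \<open>f\<close> (with gradient \<open>g\<close>) whose differential does not vanish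
  on the tangent space \<open>{h. a \<bullet> h = 0}\<close> of that hyperplane.\<close>

definition C1_boundary :: "(real^'m) set set \<Rightarrow> bool" where
  "C1_boundary \<Omega> \<longleftrightarrow>
     (\<forall>a. \<forall>p \<in> in_chart a (proj_boundary \<Omega>).
        \<exists>U (f :: real^'m \<Rightarrow> real) g. open U \<and> p \<in> U \<and>
          (\<forall>x\<in>U. (f has_derivative (\<lambda>h. g x \<bullet> h)) (at x)) \<and> continuous_on U g \<and>
          (\<exists>h. a \<bullet> h = 0 \<and> g p \<bullet> h \<noteq> 0) \<and>
          {x \<in> U. a \<bullet> x = 1 \<and> pt x \<in> proj_boundary \<Omega>} = {x \<in> U. a \<bullet> x = 1 \<and> f x = 0})"


section \<open>Automorphisms and limit sets\<close>

definition SL :: "(real^'m^'m) monoid" where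
  "SL = \<lparr>carrier = {A. det A = 1}, mult = (\<lambda>A B. A ** B), one = mat 1\<rparr>"

lemma group_SL: "group (SL :: (real^'m^'m) monoid)"
proof (rule groupI)
  fix A :: "real^'m^'m" assume "A \<in> carrier SL"
  then have A: "det A = 1" by (simp add: SL_def)
  then have "invertible A" by (simp add: invertible_det_nz)
  then obtain B where B: "B ** A = mat 1" by (auto simp: invertible_def)
  then have "det (B ** A) = 1" by simp
  with A have "det B = 1" by (simp add: det_mul)
  with B show "\<exists>B\<in>carrier SL. B \<otimes>\<^bsub>SL\<^esub> A = \<one>\<^bsub>SL\<^esub>" by (auto simp: SL_def)
qed (simp_all add: SL_def det_mul matrix_mul_assoc)

definition proj_act :: "real^'m^'m \<Rightarrow> (real^'m) set \<Rightarrow> (real^'m) set" where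
  "proj_act A p = (\<lambda>v. A *v v) ` p"

lemma proj_act_pt: "proj_act A (pt v) = pt (A *v v)"
proof -
  have "A *v (c *\<^sub>R v) = c *\<^sub>R (A *v v)" for c
    by (simp add: matrix_vector_mult_scaleR)
  then show ?thesis
    unfolding proj_act_def pt_def setcompr_eq_image image_image by simp
qed

definition proj_Aut :: "(real^'m) set set \<Rightarrow> (real^'m^'m) set" where
  "proj_Aut \<Omega> = {A \<in> carrier SL. proj_act A ` \<Omega> = \<Omega>}"

definition torsion_free :: "(real^'m^'m) set \<Rightarrow> bool" where
  "torsion_free \<Gamma> \<longleftrightarrow> (\<forall>A\<in>\<Gamma>. \<forall>k::nat. k > 0 \<and> A [^]\<^bsub>SL\<^esub> k = \<one>\<^bsub>SL\<^esub> \<longrightarrow> A = \<one>\<^bsub>SL\<^esub>)"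

definition limit_set :: "(real^'m^'m) set \<Rightarrow> (real^'m) set \<Rightarrow> (real^'m) set set" where
  "limit_set \<Gamma> x = proj_space closure_of ((\<lambda>A. proj_act A x) ` \<Gamma>) - (\<lambda>A. proj_act A x) ` \<Gamma>"

definition non_elementary :: "(real^'m^'m) set \<Rightarrow> (real^'m) set \<Rightarrow> bool" where
  "non_elementary \<Gamma> x \<longleftrightarrow> infinite (limit_set \<Gamma> x)"


section \<open>The Hilbert distance\<close>

text \<open>In the chart \<open>a\<close>: the point where the open half-line from \<open>x\<close> in direction \<open>d\<close> meets the
  boundary.\<close>

definition boundary_hit :: "real^'m \<Rightarrow> (real^'m) set set \<Rightarrow> real^'m \<Rightarrow> real^'m \<Rightarrow> real^'m" where
  "boundary_hit a \<Omega> x d =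
     (THE p. p \<in> in_chart a (proj_boundary \<Omega>) \<and> (\<exists>s>0. p = x + s *\<^sub>R d))"

definition hilbert_dist ::
    "real^'m \<Rightarrow> (real^'m) set set \<Rightarrow> (real^'m) set \<Rightarrow> (real^'m) set \<Rightarrow> real" where
  "hilbert_dist a \<Omega> x y =
     (if x = y then 0 else
       (let X = chart_coord a x; Y = chart_coord a y;
            q = boundary_hit a \<Omega> X (X - Y); p = boundary_hit a \<Omega> X (Y - X)
        in 1/2 * ln ((norm (q - Y) * norm (p - X)) / (norm (q - X) * norm (p - Y)))))"


section \<open>The bundle of oriented directions and the geodesic flow\<close>

text \<open>A nonzero tangent vector of projective space at \<open>[v]\<close> is the velocity at \<open>s = 0\<close> of
  \<open>s \<mapsto> [v + s \<xi>]\<close> with \<open>\<xi>\<close> not a multiple of \<open>v\<close>; the pairs \<open>(v, \<xi>)\<close> and \<open>(l v, l (\<xi> + c v))\<close>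
  give the same tangent vector. Dividing further by positive scalars \<open>m\<close> yields the
  equivalence class \<open>dir v \<xi>\<close>.\<close>

definition dir :: "real^'m \<Rightarrow> real^'m \<Rightarrow> ((real^'m) \<times> (real^'m)) set" where
  "dir v \<xi> = {(l *\<^sub>R v, l *\<^sub>R (m *\<^sub>R \<xi> + c *\<^sub>R v)) | l m c. l \<noteq> 0 \<and> m > 0}"

text \<open>The direction bundle of the whole projective space, and its restriction to \<open>\<Omega>\<close>.
  The base point of a direction \<open>w\<close> is \<open>fst ` w\<close>.\<close>

definition dir_space :: "((real^'m) \<times> (real^'m)) set topology" where
  "dir_space = quotient_topology (top_of_set {(v, \<xi>). v \<noteq> 0 \<and> \<xi> \<notin> span {v}}) (\<lambda>(v, \<xi>). dir v \<xi>)"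

lemma base_point_dir: "fst ` dir v \<xi> = pt v"
proof
  show "pt v \<subseteq> fst ` dir v \<xi>"
  proof
    fix x assume "x \<in> pt v"
    then obtain c where "c \<noteq> 0" "x = c *\<^sub>R v" by (auto simp: pt_def)
    then have "(x, c *\<^sub>R (1 *\<^sub>R \<xi> + 0 *\<^sub>R v)) \<in> dir v \<xi>"
      unfolding dir_def using zero_less_one by blast
    then show "x \<in> fst ` dir v \<xi>" by (rule image_eqI[rotated]) simp
  qed
  show "fst ` dir v \<xi> \<subseteq> pt v"
    unfolding dir_def pt_def by fastforce
qed

definition H\<Omega> :: "(real^'m) set set \<Rightarrow> ((real^'m) \<times> (real^'m)) set topology" where
  "H\<Omega> \<Omega> = subtopology dir_space {w. fst ` w \<in> \<Omega>}"

text \<open>The representatives of \<open>w\<close> adapted to the chart \<open>a\<close>: the base point \<open>v\<close> in the chart and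
  a direction vector \<open>\<xi>\<close> parallel to the chart, unique up to a positive factor.\<close>

definition chart_reps ::
    "real^'m \<Rightarrow> ((real^'m) \<times> (real^'m)) set \<Rightarrow> ((real^'m) \<times> (real^'m)) set" where
  "chart_reps a w = {(v, \<xi>) \<in> w. a \<bullet> v = 1 \<and> a \<bullet> \<xi> = 0}"

definition fwd_end ::
    "real^'m \<Rightarrow> (real^'m) set set \<Rightarrow> ((real^'m) \<times> (real^'m)) set \<Rightarrow> (real^'m) set" where
  "fwd_end a \<Omega> w = (THE p. \<exists>(v, \<xi>) \<in> chart_reps a w. p = pt (boundary_hit a \<Omega> v \<xi>))"

definition bwd_end ::
    "real^'m \<Rightarrow> (real^'m) set set \<Rightarrow> ((real^'m) \<times> (real^'m)) set \<Rightarrow> (real^'m) set" where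
  "bwd_end a \<Omega> w = (THE p. \<exists>(v, \<xi>) \<in> chart_reps a w. p = pt (boundary_hit a \<Omega> v (- \<xi>)))"

definition geodesic_flow ::
    "real^'m \<Rightarrow> (real^'m) set set \<Rightarrow> real \<Rightarrow> ((real^'m) \<times> (real^'m)) set \<Rightarrow> ((real^'m) \<times> (real^'m)) set"
  where
  "geodesic_flow a \<Omega> t w =
     (THE w'. \<exists>(v, \<xi>) \<in> chart_reps a w. \<exists>s.
        w' = dir (v + s *\<^sub>R \<xi>) \<xi> \<and> pt (v + s *\<^sub>R \<xi>) \<in> \<Omega> \<and>
        sgn s = sgn t \<and> hilbert_dist a \<Omega> (pt v) (pt (v + s *\<^sub>R \<xi>)) = \<bar>t\<bar>)"


section \<open>The quotient by the group\<close>

definition dir_act ::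
    "real^'m^'m \<Rightarrow> ((real^'m) \<times> (real^'m)) set \<Rightarrow> ((real^'m) \<times> (real^'m)) set" where
  "dir_act A w = (\<lambda>(v, \<xi>). (A *v v, A *v \<xi>)) ` w"

definition dir_orbit ::
    "(real^'m^'m) set \<Rightarrow> ((real^'m) \<times> (real^'m)) set \<Rightarrow> ((real^'m) \<times> (real^'m)) set set" where
  "dir_orbit \<Gamma> w = (\<lambda>A. dir_act A w) ` \<Gamma>"

definition HM ::
    "(real^'m) set set \<Rightarrow> (real^'m^'m) set \<Rightarrow> ((real^'m) \<times> (real^'m)) set set topology" where
  "HM \<Omega> \<Gamma> = quotient_topology (H\<Omega> \<Omega>) (dir_orbit \<Gamma>)"

text \<open>The flow on \<open>H\<Omega>\<close> commutes with the group, so it maps orbits to orbits.\<close>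

definition geodesic_flow_HM ::
    "real^'m \<Rightarrow> (real^'m) set set \<Rightarrow> real \<Rightarrow>
     ((real^'m) \<times> (real^'m)) set set \<Rightarrow> ((real^'m) \<times> (real^'m)) set set" where
  "geodesic_flow_HM a \<Omega> t c = geodesic_flow a \<Omega> t ` c"

definition NW ::
    "real^'m \<Rightarrow> (real^'m) set set \<Rightarrow> (real^'m^'m) set \<Rightarrow> (real^'m) set \<Rightarrow>
     ((real^'m) \<times> (real^'m)) set set set" where
  "NW a \<Omega> \<Gamma> x = dir_orbit \<Gamma> `
     {w \<in> topspace (H\<Omega> \<Omega>). fwd_end a \<Omega> w \<in> limit_set \<Gamma> x \<and> bwd_end a \<Omega> w \<in> limit_set \<Gamma> x}"

definition topologically_mixing :: "'a topology \<Rightarrow> (real \<Rightarrow> 'a \<Rightarrow> 'a) \<Rightarrow> bool" where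
  "topologically_mixing Y \<phi> \<longleftrightarrow>
     (\<forall>U V. openin Y U \<and> openin Y V \<and> U \<noteq> {} \<and> V \<noteq> {} \<longrightarrow>
        (\<exists>T. \<forall>t\<ge>T. \<phi> t ` U \<inter> V \<noteq> {}))"

end

theory Submission
  imports Defs
begin

text \<open>
  Let \<open>C\<close> be the open convex cone over \<open>\<Omega>\<close>, on the positive side of the form \<open>a\<close>, and let \<open>G\<close> consist of
  the matrices \<open>\<plusminus>A\<close>, \<open>A \<in> \<Gamma>\<close>, that map \<open>C\<close> to itself. A direction \<open>w\<close> with \<open>w\<^sup>- = [p]\<close> and \<open>w\<^sup>+ = [q]\<close> is
  recorded by a pair of non-proportional vectors \<open>(p, q)\<close> in the boundary of \<open>C\<close>: its base point is
  \<open>[p + q]\<close>, and only the common positive multiples of \<open>p\<close> and \<open>q\<close> give the same direction. In these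
  coordinates the matrices act linearly, and since the Hilbert distance is half the logarithm of a
  cross-ratio, the flow is \<open>\<phi>\<^sup>t (p, q) = (e\<^sup>-\<^sup>t p, e\<^sup>t q)\<close> (\<open>geodesic_flow_ray\<close>).

  Mixing thus becomes a statement about matrices. Let \<open>(p, q)\<close> and \<open>(p', q')\<close> be directions with ends in
  the limit set. If \<open>g \<in> G\<close> satisfies \<open>g q' = \<sigma> q\<^sub>1\<close> and \<open>g\<inverse> p = \<tau> p\<^sub>2\<close>, where \<open>q\<^sub>1\<close> is near \<open>q\<close>, \<open>p\<^sub>2\<close> is near
  \<open>p'\<close> and \<open>\<sigma> \<tau> = e\<^sup>2\<^sup>t\<close>, then \<open>g\<close> maps \<open>(p\<^sub>2, q')\<close> to a multiple of \<open>\<phi>\<^sup>t (p, q\<^sub>1)\<close>: the flow takes a point near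
  the first direction to a translate of a point near the second in time exactly \<open>t\<close>. All that has to be
  shown is that such a \<open>g\<close> exists for every large \<open>t\<close> (\<open>all_large_times_realized\<close>).

  If \<open>g\<^sub>n \<in> G\<close> leaves every bounded set, strict convexity forces the limits of \<open>g\<^sub>n / \<parallel>g\<^sub>n\<parallel>\<close> to be matrices
  of rank one whose image is a boundary ray and whose kernel supports \<open>C\<close> at a boundary ray
  (\<open>diverging_limits\<close>). Such limits yield a loxodromic \<open>\<gamma> \<in> G\<close>: it fixes two boundary rays \<open>x\<close> and \<open>y\<close>,
  and its powers, rescaled by the eigenvalue \<open>\<rho>\<close> of \<open>x\<close>, converge to the projection onto \<open>x\<close> with kernel
  \<open>\<alpha> = 0\<close>, a hyperplane through \<open>y\<close>; likewise for \<open>\<gamma>\<inverse>\<close>, with a form \<open>\<beta>\<close> (\<open>ex_loxodromic\<close>). Consider the words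
  \<open>u \<gamma>\<^sup>k h \<gamma>\<^sup>l h' \<dots> \<gamma>\<^sup>m v\<close> with large exponents. They contract almost everything to \<open>u x\<close>, their inverses
  contract almost everything to \<open>v\<inverse> y\<close>, and the number \<open>ln (\<sigma> \<tau>)\<close> tends to a constant depending on the
  ends \<open>u, v\<close>, plus \<open>k + l + \<dots> + m\<close> times the period \<open>ln \<rho> - ln \<mu>\<close>, plus one term
  \<open>ln (\<alpha> \<bullet> h x) + ln (\<beta> \<bullet> h\<inverse> y)\<close> for each letter \<open>h\<close>. The orbits of \<open>x\<close> and \<open>y\<close> are dense in
  the limit set (\<open>attracting_orbit_dense\<close>), so \<open>u\<close> and \<open>v\<close> can be chosen at will, and it
  remains to see that the contributions of the inner words, the \<open>translation_values\<close>, are dense in the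
  real line; finitely many of them then suffice for all large \<open>t\<close>.

  The translation values form a semigroup that contains both signs of the period, so their
  closure is a group. It contains the logarithms of the cross-ratios
  \<open>\<langle>X\<^sub>1, X\<^sub>2\<rangle> \<langle>X\<^sub>3, X\<^sub>4\<rangle> / (\<langle>X\<^sub>1, X\<^sub>4\<rangle> \<langle>X\<^sub>3, X\<^sub>2\<rangle>)\<close>, where \<open>\<langle>X, Y\<rangle>\<close> is the trace of \<open>X Y\<close> and each \<open>X\<^sub>i\<close> is a conjugate
  \<open>h (x \<otimes> \<beta>) h\<inverse>\<close>. When the boundary points below \<open>X\<^sub>1\<close> and \<open>X\<^sub>3\<close> approach each other such a cross-ratio tends
  to \<open>1\<close>. If the group were discrete, it would eventually equal \<open>1\<close>, for all \<open>X\<^sub>2, X\<^sub>4\<close> in a finite family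
  that spans all conjugates based at other points than the limit; so \<open>X\<^sub>1\<close> and \<open>X\<^sub>3\<close> would define proportional linear
  functionals on that span. But \<open>X\<^sub>3\<close> is in the span, and \<open>\<langle>X\<^sub>3, X\<^sub>3\<rangle> = 0 < \<langle>X\<^sub>1, X\<^sub>3\<rangle>\<close> by strict convexity
  (\<open>small_translation_values\<close>).
\<close>

section \<open>Rank-one matrices and limits of matrices\<close>

text \<open>The tensor \<open>x \<otimes> \<psi>\<close>, acting as \<open>v \<mapsto> (\<psi> \<bullet> v) x\<close>.\<close>

definition outer :: "real^'m \<Rightarrow> real^'m \<Rightarrow> real^'m^'m" where
  "outer x \<psi> = (\<chi> i j. x $ i * \<psi> $ j)"

lemma outer_mv: "outer x \<psi> *v v = (\<psi> \<bullet> v) *\<^sub>R x"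
  by (simp add: outer_def matrix_vector_mult_def vec_eq_iff inner_vec_def sum_distrib_left mult_ac)

lemma outer_scaleR: "outer (c *\<^sub>R x) \<psi> = c *\<^sub>R outer x \<psi>" "outer x (c *\<^sub>R \<psi>) = c *\<^sub>R outer x \<psi>"
  by (simp_all add: outer_def vec_eq_iff mult_ac)

lemma mv_scaleR_left: "(c *\<^sub>R A) *v (v :: real^'n) = c *\<^sub>R (A *v v)"
  by (simp add: matrix_vector_mult_def vec_eq_iff sum_distrib_left mult_ac)

lemma mv_minus_left: "(- A) *v (v :: real^'n) = - (A *v v)"
  by (simp add: matrix_vector_mult_def vec_eq_iff sum_negf)

lemma mm_scaleR: "(c *\<^sub>R A) ** (d *\<^sub>R B) = (c * d) *\<^sub>R (A ** (B :: real^'k^'n))"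
  by (simp add: matrix_matrix_mult_def vec_eq_iff sum_distrib_left mult_ac)

lemma matrix_eqI: "(\<And>v :: real^'n. A *v v = B *v v) \<Longrightarrow> A = B"
  by (simp add: matrix_eq)

lemma tendsto_mv:
  fixes A :: "'a \<Rightarrow> real^'n^'k"
  assumes "(A \<longlongrightarrow> L) F" "(v \<longlongrightarrow> w) F"
  shows "((\<lambda>n. A n *v v n) \<longlongrightarrow> L *v w) F"
  unfolding matrix_vector_mult_def
  by (intro vec_tendstoI) (auto intro!: tendsto_sum tendsto_mult tendsto_vec_nth assms)

lemma tendsto_mm:
  fixes A :: "'a \<Rightarrow> real^'n^'k" and B :: "'a \<Rightarrow> real^'l^'n"
  assumes "(A \<longlongrightarrow> L) F" "(B \<longlongrightarrow> M) F"
  shows "((\<lambda>n. A n ** B n) \<longlongrightarrow> L ** M) F"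
  unfolding matrix_matrix_mult_def
  by (intro vec_tendstoI) (auto intro!: tendsto_sum tendsto_mult tendsto_vec_nth assms)

lemma inner_mv_transpose: "(u :: real^'n) \<bullet> (A *v v) = (u v* A) \<bullet> v"
  by (simp add: dot_lmul_matrix)

lemma outer_mult_left: "h ** outer x \<psi> = outer (h *v x) \<psi>"
  by (rule matrix_eqI) (simp add: outer_mv matrix_vector_mul_assoc[symmetric] matrix_vector_mult_scaleR)

lemma outer_mult_right: "outer x \<psi> ** h = outer x (\<psi> v* h)"
  by (rule matrix_eqI) (simp add: outer_mv matrix_vector_mul_assoc[symmetric] inner_mv_transpose)

lemma outer_mult_outer: "outer x \<psi> ** outer y \<eta> = (\<psi> \<bullet> y) *\<^sub>R outer x \<eta>"
  by (rule matrix_eqI) (simp add: outer_mv matrix_vector_mul_assoc[symmetric] mv_scaleR_left)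

lemma outer_inj:
  assumes "outer x \<psi> = outer x \<eta>" "x \<noteq> 0" shows "\<psi> = \<eta>"
proof -
  have "(\<psi> \<bullet> v) *\<^sub>R x = (\<eta> \<bullet> v) *\<^sub>R x" for v
    using assms(1) by (metis outer_mv)
  then have "\<psi> \<bullet> v = \<eta> \<bullet> v" for v using assms(2) by simp
  then show ?thesis by (metis inner_commute vector_eq_rdot)
qed

lemma mm_add_left: "(A + B) ** D = A ** D + B ** (D :: real^'n^'n)"
  by (rule matrix_eqI) (simp add: matrix_vector_mul_assoc[symmetric] matrix_vector_mult_add_rdistrib)

lemma mm_diff_left: "(A - B) ** D = A ** D - B ** (D :: real^'n^'n)"
  by (rule matrix_eqI) (simp add: matrix_vector_mul_assoc[symmetric] matrix_vector_mult_diff_rdistrib)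

lemma mm_diff_right: "D ** (A - B) = D ** A - D ** (B :: real^'n^'n)"
  by (rule matrix_eqI) (simp add: matrix_vector_mul_assoc[symmetric] matrix_vector_mult_diff_rdistrib
      matrix_vector_mult_diff_distrib)

lemma bounded_matrix_mult:
  "\<exists>K>0. \<forall>(A :: real^'n^'n) (B :: real^'n^'n). norm (A ** B) \<le> norm A * norm B * K"
proof -
  have "bilinear ((**) :: real^'n^'n \<Rightarrow> real^'n^'n \<Rightarrow> real^'n^'n)"
    unfolding bilinear_def
    using mm_scaleR[of 1] mm_scaleR[of _ _ 1]
    by (intro conjI allI linearI) (simp_all add: matrix_add_ldistrib mm_add_left)
  then have "bounded_bilinear ((**) :: real^'n^'n \<Rightarrow> real^'n^'n \<Rightarrow> real^'n^'n)"
    by (simp add: bilinear_conv_bounded_bilinear)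
  then show ?thesis using bounded_bilinear.pos_bounded by blast
qed

lemma tendsto_det:
  fixes f :: "nat \<Rightarrow> real^'n^'n"
  assumes "f \<longlonglongrightarrow> L" shows "(\<lambda>n. det (f n)) \<longlonglongrightarrow> det L"
  unfolding det_def by (intro tendsto_sum tendsto_mult tendsto_const tendsto_prod tendsto_vec_nth assms)

lemma matrix_inv_cancel:
  fixes A :: "real^'n^'n" assumes "invertible A"
  shows "A ** matrix_inv A = mat 1" "matrix_inv A ** A = mat 1"
    "A *v (matrix_inv A *v v) = v" "matrix_inv A *v (A *v v) = v"
proof -
  show 1: "A ** matrix_inv A = mat 1" "matrix_inv A ** A = mat 1"
    using assms unfolding invertible_def matrix_inv_def
    by (metis (mono_tags, lifting) someI_ex)+
  show "A *v (matrix_inv A *v v) = v" "matrix_inv A *v (A *v v) = v"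
    using 1 by (simp_all add: matrix_vector_mul_assoc)
qed

lemma matrix_inv_eqI:
  fixes A :: "real^'n^'n" assumes "A ** B = mat 1"
  shows "matrix_inv A = B"
proof -
  have "B ** A = mat 1" using assms matrix_left_right_inverse by blast
  then have "invertible A" using assms by (auto simp: invertible_def)
  then have "matrix_inv A ** (A ** B) = B" by (simp add: matrix_mul_assoc matrix_inv_cancel)
  then show ?thesis using assms by simp
qed

lemma sphere_subseq:
  fixes g :: "nat \<Rightarrow> 'a::euclidean_space"
  obtains r L where "strict_mono (r :: nat \<Rightarrow> nat)" "(\<lambda>n. (1 / norm (g (r n))) *\<^sub>R g (r n)) \<longlonglongrightarrow> L"
proof -
  define f where "f n = (1 / norm (g n)) *\<^sub>R g n" for n
  have "seq_compact (cball (0::'a) 1)" by (simp add: compact_imp_seq_compact)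
  moreover have "\<forall>n. f n \<in> cball 0 1"
    by (simp add: f_def)
  ultimately obtain L r where "strict_mono (r :: nat \<Rightarrow> nat)" "(f \<circ> r) \<longlonglongrightarrow> L"
    by (blast elim: seq_compactE)
  then show ?thesis using that[of r L] by (simp add: o_def f_def)
qed

lemma closure_limI:
  fixes f :: "nat \<Rightarrow> 'a::metric_space"
  assumes "\<And>n. f n \<in> S" "f \<longlonglongrightarrow> x" shows "x \<in> closure S"
  using assms unfolding closure_sequential by blast

lemma nonneg_on_open_pos:
  fixes \<psi> :: "'a::real_inner"
  assumes "open C" "\<psi> \<noteq> 0" "\<And>z. z \<in> C \<Longrightarrow> \<psi> \<bullet> z \<ge> 0" "x \<in> C"
  shows "\<psi> \<bullet> x > 0"
proof -
  obtain e where e: "e > 0" "ball x e \<subseteq> C" using openE[OF assms(1,4)] by blast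
  have n: "norm \<psi> > 0" using assms by simp
  define d where "d = e / (2 * norm \<psi>)"
  have d: "d > 0" using e n by (simp add: d_def)
  have "norm (d *\<^sub>R \<psi>) = e / 2" using e n by (simp add: d_def)
  then have "x - d *\<^sub>R \<psi> \<in> ball x e" using e by (simp add: dist_norm)
  then have "\<psi> \<bullet> (x - d *\<^sub>R \<psi>) \<ge> 0" using assms e by blast
  moreover have "d * (\<psi> \<bullet> \<psi>) > 0" using d n by simp
  ultimately show ?thesis by (simp add: inner_diff_right)
qed

text \<open>The power operation of the type class \<^class>\<open>power\<close> is entrywise on matrices.\<close>

primrec mpow :: "real^'n^'n \<Rightarrow> nat \<Rightarrow> real^'n^'n" where
  "mpow A 0 = mat 1"
| "mpow A (Suc n) = A ** mpow A n"

lemma mpow_add: "mpow A (m + n) = mpow A m ** mpow A n"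
  by (induction m) (simp_all add: matrix_mul_assoc)

lemma mpow_commute: "mpow A m ** mpow A n = mpow A n ** mpow A m"
  by (metis mpow_add add.commute)

lemma mpow_eigen: "A *v v = c *\<^sub>R v \<Longrightarrow> mpow A n *v v = c ^ n *\<^sub>R v"
  by (induction n) (simp_all add: matrix_vector_mul_assoc[symmetric] matrix_vector_mult_scaleR)

lemma mpow_mult: "mpow (mpow A d) n = mpow A (d * n)"
  by (induction n) (simp_all add: mpow_add)

section \<open>Discrete groups preserving a strictly convex cone\<close>

text \<open>The setting of the dynamical part: a sharp open cone, sharpness being witnessed by a form \<open>a\<close>
  that is positive on the closure, and a discrete group of matrices that preserve it. Discreteness enters
  as finiteness of the bounded parts of \<open>G\<close>. Assumption \<open>strict\<close> is strict convexity in dual form: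
  a supporting hyperplane touches the closed cone along a single ray.\<close>

locale cone_group =
  fixes C :: "(real^'m) set" and a :: "real^'m" and G :: "(real^'m^'m) set"
  assumes openC: "open C" and convexC: "convex C" and C_nonempty: "C \<noteq> {}"
    and C_scale: "\<And>x c. x \<in> C \<Longrightarrow> c > 0 \<Longrightarrow> c *\<^sub>R x \<in> C"
    and a_pos: "\<And>x. x \<in> C \<Longrightarrow> a \<bullet> x > 0"
    and a_pos_closure: "\<And>x. x \<in> closure C \<Longrightarrow> x \<noteq> 0 \<Longrightarrow> a \<bullet> x > 0"
    and strict: "\<And>\<psi> x y. \<psi> \<noteq> 0 \<Longrightarrow> (\<And>z. z \<in> C \<Longrightarrow> \<psi> \<bullet> z \<ge> 0) \<Longrightarrow>
          x \<in> closure C \<Longrightarrow> y \<in> closure C \<Longrightarrow> a \<bullet> x = 1 \<Longrightarrow> a \<bullet> y = 1 \<Longrightarrow>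
          \<psi> \<bullet> x = 0 \<Longrightarrow> \<psi> \<bullet> y = 0 \<Longrightarrow> x = y"
    and G_one: "mat 1 \<in> G"
    and G_mult: "\<And>A B. A \<in> G \<Longrightarrow> B \<in> G \<Longrightarrow> A ** B \<in> G"
    and G_inv: "\<And>A. A \<in> G \<Longrightarrow> matrix_inv A \<in> G"
    and G_invertible: "\<And>A. A \<in> G \<Longrightarrow> invertible A"
    and G_C: "\<And>A x. A \<in> G \<Longrightarrow> x \<in> C \<Longrightarrow> A *v x \<in> C"
    and G_finite: "\<And>R. finite {A \<in> G. norm A \<le> R}"
begin

definition supporting :: "(real^'m) \<Rightarrow> bool" where
  "supporting \<psi> \<longleftrightarrow> \<psi> \<noteq> 0 \<and> (\<forall>z\<in>C. \<psi> \<bullet> z \<ge> 0)"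

definition bd :: "(real^'m) set" where
  "bd = closure C - C - {0}"

text \<open>The representative of a ray in the affine hyperplane \<open>a \<bullet> v = 1\<close>. Two boundary vectors span the same
  ray if and only if their values under \<open>pr\<close> agree, which is how distinctness of boundary points is
  expressed below.\<close>

definition pr :: "(real^'m) \<Rightarrow> real^'m" where
  "pr x = (1 / (a \<bullet> x)) *\<^sub>R x"

text \<open>A sequence in the group that converges, after rescaling by positive numbers, to a rank-one matrix.
  Geometrically, \<open>g n\<close> contracts everything off the hyperplane \<open>\<psi> = 0\<close> to the boundary point \<open>[x]\<close>, and
  \<open>A n\<close> records the rate.\<close>

definition scaled_lim :: "(nat \<Rightarrow> real^'m^'m) \<Rightarrow> (nat \<Rightarrow> real) \<Rightarrow> (real^'m) \<Rightarrow> (real^'m) \<Rightarrow> bool" where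
  "scaled_lim g A x \<psi> \<longleftrightarrow> (\<forall>n. g n \<in> G \<and> A n > 0) \<and> x \<in> bd \<and> supporting \<psi> \<and>
     (\<lambda>n. (1 / A n) *\<^sub>R g n) \<longlonglongrightarrow> outer x \<psi>"

lemma closure_scale: "x \<in> closure C \<Longrightarrow> c > 0 \<Longrightarrow> c *\<^sub>R x \<in> closure C"
proof -
  assume x: "x \<in> closure C" and c: "c > 0"
  then obtain f where f: "\<And>n. f n \<in> C" "f \<longlonglongrightarrow> x" by (auto simp: closure_sequential)
  have "(\<lambda>n. c *\<^sub>R f n) \<longlonglongrightarrow> c *\<^sub>R x" by (intro tendsto_intros f)
  moreover have "\<And>n. c *\<^sub>R f n \<in> C" using f c C_scale by blast
  ultimately show ?thesis by (rule closure_limI[rotated])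
qed

lemma C_add: "x \<in> C \<Longrightarrow> y \<in> C \<Longrightarrow> x + y \<in> C"
proof -
  assume "x \<in> C" "y \<in> C"
  then have "(1/2) *\<^sub>R x + (1/2) *\<^sub>R y \<in> C" by (intro convexD[OF convexC]) auto
  then have "2 *\<^sub>R ((1/2) *\<^sub>R x + (1/2) *\<^sub>R y) \<in> C" using C_scale by fastforce
  then show ?thesis by (simp add: scaleR_add_right)
qed

lemma bd_scale: "x \<in> bd \<Longrightarrow> c > 0 \<Longrightarrow> c *\<^sub>R x \<in> bd"
proof -
  assume x: "x \<in> bd" and c: "c > 0"
  have "c *\<^sub>R x \<notin> C"
  proof
    assume "c *\<^sub>R x \<in> C"
    from C_scale[OF this, of "1/c"] have "x \<in> C" using c by simp
    then show False using x by (simp add: bd_def)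
  qed
  then show ?thesis using x c closure_scale by (auto simp: bd_def)
qed

lemma bd_pos: "x \<in> bd \<Longrightarrow> a \<bullet> x > 0"
  by (auto simp: bd_def intro: a_pos_closure)

lemma pr_bd: "x \<in> bd \<Longrightarrow> pr x \<in> bd \<and> a \<bullet> pr x = 1"
  using bd_pos[of x] by (auto simp: pr_def intro: bd_scale)

lemma pr_scale: "c \<noteq> 0 \<Longrightarrow> pr (c *\<^sub>R x) = pr x"
  by (simp add: pr_def)

lemma pr_id: "a \<bullet> x = 1 \<Longrightarrow> pr x = x"
  by (simp add: pr_def)

lemma pr_scaled: "x \<in> bd \<Longrightarrow> x = (a \<bullet> x) *\<^sub>R pr x"
  using bd_pos[of x] by (simp add: pr_def)

lemma supporting_pos: "supporting \<psi> \<Longrightarrow> x \<in> C \<Longrightarrow> \<psi> \<bullet> x > 0"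
  by (rule nonneg_on_open_pos[OF openC]) (auto simp: supporting_def)

lemma supporting_closure:
  assumes "supporting \<psi>" "x \<in> closure C" shows "\<psi> \<bullet> x \<ge> 0"
proof -
  obtain f where f: "\<And>n. f n \<in> C" "f \<longlonglongrightarrow> x" using assms by (auto simp: closure_sequential)
  have "(\<lambda>n. \<psi> \<bullet> f n) \<longlonglongrightarrow> \<psi> \<bullet> x" by (intro tendsto_intros f)
  then show ?thesis using f assms by (intro LIMSEQ_le_const) (auto simp: supporting_def)
qed

lemma supporting_strict:
  assumes "supporting \<psi>" "x \<in> bd" "y \<in> bd" "\<psi> \<bullet> x = 0" "pr x \<noteq> pr y"
  shows "\<psi> \<bullet> y > 0"
proof (rule ccontr)
  assume "\<not> \<psi> \<bullet> y > 0"
  then have y0: "\<psi> \<bullet> y = 0" using supporting_closure[OF assms(1), of y] assms(3) by (auto simp: bd_def)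
  have "pr x = pr y"
    using assms pr_bd[of x] pr_bd[of y] y0
    by (intro strict[of \<psi>]) (auto simp: supporting_def bd_def pr_def)
  then show False using assms by simp
qed

lemma supporting_zero_bd:
  assumes "supporting \<psi>" "x \<in> closure C" "x \<noteq> 0" "\<psi> \<bullet> x = 0"
  shows "x \<in> bd"
  using assms supporting_pos[of \<psi> x] by (auto simp: bd_def)

text \<open>Separate \<open>x\<close> from the cone; homogeneity turns the separating affine form into a linear one.\<close>

lemma supporting_exists:
  assumes "x \<in> bd" shows "\<exists>\<psi>. supporting \<psi> \<and> \<psi> \<bullet> x = 0"
proof -
  have "{x} \<inter> C = {}" using assms by (auto simp: bd_def)
  then obtain \<psi> b where \<psi>: "\<psi> \<noteq> 0" "\<psi> \<bullet> x \<le> b" "\<And>z. z \<in> C \<Longrightarrow> b \<le> \<psi> \<bullet> z"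
    using separating_hyperplane_sets[of "{x}" C] convexC C_nonempty by auto
  have pos: "\<psi> \<bullet> z \<ge> 0" if z: "z \<in> C" for z
  proof (rule ccontr)
    assume n: "\<not> \<psi> \<bullet> z \<ge> 0"
    define c where "c = (\<bar>b\<bar> + 1) / (- (\<psi> \<bullet> z))"
    have "c > 0" unfolding c_def using n by (intro divide_pos_pos) auto
    then have "b \<le> \<psi> \<bullet> (c *\<^sub>R z)" using \<psi> C_scale z by blast
    also have "\<dots> = - (\<bar>b\<bar> + 1)" using n by (simp add: c_def field_simps)
    finally show False by simp
  qed
  obtain z where z: "z \<in> C" using C_nonempty by blast
  have b: "b \<le> 0"
  proof (rule ccontr)
    assume n: "\<not> b \<le> 0"
    have "\<psi> \<bullet> z \<ge> b" using \<psi> z by blast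
    then have pz: "\<psi> \<bullet> z > 0" using n by simp
    have "b \<le> \<psi> \<bullet> ((b / (2 * (\<psi> \<bullet> z))) *\<^sub>R z)"
      using n pz by (intro \<psi>(3) C_scale[OF z]) simp
    then show False using n pz by simp
  qed
  have s: "supporting \<psi>" using \<psi> pos by (simp add: supporting_def)
  then have "\<psi> \<bullet> x \<ge> 0" using supporting_closure assms by (auto simp: bd_def)
  then show ?thesis using s b \<psi> by force
qed

text \<open>If \<open>x + y\<close> were a boundary point, a form supporting the cone there would vanish at both \<open>x\<close> and \<open>y\<close>.\<close>

lemma bd_add_C:
  assumes "x \<in> bd" "y \<in> bd" "pr x \<noteq> pr y" shows "x + y \<in> C"
proof (rule ccontr)
  assume n: "x + y \<notin> C"
  obtain f g where f: "\<And>n. f n \<in> C" "f \<longlonglongrightarrow> x" and g: "\<And>n. g n \<in> C" "g \<longlonglongrightarrow> y"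
    using assms by (auto simp: bd_def closure_sequential)
  have "(\<lambda>n. f n + g n) \<longlonglongrightarrow> x + y" by (intro tendsto_intros f g)
  moreover have "\<And>n. f n + g n \<in> C" using f g C_add by blast
  ultimately have cl: "x + y \<in> closure C" by (rule closure_limI[rotated])
  have "a \<bullet> (x + y) > 0" using bd_pos assms by (simp add: inner_add_right add_pos_pos)
  then have "x + y \<in> bd" using cl n by (auto simp: bd_def)
  then obtain \<psi> where \<psi>: "supporting \<psi>" "\<psi> \<bullet> (x + y) = 0" using supporting_exists by blast
  have "\<psi> \<bullet> x \<ge> 0" "\<psi> \<bullet> y \<ge> 0" using \<psi> assms supporting_closure by (auto simp: bd_def)
  then have "\<psi> \<bullet> x = 0" "\<psi> \<bullet> y = 0" using \<psi> by (auto simp: inner_add_right)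
  then show False using supporting_strict[OF \<psi>(1) assms(1,2) _ assms(3)] by simp
qed

lemma G_cancel:
  assumes "A \<in> G"
  shows "A ** matrix_inv A = mat 1" "matrix_inv A ** A = mat 1"
    "A *v (matrix_inv A *v v) = v" "matrix_inv A *v (A *v v) = v"
  using matrix_inv_cancel[OF G_invertible[OF assms]] by auto

lemma inv_mult: "A \<in> G \<Longrightarrow> B \<in> G \<Longrightarrow> matrix_inv (A ** B) = matrix_inv B ** matrix_inv A"
  by (rule matrix_inv_eqI)
    (metis G_cancel(1) matrix_mul_assoc matrix_mul_lid)

lemma inv_inv: "A \<in> G \<Longrightarrow> matrix_inv (matrix_inv A) = A"
  by (rule matrix_inv_eqI) (simp add: G_cancel)

lemma inv_one: "matrix_inv (mat 1 :: real^'m^'m) = mat 1"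
  by (rule matrix_inv_eqI) simp

lemma G_mv_nonzero: "A \<in> G \<Longrightarrow> v \<noteq> 0 \<Longrightarrow> A *v v \<noteq> 0"
  by (metis G_cancel(4) matrix_vector_mult_0_right)

lemma G_nonzero: "A \<in> G \<Longrightarrow> A \<noteq> 0"
proof
  assume "A \<in> G" "A = 0"
  then have "axis undefined 1 = (0 :: real^'m)" using G_mv_nonzero by force
  then show False by simp
qed

lemma G_C_iff: "A \<in> G \<Longrightarrow> A *v v \<in> C \<longleftrightarrow> v \<in> C"
  by (metis G_cancel(4) G_C G_inv)

lemma G_closure: "A \<in> G \<Longrightarrow> v \<in> closure C \<Longrightarrow> A *v v \<in> closure C"
proof -
  assume A: "A \<in> G" and v: "v \<in> closure C"
  obtain f where f: "\<And>n. f n \<in> C" "f \<longlonglongrightarrow> v" using v by (auto simp: closure_sequential)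
  have "(\<lambda>n. A *v f n) \<longlonglongrightarrow> A *v v" by (intro tendsto_mv tendsto_const f)
  moreover have "\<And>n. A *v f n \<in> C" using A f G_C by blast
  ultimately show ?thesis by (rule closure_limI[rotated])
qed

lemma G_bd: "A \<in> G \<Longrightarrow> v \<in> bd \<Longrightarrow> A *v v \<in> bd"
  using G_closure G_C_iff G_mv_nonzero by (auto simp: bd_def)

lemma supporting_transpose:
  assumes "A \<in> G" "supporting \<psi>" shows "supporting (\<psi> v* A)"
proof -
  have "(\<psi> v* A) \<bullet> v = \<psi> \<bullet> (A *v v)" for v
    by (simp add: inner_mv_transpose)
  moreover obtain z where "z \<in> C" using C_nonempty by blast
  ultimately show ?thesis using assms G_C supporting_pos
    unfolding supporting_def by (metis inner_zero_left less_irrefl)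
qed

lemma pr_mult_eq_iff:
  assumes "A \<in> G" "x \<in> bd" "y \<in> bd"
  shows "pr (A *v x) = pr (A *v y) \<longleftrightarrow> pr x = pr y"
proof -
  have *: "pr (B *v u) = pr (B *v w)" if "B \<in> G" "u \<in> bd" "w \<in> bd" "pr u = pr w" for B u w
  proof -
    have "u = (a \<bullet> u) *\<^sub>R pr w" "w = (a \<bullet> w) *\<^sub>R pr w"
      using that pr_scaled[of u] pr_scaled[of w] by auto
    then have "B *v u = (a \<bullet> u) *\<^sub>R (B *v pr w)" "B *v w = (a \<bullet> w) *\<^sub>R (B *v pr w)"
      by (metis matrix_vector_mult_scaleR)+
    then show ?thesis using bd_pos[of u] bd_pos[of w] that by (simp add: pr_scale)
  qed
  show ?thesis
    using *[OF assms] *[OF G_inv[OF assms(1)] G_bd[OF assms(1,2)] G_bd[OF assms(1,3)]]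
      G_cancel(4)[OF assms(1)] by auto
qed

section \<open>Limits of diverging sequences\<close>

text \<open>The limit \<open>L\<close> maps \<open>C\<close> to its closure. No image of a point of \<open>C\<close> is zero, because the closed cone
  contains no line and \<open>L \<noteq> 0\<close>; none lies in \<open>C\<close>, because the kernel direction would then give a whole line
  inside \<open>C\<close>. So \<open>L\<close> maps the convex set \<open>C\<close> into the boundary, and by strict convexity into one ray.\<close>

lemma limit_rank_one:
  assumes h: "\<And>n. h n \<in> G" and c: "\<And>n. c n > 0" and lim: "(\<lambda>n. c n *\<^sub>R h n) \<longlonglongrightarrow> L"
    and L0: "L \<noteq> 0" and k: "L *v k = 0" "k \<noteq> 0"
  obtains x \<psi> where "x \<in> bd" "a \<bullet> x = 1" "supporting \<psi>" "L = outer x \<psi>"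
proof -
  have Lv: "(\<lambda>n. c n *\<^sub>R (h n *v v)) \<longlonglongrightarrow> L *v v" for v
    using tendsto_mv[OF lim tendsto_const[of v]] by (simp add: mv_scaleR_left)
  have Lcl: "L *v v \<in> closure C" if "v \<in> C" for v
  proof -
    have "\<And>n. c n *\<^sub>R (h n *v v) \<in> C" using that h c G_C C_scale by blast
    then show ?thesis using Lv[of v] by (rule closure_limI)
  qed
  have small: "\<exists>e>0. u + e *\<^sub>R v \<in> C \<and> u - e *\<^sub>R v \<in> C" if "u \<in> C" for u v
  proof -
    obtain r where r: "r > 0" "ball u r \<subseteq> C" using openE[OF openC \<open>u \<in> C\<close>] by blast
    define e where "e = r / (2 * (norm v + 1))"
    have n: "norm v + 1 > 0" using norm_ge_zero[of v] by linarith
    have e: "e > 0" using r n by (simp add: e_def)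
    have "e * norm v \<le> e * (norm v + 1)" using e by simp
    also have "\<dots> = r / 2" using n by (simp add: e_def field_simps)
    finally have "e * norm v < r" using r by simp
    then have "u + e *\<^sub>R v \<in> ball u r" "u - e *\<^sub>R v \<in> ball u r" using e by (auto simp: dist_norm)
    then show ?thesis using r e by blast
  qed
  have opp: False if "w \<in> closure C" "- w \<in> closure C" "w \<noteq> 0" for w
    using a_pos_closure[of w] a_pos_closure[of "- w"] that by simp
  have Lnz: "L *v v \<noteq> 0" if v: "v \<in> C" for v
  proof
    assume z: "L *v v = 0"
    have "L *v w = 0" for w
    proof (rule ccontr)
      assume w: "L *v w \<noteq> 0"
      obtain e where e: "e > 0" "v + e *\<^sub>R w \<in> C" "v - e *\<^sub>R w \<in> C" using small[OF v] by blast
      have "e *\<^sub>R (L *v w) \<in> closure C" "- (e *\<^sub>R (L *v w)) \<in> closure C"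
        using Lcl[OF e(2)] Lcl[OF e(3)] z
        by (simp_all add: matrix_vector_right_distrib matrix_vector_mult_diff_distrib matrix_vector_mult_scaleR)
      then show False using opp[of "e *\<^sub>R (L *v w)"] e w by simp
    qed
    then have "L = 0" by (intro matrix_eqI) simp
    then show False using L0 by simp
  qed
  have LnC: "L *v v \<notin> C" if v: "v \<in> C" for v
  proof
    assume LC: "L *v v \<in> C"
    \<comment> \<open>The points of the line have the same image under \<open>L\<close>, so some \<open>h n\<close> maps them into \<open>C\<close>.\<close>
    have all: "v + s *\<^sub>R k \<in> C" for s
    proof -
      have "L *v (v + s *\<^sub>R k) \<in> C" using LC k
        by (simp add: matrix_vector_right_distrib matrix_vector_mult_scaleR)
      then have "eventually (\<lambda>n. c n *\<^sub>R (h n *v (v + s *\<^sub>R k)) \<in> C) sequentially"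
        using Lv openC topological_tendstoD by blast
      then obtain n where n: "c n *\<^sub>R (h n *v (v + s *\<^sub>R k)) \<in> C"
        using eventually_happens sequentially_bot by blast
      have "(1 / c n) *\<^sub>R (c n *\<^sub>R (h n *v (v + s *\<^sub>R k))) \<in> C" using c[of n] by (intro C_scale[OF n]) simp
      then show ?thesis using c[of n] G_C_iff[OF h] by simp
    qed
    have lim0: "(\<lambda>n. inverse (real (Suc n))) \<longlonglongrightarrow> 0" by (rule LIMSEQ_inverse_real_of_nat)
    \<comment> \<open>A cone that contains a line has both directions of the line in its closure.\<close>
    have dir: "w \<in> closure C" if w: "w = k \<or> w = - k" for w
    proof -
      have "(\<lambda>n. inverse (real (Suc n)) *\<^sub>R v + w) \<longlonglongrightarrow> w"
        using tendsto_add[OF tendsto_scaleR[OF lim0 tendsto_const[of v]] tendsto_const[of w]] by simp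
      moreover have "inverse (real (Suc n)) *\<^sub>R v + w \<in> C" for n
      proof -
        have "v + real (Suc n) *\<^sub>R w \<in> C" using all[of "real (Suc n)"] all[of "- real (Suc n)"] w
          by (metis scaleR_minus_left scaleR_minus_right)
        then have "inverse (real (Suc n)) *\<^sub>R (v + real (Suc n) *\<^sub>R w) \<in> C" by (rule C_scale) simp
        moreover have "inverse (real (Suc n)) *\<^sub>R (v + real (Suc n) *\<^sub>R w) = inverse (real (Suc n)) *\<^sub>R v + w"
          by (simp add: scaleR_add_right del: of_nat_Suc)
        ultimately show ?thesis by simp
      qed
      ultimately show ?thesis by (rule closure_limI[rotated])
    qed
    show False using dir[of k] dir[of "- k"] opp[of k] k by simp
  qed
  have Lbd: "L *v v \<in> bd" if "v \<in> C" for v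
    using Lcl Lnz LnC that by (simp add: bd_def)
  obtain u where u: "u \<in> C" using C_nonempty by blast
  define x where "x = pr (L *v u)"
  have x: "x \<in> bd" "a \<bullet> x = 1" using pr_bd[OF Lbd[OF u]] by (auto simp: x_def)
  have ray: "L *v v = (a \<bullet> (L *v v)) *\<^sub>R x" if v: "v \<in> C" for v
  proof -
    have "pr (L *v u) = pr (L *v v)"
    proof (rule ccontr)
      assume "pr (L *v u) \<noteq> pr (L *v v)"
      then have "L *v u + L *v v \<in> C" using bd_add_C Lbd u v by blast
      then show False using LnC[OF C_add[OF u v]] by (simp add: matrix_vector_right_distrib)
    qed
    then show ?thesis using pr_scaled[OF Lbd[OF v]] by (simp add: x_def)
  qed
  define \<psi> where "\<psi> = a v* L"
  have \<psi>: "\<psi> \<bullet> v = a \<bullet> (L *v v)" for v by (simp add: \<psi>_def inner_mv_transpose)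
  have eq: "L *v v = (\<psi> \<bullet> v) *\<^sub>R x" for v
  proof -
    obtain e where e: "e > 0" "u + e *\<^sub>R v \<in> C" using small[OF u] by blast
    have "L *v u + e *\<^sub>R (L *v v) = (\<psi> \<bullet> u + e * (\<psi> \<bullet> v)) *\<^sub>R x"
      using ray[OF e(2)] by (simp add: \<psi> matrix_vector_right_distrib matrix_vector_mult_scaleR inner_add_right)
    moreover have "L *v u = (\<psi> \<bullet> u) *\<^sub>R x" using ray[OF u] by (simp add: \<psi>)
    ultimately have "e *\<^sub>R (L *v v) = e *\<^sub>R ((\<psi> \<bullet> v) *\<^sub>R x)" by (simp add: scaleR_add_left)
    then show ?thesis using e(1) by (metis less_irrefl scaleR_cancel_left)
  qed
  have "L = outer x \<psi>" by (intro matrix_eqI) (simp add: eq outer_mv)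
  moreover have "supporting \<psi>"
  proof -
    have "\<psi> \<bullet> v > 0" if "v \<in> C" for v using bd_pos[OF Lbd[OF that]] by (simp add: \<psi>)
    then show ?thesis using u unfolding supporting_def by (metis inner_zero_left less_irrefl less_imp_le)
  qed
  ultimately show ?thesis using that x by blast
qed

text \<open>Only finitely many elements have a bounded inverse.\<close>

lemma G_unbounded_inv:
  assumes g: "\<And>n. g n \<in> G" and inf: "filterlim (\<lambda>n. norm (g n)) at_top sequentially"
  shows "filterlim (\<lambda>n. norm (matrix_inv (g n))) at_top sequentially"
proof (subst filterlim_at_top, intro allI)
  fix R :: real
  define F where "F = {A \<in> G. norm A \<le> R}"
  define M where "M = Max (insert 0 ((\<lambda>A. norm (matrix_inv A)) ` F))"
  have fin: "finite F" using G_finite by (simp add: F_def)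
  have "eventually (\<lambda>n. norm (g n) \<ge> M + 1) sequentially"
    using inf by (simp add: filterlim_at_top)
  then show "eventually (\<lambda>n. norm (matrix_inv (g n)) \<ge> R) sequentially"
  proof (rule eventually_mono)
    fix n assume n: "norm (g n) \<ge> M + 1"
    show "norm (matrix_inv (g n)) \<ge> R"
    proof (rule ccontr)
      assume "\<not> ?thesis"
      then have "matrix_inv (g n) \<in> F" using g G_inv by (simp add: F_def)
      then have "norm (matrix_inv (matrix_inv (g n))) \<le> M"
        unfolding M_def using fin by (intro Max_ge) auto
      then show False using n inv_inv[OF g] by simp
    qed
  qed
qed

text \<open>The two limits multiply to \<open>0\<close> because the norms of \<open>g n\<close> and of its inverse both tend to infinity.
  This makes them singular, so that \<open>limit_rank_one\<close> applies, and it shows that the kernel of each of them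
  contains the image of the other.\<close>

lemma diverging_limits:
  assumes g: "\<And>n. g n \<in> G" and inf: "filterlim (\<lambda>n. norm (g n)) at_top sequentially"
  obtains r x \<psi> y \<eta> where "strict_mono (r :: nat \<Rightarrow> nat)" "a \<bullet> x = 1" "a \<bullet> y = 1"
    "\<psi> \<bullet> y = 0" "\<eta> \<bullet> x = 0"
    "scaled_lim (\<lambda>n. g (r n)) (\<lambda>n. norm (g (r n))) x \<psi>"
    "scaled_lim (\<lambda>n. matrix_inv (g (r n))) (\<lambda>n. norm (matrix_inv (g (r n)))) y \<eta>"
proof -
  obtain r1 L where r1: "strict_mono (r1 :: nat \<Rightarrow> nat)"
      "(\<lambda>n. (1 / norm (g (r1 n))) *\<^sub>R g (r1 n)) \<longlonglongrightarrow> L"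
    using sphere_subseq by blast
  obtain r2 L' where r2: "strict_mono (r2 :: nat \<Rightarrow> nat)"
      "(\<lambda>n. (1 / norm (matrix_inv (g (r1 (r2 n))))) *\<^sub>R matrix_inv (g (r1 (r2 n)))) \<longlonglongrightarrow> L'"
    using sphere_subseq[of "\<lambda>n. matrix_inv (g (r1 n))"] by blast
  define r where "r = r1 \<circ> r2"
  have r: "strict_mono r" using r1 r2 by (simp add: r_def strict_mono_o)
  define f where "f n = g (r n)" for n
  have f: "f n \<in> G" for n using g by (simp add: f_def)
  have limL: "(\<lambda>n. (1 / norm (f n)) *\<^sub>R f n) \<longlonglongrightarrow> L"
    using LIMSEQ_subseq_LIMSEQ[OF r1(2) r2(1)] by (simp add: o_def r_def f_def)
  have limL': "(\<lambda>n. (1 / norm (matrix_inv (f n))) *\<^sub>R matrix_inv (f n)) \<longlonglongrightarrow> L'"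
    using r2(2) by (simp add: o_def r_def f_def)
  have finf: "filterlim (\<lambda>n. norm (f n)) at_top sequentially"
    unfolding f_def using filterlim_compose[OF inf filterlim_subseq[OF r]] by simp
  have finf': "filterlim (\<lambda>n. norm (matrix_inv (f n))) at_top sequentially"
    by (rule G_unbounded_inv[OF f finf])
  have nz: "f n \<noteq> 0" "matrix_inv (f n) \<noteq> 0" for n
    using G_nonzero[OF f] G_nonzero[OF G_inv[OF f]] by auto
  have one: "norm M = 1" if "h \<longlonglongrightarrow> M" and "\<And>n. norm (h n) = 1" for h and M :: "real^'m^'m"
    using tendsto_norm[OF that(1)] by (simp add: that(2) LIMSEQ_const_iff)
  have L0: "norm L = 1" "norm L' = 1"
    using one[OF limL] one[OF limL'] nz by simp_all
  have inv0: "((\<lambda>n. 1 / norm (f n) * (1 / norm (matrix_inv (f n)))) \<longlonglongrightarrow> 0 * 0)"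
    using finf finf' by (intro tendsto_mult tendsto_divide_0[OF tendsto_const] filterlim_at_top_imp_at_infinity)
  have z: "(\<lambda>n. (1 / norm (f n) * (1 / norm (matrix_inv (f n)))) *\<^sub>R (mat 1 :: real^'m^'m)) \<longlonglongrightarrow> 0"
    using tendsto_scaleR[OF inv0 tendsto_const[of "mat 1"]] by simp
  have z': "(\<lambda>n. (1 / norm (matrix_inv (f n)) * (1 / norm (f n))) *\<^sub>R (mat 1 :: real^'m^'m)) \<longlonglongrightarrow> 0"
    using z by (simp add: mult.commute)
  have LL': "L ** L' = 0"
    using LIMSEQ_unique[OF tendsto_mm[OF limL limL']] z by (simp add: mm_scaleR G_cancel[OF f])
  have L'L: "L' ** L = 0"
    using LIMSEQ_unique[OF tendsto_mm[OF limL' limL]] z' by (simp add: mm_scaleR G_cancel[OF f])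
  have ker: "\<exists>k. k \<noteq> 0 \<and> A *v k = 0" if AB: "A ** B = 0" "norm B = 1" for A B :: "real^'m^'m"
  proof -
    obtain v where "B *v v \<noteq> 0" using AB(2) matrix_eqI[of B 0] by force
    moreover have "A *v (B *v v) = 0" using AB by (simp add: matrix_vector_mul_assoc)
    ultimately show ?thesis by blast
  qed
  obtain k k' where k: "k \<noteq> 0" "L *v k = 0" and k': "k' \<noteq> 0" "L' *v k' = 0"
    using ker[OF LL' L0(2)] ker[OF L'L L0(1)] by auto
  have pos: "1 / norm (f n) > 0" "1 / norm (matrix_inv (f n)) > 0" for n using nz by simp_all
  have "L \<noteq> 0" "L' \<noteq> 0" using L0 by auto
  obtain x \<psi> where x: "x \<in> bd" "a \<bullet> x = 1" "supporting \<psi>" "L = outer x \<psi>"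
    by (rule limit_rank_one[OF f pos(1) limL \<open>L \<noteq> 0\<close> k(2,1)])
  obtain y \<eta> where y: "y \<in> bd" "a \<bullet> y = 1" "supporting \<eta>" "L' = outer y \<eta>"
    by (rule limit_rank_one[OF G_inv[OF f] pos(2) limL' \<open>L' \<noteq> 0\<close> k'(2,1)])
  obtain u where u: "u \<in> C" using C_nonempty by blast
  have "L *v (L' *v u) = 0" "L' *v (L *v u) = 0"
    using LL' L'L by (simp_all add: matrix_vector_mul_assoc)
  moreover have "x \<noteq> 0" "y \<noteq> 0" using x y by auto
  moreover have "\<psi> \<bullet> u > 0" "\<eta> \<bullet> u > 0" using supporting_pos u x y by auto
  ultimately have "\<psi> \<bullet> y = 0" "\<eta> \<bullet> x = 0" using x y by (auto simp: outer_mv)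
  moreover have "scaled_lim f (\<lambda>n. norm (f n)) x \<psi>"
    "scaled_lim (\<lambda>n. matrix_inv (f n)) (\<lambda>n. norm (matrix_inv (f n))) y \<eta>"
    using x y limL limL' f G_inv nz by (simp_all add: scaled_lim_def)
  ultimately show ?thesis using x(2) y(2) by (intro that[OF r, of x y \<psi> \<eta>]) (simp_all add: f_def[abs_def])
qed

text \<open>The rays in the limit set of the group, for an arbitrary base point \<open>u\<close> in the cone.\<close>

definition limit_cone :: "(real^'m) set" where
  "limit_cone = {q \<in> bd. \<exists>g c u. (\<forall>n. g n \<in> G) \<and> (\<forall>n. c n > 0) \<and> u \<in> C \<and>
     filterlim (\<lambda>n. norm (g n)) at_top sequentially \<and> (\<lambda>n. c n *\<^sub>R (g n *v u)) \<longlonglongrightarrow> q}"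

lemma G_mpow: "A \<in> G \<Longrightarrow> mpow A n \<in> G"
  by (induction n) (auto intro: G_one G_mult)

lemma mpow_inv: "A \<in> G \<Longrightarrow> mpow (matrix_inv A) n = matrix_inv (mpow A n)"
proof (induction n)
  case (Suc n)
  have "matrix_inv (mpow A (Suc n)) = matrix_inv (mpow A n ** A)"
    using mpow_commute[of A n 1] by simp
  then show ?case using Suc inv_mult[OF G_mpow[OF Suc.prems] Suc.prems] by simp
qed (simp add: inv_one)

lemma tendsto_pr: "(f \<longlongrightarrow> l) F \<Longrightarrow> a \<bullet> l \<noteq> 0 \<Longrightarrow> ((\<lambda>n. pr (f n)) \<longlongrightarrow> pr l) F"
  unfolding pr_def by (intro tendsto_intros) auto

lemma pr_neq_nhd:
  assumes "v \<in> bd" "finite S" "pr v \<notin> S"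
  shows "\<exists>N. open N \<and> v \<in> N \<and> (\<forall>u\<in>N. pr u \<notin> S)"
proof -
  have "((\<lambda>u. pr u) \<longlongrightarrow> pr v) (nhds v)"
    using bd_pos[OF assms(1)] by (intro tendsto_pr filterlim_ident) simp
  moreover have "open (- S)" using assms(2) by (simp add: finite_imp_closed open_Compl)
  ultimately have "eventually (\<lambda>u. pr u \<in> - S) (nhds v)"
    using assms(3) by (intro topological_tendstoD) auto
  then show ?thesis unfolding eventually_nhds by auto
qed

lemma pr_tendsto_unique:
  assumes lim: "(\<lambda>n. c n *\<^sub>R f n) \<longlonglongrightarrow> l" and c: "\<And>n. c n > 0" and l: "l \<in> bd"
    and lim': "(\<lambda>n. pr (f n)) \<longlonglongrightarrow> z"
  shows "z = pr l"
proof -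
  have "(\<lambda>n. pr (c n *\<^sub>R f n)) \<longlonglongrightarrow> pr l"
    using tendsto_pr[OF lim] bd_pos[OF l] by simp
  moreover have "pr (c n *\<^sub>R f n) = pr (f n)" for n using c[of n] by (simp add: pr_scale)
  ultimately show ?thesis using LIMSEQ_unique[OF lim'] by simp
qed

lemma inj_unbounded:
  fixes g :: "nat \<Rightarrow> real^'m^'m"
  assumes "\<And>n. g n \<in> G" "inj g"
  shows "filterlim (\<lambda>n. norm (g n)) at_top sequentially"
proof (subst filterlim_at_top, intro allI)
  fix R :: real
  have "finite (g -` {A \<in> G. norm A \<le> R})" using G_finite assms(2) by (rule finite_vimageI)
  then have "eventually (\<lambda>n. n \<notin> g -` {A \<in> G. norm A \<le> R}) sequentially"
    by (simp add: cofinite_eq_sequentially[symmetric] eventually_cofinite)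
  then show "eventually (\<lambda>n. norm (g n) \<ge> R) sequentially"
    by (rule eventually_mono) (use assms(1) in auto)
qed

lemma scaled_lim_apply:
  assumes "scaled_lim g A x \<psi>"
  shows "(\<lambda>n. (1 / A n) *\<^sub>R (g n *v v)) \<longlonglongrightarrow> (\<psi> \<bullet> v) *\<^sub>R x"
proof -
  have "(\<lambda>n. ((1 / A n) *\<^sub>R g n) *v v) \<longlonglongrightarrow> outer x \<psi> *v v"
    using assms by (intro tendsto_mv tendsto_const) (simp add: scaled_lim_def)
  then show ?thesis by (simp add: outer_mv mv_scaleR_left)
qed

lemma scaled_lim_pr:
  assumes "scaled_lim g A x \<psi>" "\<psi> \<bullet> v > 0"
  shows "(\<lambda>n. pr (g n *v v)) \<longlonglongrightarrow> pr x"
proof -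
  have A: "A n > 0" for n using assms by (simp add: scaled_lim_def)
  have "a \<bullet> x > 0" using assms bd_pos by (simp add: scaled_lim_def)
  then have "(\<lambda>n. pr ((1 / A n) *\<^sub>R (g n *v v))) \<longlonglongrightarrow> pr ((\<psi> \<bullet> v) *\<^sub>R x)"
    using assms by (intro tendsto_pr scaled_lim_apply) auto
  moreover have "pr ((1 / A n) *\<^sub>R (g n *v v)) = pr (g n *v v)" for n
    using A[of n] by (intro pr_scale) auto
  ultimately show ?thesis using assms by (simp add: pr_scale)
qed

lemma scaled_lim_left:
  assumes "scaled_lim g A x \<psi>" "h \<in> G"
  shows "scaled_lim (\<lambda>n. h ** g n) A (h *v x) \<psi>"
proof -
  have "(\<lambda>n. h ** ((1 / A n) *\<^sub>R g n)) \<longlonglongrightarrow> h ** outer x \<psi>"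
    using assms by (intro tendsto_mm tendsto_const) (simp add: scaled_lim_def)
  moreover have "h ** (c *\<^sub>R M) = c *\<^sub>R (h ** M)" for c and M :: "real^'m^'m"
    using mm_scaleR[of 1 h c M] by simp
  ultimately show ?thesis
    using assms by (auto simp: scaled_lim_def outer_mult_left intro: G_mult G_bd)
qed

lemma scaled_lim_right:
  assumes "scaled_lim g A x \<psi>" "h \<in> G"
  shows "scaled_lim (\<lambda>n. g n ** h) A x (\<psi> v* h)"
proof -
  have "(\<lambda>n. ((1 / A n) *\<^sub>R g n) ** h) \<longlonglongrightarrow> outer x \<psi> ** h"
    using assms by (intro tendsto_mm tendsto_const) (simp add: scaled_lim_def)
  moreover have "(c *\<^sub>R M) ** h = c *\<^sub>R (M ** h)" for c and M :: "real^'m^'m"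
    using mm_scaleR[of c M 1 h] by simp
  ultimately show ?thesis
    using assms by (auto simp: scaled_lim_def outer_mult_right intro: G_mult supporting_transpose)
qed

text \<open>That the limit is a boundary vector is automatic: by \<open>diverging_limits\<close> the directions of
  \<open>g n *v u\<close> accumulate only on the boundary.\<close>

lemma limit_coneI:
  assumes g: "\<And>n. g n \<in> G" and c: "eventually (\<lambda>n. c n > 0) sequentially" and u: "u \<in> C"
    and inf: "filterlim (\<lambda>n. norm (g n)) at_top sequentially"
    and lim: "(\<lambda>n. c n *\<^sub>R (g n *v u)) \<longlonglongrightarrow> q" and q: "a \<bullet> q > 0"
  shows "q \<in> limit_cone"
proof -
  define c' where "c' n = (if c n > 0 then c n else 1)" for n
  have c': "c' n > 0" for n by (simp add: c'_def)
  have lim': "(\<lambda>n. c' n *\<^sub>R (g n *v u)) \<longlonglongrightarrow> q"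
    using c by (intro Lim_transform_eventually[OF lim]) (auto elim!: eventually_mono simp: c'_def)
  obtain r x \<psi> y \<eta> where r: "strict_mono (r :: nat \<Rightarrow> nat)" and x: "a \<bullet> x = 1"
    and cv: "scaled_lim (\<lambda>n. g (r n)) (\<lambda>n. norm (g (r n))) x \<psi>"
    by (rule diverging_limits[OF g inf]) (rule that)
  have xbd: "x \<in> bd" and "\<psi> \<bullet> u > 0" using cv u supporting_pos by (auto simp: scaled_lim_def)
  then have "(\<lambda>n. pr (g (r n) *v u)) \<longlonglongrightarrow> x" using scaled_lim_pr[OF cv] pr_id[OF x] by simp
  moreover have "(\<lambda>n. pr (c' (r n) *\<^sub>R (g (r n) *v u))) \<longlonglongrightarrow> pr q"
    using LIMSEQ_subseq_LIMSEQ[OF lim' r] q by (intro tendsto_pr) (auto simp: o_def)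
  moreover have "pr (c' (r n) *\<^sub>R (g (r n) *v u)) = pr (g (r n) *v u)" for n
    using c'[of "r n"] by (intro pr_scale) simp
  ultimately have "pr q = x" using LIMSEQ_unique by fastforce
  then have "q = (a \<bullet> q) *\<^sub>R x" using q by (auto simp: pr_def)
  then have "q \<in> bd" using bd_scale[OF xbd q] by simp
  then show ?thesis unfolding limit_cone_def using g c' u inf lim' by blast
qed

lemma scaled_lim_compose:
  "scaled_lim g A x \<psi> \<Longrightarrow> filterlim p at_top sequentially \<Longrightarrow> scaled_lim (\<lambda>n. g (p n)) (\<lambda>n. A (p n)) x \<psi>"
  unfolding scaled_lim_def by (auto intro: filterlim_compose[where g="\<lambda>n. (1 / A n) *\<^sub>R g n"])

text \<open>The basic computation with words: in the product \<open>(x \<otimes> \<psi>) h (x' \<otimes> \<psi>')\<close> the junction \<open>h\<close> contributes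
  the factor \<open>\<psi> \<bullet> h x'\<close>. The indices \<open>p n\<close> and \<open>q n\<close> of the two factors tend to infinity independently.\<close>

lemma scaled_lim_join:
  assumes g: "scaled_lim g A x \<psi>" and g': "scaled_lim g' A' x' \<psi>'" and h: "h \<in> G" and pos: "\<psi> \<bullet> (h *v x') > 0"
    and p: "filterlim p at_top sequentially" and q: "filterlim q at_top sequentially"
  shows "scaled_lim (\<lambda>n. g (p n) ** (h ** g' (q n))) (\<lambda>n. A (p n) * A' (q n) * (\<psi> \<bullet> (h *v x'))) x \<psi>'"
proof -
  define c where "c = \<psi> \<bullet> (h *v x')"
  have "(\<lambda>n. (1 / A (p n)) *\<^sub>R g (p n)) \<longlonglongrightarrow> outer x \<psi>"
    using scaled_lim_compose[OF g p] by (simp add: scaled_lim_def)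
  moreover have "(\<lambda>n. (1 / A' (q n)) *\<^sub>R (h ** g' (q n))) \<longlonglongrightarrow> outer (h *v x') \<psi>'"
    using scaled_lim_left[OF scaled_lim_compose[OF g' q] h] by (simp add: scaled_lim_def)
  ultimately have "(\<lambda>n. (1 / c) *\<^sub>R (((1 / A (p n)) *\<^sub>R g (p n)) ** ((1 / A' (q n)) *\<^sub>R (h ** g' (q n)))))
      \<longlonglongrightarrow> (1 / c) *\<^sub>R (outer x \<psi> ** outer (h *v x') \<psi>')"
    by (intro tendsto_scaleR tendsto_const tendsto_mm)
  then have "(\<lambda>n. (1 / (A (p n) * A' (q n) * c)) *\<^sub>R (g (p n) ** (h ** g' (q n)))) \<longlonglongrightarrow> outer x \<psi>'"
    using pos by (simp add: mm_scaleR outer_mult_outer c_def mult.commute mult.left_commute)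
  then show ?thesis using g g' h pos by (auto simp: scaled_lim_def c_def intro: G_mult)
qed

text \<open>The rank-one limits of a sequence whose orbit points converge to \<open>[q]\<close> have image \<open>q\<close>, since
  the limit of the orbit points is the image of the limit matrix.\<close>

lemma limit_cone_sequence:
  assumes "q \<in> limit_cone"
  obtains g \<psi> y \<eta> where "filterlim (\<lambda>n. norm (g n)) at_top sequentially"
    "scaled_lim g (\<lambda>n. norm (g n)) (pr q) \<psi>"
    "scaled_lim (\<lambda>n. matrix_inv (g n)) (\<lambda>n. norm (matrix_inv (g n))) y \<eta>"
    "a \<bullet> y = 1" "\<psi> \<bullet> y = 0" "\<eta> \<bullet> pr q = 0"
proof -
  obtain g c u where g: "\<And>n. g n \<in> G" and c: "\<And>n. c n > 0" and u: "u \<in> C"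
    and inf: "filterlim (\<lambda>n. norm (g n)) at_top sequentially"
    and lim: "(\<lambda>n. c n *\<^sub>R (g n *v u)) \<longlonglongrightarrow> q" and q: "q \<in> bd"
    using assms unfolding limit_cone_def by blast
  obtain r x \<psi> y \<eta> where r: "strict_mono (r :: nat \<Rightarrow> nat)" and x: "a \<bullet> x = 1" "a \<bullet> y = 1"
    "\<psi> \<bullet> y = 0" "\<eta> \<bullet> x = 0"
    and cv: "scaled_lim (\<lambda>n. g (r n)) (\<lambda>n. norm (g (r n))) x \<psi>"
    "scaled_lim (\<lambda>n. matrix_inv (g (r n))) (\<lambda>n. norm (matrix_inv (g (r n)))) y \<eta>"
    by (rule diverging_limits[OF g inf])
  have "\<psi> \<bullet> u > 0" using cv(1) u supporting_pos by (auto simp: scaled_lim_def)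
  then have "(\<lambda>n. pr (g (r n) *v u)) \<longlonglongrightarrow> x" using scaled_lim_pr[OF cv(1)] pr_id[OF x(1)] by simp
  moreover have "(\<lambda>n. c (r n) *\<^sub>R (g (r n) *v u)) \<longlonglongrightarrow> q"
    using LIMSEQ_subseq_LIMSEQ[OF lim r] by (simp add: o_def)
  ultimately have "x = pr q" 
    using pr_tendsto_unique[where c="\<lambda>n. c (r n)" and f="\<lambda>n. g (r n) *v u", OF _ c q] by blast
  moreover have "filterlim (\<lambda>n. norm (g (r n))) at_top sequentially"
    using filterlim_compose[OF inf filterlim_subseq[OF r]] by simp
  ultimately show ?thesis using cv x by (intro that[of "\<lambda>n. g (r n)" \<psi> y \<eta>]) simp_all
qed

section \<open>Loxodromic elements\<close>

lemma compact_slice: "compact {v \<in> closure C. a \<bullet> v = 1 \<and> dist x v \<le> \<delta>}"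
proof -
  have "{v \<in> closure C. a \<bullet> v = 1 \<and> dist x v \<le> \<delta>} = cball x \<delta> \<inter> (closure C \<inter> {v. a \<bullet> v = 1})" by auto
  then show ?thesis by (simp add: compact_Int_closed closed_Int closed_hyperplane)
qed

text \<open>If the attracting point \<open>x\<close> is off the hyperplane \<open>\<psi> = 0\<close>, then \<open>g n\<close> contracts a compact convex
  neighbourhood of \<open>x\<close> in the closed slice \<open>a = 1\<close> into itself, and Brouwer's theorem gives an eigenvector
  there. Its eigenvalue is about \<open>A n (\<psi> \<bullet> x)\<close>, hence large.\<close>

lemma eigenvector_near:
  assumes cv: "scaled_lim g A x \<psi>" and x: "a \<bullet> x = 1" and \<psi>x: "\<psi> \<bullet> x > 0"
    and inf: "filterlim A at_top sequentially"
  shows "eventually (\<lambda>n. \<exists>v\<in>closure C. \<exists>c\<ge>R. a \<bullet> v = 1 \<and> g n *v v = c *\<^sub>R v) sequentially"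
proof -
  have gG: "\<And>n. g n \<in> G" and A: "\<And>n. A n > 0" and xbd: "x \<in> bd" and \<psi>: "supporting \<psi>"
    and lim: "(\<lambda>n. (1 / A n) *\<^sub>R g n) \<longlonglongrightarrow> outer x \<psi>"
    using cv by (auto simp: scaled_lim_def)
  have "open {v. \<psi> \<bullet> v > 0}" by (rule open_halfspace_gt)
  then obtain \<delta> where \<delta>: "\<delta> > 0" "cball x \<delta> \<subseteq> {v. \<psi> \<bullet> v > 0}"
    using \<psi>x open_contains_cball[of "{v. \<psi> \<bullet> v > 0}"] by auto
  define K where "K = {v \<in> closure C. a \<bullet> v = 1 \<and> dist x v \<le> \<delta>}"
  have K: "compact K" unfolding K_def by (rule compact_slice)
  have "K = cball x \<delta> \<inter> (closure C \<inter> {v. a \<bullet> v = 1})" by (auto simp: K_def)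
  then have Kconv: "convex K"
    by (simp add: convex_Int convex_hyperplane convex_closure convexC)
  have xK: "x \<in> K" using x xbd \<delta> by (auto simp: K_def bd_def)
  have apos: "a \<bullet> (g n *v v) > 0" if "v \<in> K" for n v
  proof -
    have "v \<noteq> 0" using that by (auto simp: K_def)
    then show ?thesis using that gG G_closure G_mv_nonzero by (intro a_pos_closure) (auto simp: K_def)
  qed
  have "\<exists>N. \<forall>n\<ge>N. \<forall>v\<in>K. dist x (pr (g n *v v)) \<le> \<delta> \<and> a \<bullet> (g n *v v) \<ge> R"
  proof (rule ccontr)
    assume "\<not> ?thesis"
    then have "\<forall>N. \<exists>n\<ge>N. \<exists>v\<in>K. \<not> (dist x (pr (g n *v v)) \<le> \<delta> \<and> a \<bullet> (g n *v v) \<ge> R)" by blast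
    then obtain k v where kv: "\<And>N. k N \<ge> N" "\<And>N. v N \<in> K"
        "\<And>N. \<not> (dist x (pr (g (k N) *v v N)) \<le> \<delta> \<and> a \<bullet> (g (k N) *v v N) \<ge> R)"
      by metis
    obtain w r where w: "w \<in> K" and r: "strict_mono (r :: nat \<Rightarrow> nat)" and vr: "(v \<circ> r) \<longlonglongrightarrow> w"
      using K kv(2) unfolding compact_def by metis
    have kinf: "filterlim (\<lambda>n. k (r n)) at_top sequentially"
    proof (rule filterlim_at_top_mono[OF filterlim_subseq[OF r]])
      show "\<forall>\<^sub>F n in sequentially. r n \<le> k (r n)" using kv(1) by simp
    qed
    have \<psi>w: "\<psi> \<bullet> w > 0" using w \<delta> by (auto simp: K_def)
    have "(\<lambda>n. ((1 / A (k (r n))) *\<^sub>R g (k (r n))) *v ((v \<circ> r) n)) \<longlonglongrightarrow> outer x \<psi> *v w"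
      by (intro tendsto_mv filterlim_compose[OF lim kinf] vr)
    then have L: "(\<lambda>n. (1 / A (k (r n))) *\<^sub>R (g (k (r n)) *v v (r n))) \<longlonglongrightarrow> (\<psi> \<bullet> w) *\<^sub>R x"
      by (simp add: mv_scaleR_left outer_mv)
    have "(\<lambda>n. pr ((1 / A (k (r n))) *\<^sub>R (g (k (r n)) *v v (r n)))) \<longlonglongrightarrow> pr ((\<psi> \<bullet> w) *\<^sub>R x)"
      using x \<psi>w by (intro tendsto_pr L) simp
    moreover have "pr ((1 / A (k (r n))) *\<^sub>R (g (k (r n)) *v v (r n))) = pr (g (k (r n)) *v v (r n))" for n
      using A[of "k (r n)"] by (intro pr_scale) auto
    ultimately have "(\<lambda>n. pr (g (k (r n)) *v v (r n))) \<longlonglongrightarrow> x"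
      using \<psi>w by (simp add: pr_scale pr_id[OF x])
    then have e1: "eventually (\<lambda>n. dist (pr (g (k (r n)) *v v (r n))) x < \<delta>) sequentially"
      using \<delta>(1) by (rule tendstoD)
    have "(\<lambda>n. a \<bullet> ((1 / A (k (r n))) *\<^sub>R (g (k (r n)) *v v (r n)))) \<longlonglongrightarrow> a \<bullet> ((\<psi> \<bullet> w) *\<^sub>R x)"
      by (intro tendsto_intros L)
    then have "(\<lambda>n. (1 / A (k (r n))) * (a \<bullet> (g (k (r n)) *v v (r n)))) \<longlonglongrightarrow> \<psi> \<bullet> w"
      using x by simp
    from filterlim_tendsto_pos_mult_at_top[OF this \<psi>w filterlim_compose[OF inf kinf]]
    have "filterlim (\<lambda>n. a \<bullet> (g (k (r n)) *v v (r n))) at_top sequentially"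
      using A by (simp add: less_imp_neq[symmetric])
    then have e2: "eventually (\<lambda>n. a \<bullet> (g (k (r n)) *v v (r n)) \<ge> R) sequentially"
      by (simp add: filterlim_at_top)
    obtain n where "dist (pr (g (k (r n)) *v v (r n))) x < \<delta>" "a \<bullet> (g (k (r n)) *v v (r n)) \<ge> R"
      using eventually_happens[OF eventually_conj[OF e1 e2]] by auto
    then show False using kv(3)[of "r n"] by (simp add: dist_commute)
  qed
  then obtain N where N: "\<And>n v. n \<ge> N \<Longrightarrow> v \<in> K \<Longrightarrow> dist x (pr (g n *v v)) \<le> \<delta> \<and> a \<bullet> (g n *v v) \<ge> R"
    by blast
  have "\<exists>v\<in>closure C. \<exists>c\<ge>R. a \<bullet> v = 1 \<and> g n *v v = c *\<^sub>R v" if n: "n \<ge> N" for n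
  proof -
    have cont: "continuous_on K (\<lambda>v. pr (g n *v v))"
      unfolding pr_def
      using apos[of _ n] by (intro continuous_intros matrix_vector_mult_linear_continuous_on ballI) (simp add: less_imp_neq[symmetric])
    have into: "(\<lambda>v. pr (g n *v v)) \<in> K \<rightarrow> K"
    proof
      fix v assume v: "v \<in> K"
      have "a \<bullet> pr (g n *v v) = 1" using apos[OF v, of n] by (simp add: pr_def)
      moreover have "pr (g n *v v) \<in> closure C"
        unfolding pr_def using apos[OF v, of n] v by (intro closure_scale G_closure[OF gG]) (auto simp: K_def)
      ultimately show "pr (g n *v v) \<in> K" using N[OF n v] by (simp add: K_def)
    qed
    obtain v where v: "v \<in> K" "pr (g n *v v) = v"
      using brouwer[OF K Kconv _ cont into] xK by blast
    have "g n *v v = (a \<bullet> (g n *v v)) *\<^sub>R v"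
      using v apos[OF v(1), of n] by (metis (no_types) pr_def divide_self_if less_irrefl mult.commute
          scaleR_one scaleR_scaleR times_divide_eq_right mult.right_neutral)
    then show ?thesis using v N[OF n v(1)] unfolding K_def by blast
  qed
  then show ?thesis unfolding eventually_sequentially by blast
qed

lemma inv_eigen:
  assumes "A \<in> G" "A *v v = c *\<^sub>R v" "c \<noteq> 0"
  shows "matrix_inv A *v v = (1 / c) *\<^sub>R v"
proof -
  have "v = matrix_inv A *v (c *\<^sub>R v)" using assms G_cancel(4) by metis
  then have "v = c *\<^sub>R (matrix_inv A *v v)" by (simp add: matrix_vector_mult_scaleR)
  then have "(1 / c) *\<^sub>R v = (1 / c) *\<^sub>R (c *\<^sub>R (matrix_inv A *v v))" by simp
  then show ?thesis using assms by simp
qed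

text \<open>An element with an expanded and a contracted eigenvector in the closed cone is loxodromic. By
  \<open>diverging_limits\<close> each subsequence of the rescaled powers has a further subsequence converging to some
  \<open>v \<otimes> \<alpha>\<close> with \<open>\<alpha> \<bullet> v = 1\<close>, and \<open>\<alpha>\<close> does not depend on the subsequence: two limits \<open>P\<close> and \<open>P'\<close> satisfy
  \<open>P P' = P'\<close> and \<open>P' P = P\<close>, and they commute as limits of powers of the same matrix.\<close>

lemma powers_converge_to_projection:
  assumes \<gamma>: "\<gamma> \<in> G" and v: "v \<in> closure C" "a \<bullet> v = 1" and w: "w \<in> closure C" "a \<bullet> w = 1"
    and ev: "\<gamma> *v v = \<rho> *\<^sub>R v" and ew: "\<gamma> *v w = \<mu> *\<^sub>R w" and \<mu>\<rho>: "0 < \<mu>" "\<mu> < 1" "1 < \<rho>"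
  shows "v \<in> bd \<and> w \<in> bd \<and> (\<exists>\<alpha>. supporting \<alpha> \<and> \<alpha> \<bullet> v = 1 \<and> \<alpha> \<bullet> w = 0 \<and> scaled_lim (mpow \<gamma>) (\<lambda>n. \<rho> ^ n) v \<alpha>)"
proof -
  define P where "P = mpow \<gamma>"
  have P: "P n \<in> G" for n using G_mpow[OF \<gamma>] by (simp add: P_def)
  have Pv: "P n *v v = \<rho> ^ n *\<^sub>R v" and Pw: "P n *v w = \<mu> ^ n *\<^sub>R w" for n
    using mpow_eigen[OF ev] mpow_eigen[OF ew] by (simp_all add: P_def)
  have v0: "v \<noteq> 0" and w0: "w \<noteq> 0" using v w by auto
  have vw: "v \<noteq> w" using ev ew v0 \<mu>\<rho> by auto
  have Piv: "matrix_inv (P n) *v v = (1 / \<rho> ^ n) *\<^sub>R v" and Piw: "matrix_inv (P n) *v w = (1 / \<mu> ^ n) *\<^sub>R w" for n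
  proof -
    have "matrix_inv (P n) *v (\<rho> ^ n *\<^sub>R v) = v" "matrix_inv (P n) *v (\<mu> ^ n *\<^sub>R w) = w"
      using G_cancel(4)[OF P] Pv Pw by metis+
    then have "(1 / \<rho> ^ n) *\<^sub>R (\<rho> ^ n *\<^sub>R (matrix_inv (P n) *v v)) = (1 / \<rho> ^ n) *\<^sub>R v"
       "(1 / \<mu> ^ n) *\<^sub>R (\<mu> ^ n *\<^sub>R (matrix_inv (P n) *v w)) = (1 / \<mu> ^ n) *\<^sub>R w"
      by (simp_all add: matrix_vector_mult_scaleR)
    then show "matrix_inv (P n) *v v = (1 / \<rho> ^ n) *\<^sub>R v" "matrix_inv (P n) *v w = (1 / \<mu> ^ n) *\<^sub>R w"
      using \<mu>\<rho> by simp_all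
  qed
  have injP: "inj P"
  proof (rule injI)
    fix m n assume "P m = P n"
    then have "\<rho> ^ m = \<rho> ^ n" using Pv v0 by (metis scaleR_cancel_right)
    then show "m = n" using \<mu>\<rho> by simp
  qed
  \<comment> \<open>An eigenvector inside the cone would be its own limit point under the powers.\<close>
  have eig_bd: "u \<in> bd" if u: "u \<in> closure C" "a \<bullet> u = 1" "\<And>n. P n *v u = c n *\<^sub>R u" "\<And>n. c n > 0" for u c
  proof (rule ccontr)
    assume "u \<notin> bd"
    then have uC: "u \<in> C" using u by (auto simp: bd_def)
    obtain r x \<psi> y \<eta> where x: "a \<bullet> x = 1"
      and cv: "scaled_lim (\<lambda>n. P (r n)) (\<lambda>n. norm (P (r n))) x \<psi>"
      by (rule diverging_limits[OF P inj_unbounded[OF P injP]]) (rule that)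
    have "\<psi> \<bullet> u > 0" using cv uC supporting_pos by (auto simp: scaled_lim_def)
    then have "(\<lambda>n. pr (P (r n) *v u)) \<longlonglongrightarrow> x" using scaled_lim_pr[OF cv] x by (simp add: pr_id)
    moreover have "pr (P (r n) *v u) = u" for n
      using u(3,4)[of "r n"] u(2) by (simp add: pr_scale pr_id)
    ultimately have "u = x" by (simp add: LIMSEQ_const_iff)
    then show False using cv uC by (auto simp: scaled_lim_def bd_def)
  qed
  have vbd: "v \<in> bd" using eig_bd[OF v Pv] \<mu>\<rho> by simp
  have wbd: "w \<in> bd" using eig_bd[OF w Pw] \<mu>\<rho> by simp
  have vwC: "v + w \<in> C" using bd_add_C[OF vbd wbd] vw v w by (simp add: pr_id)
  have sub: "\<exists>r \<alpha>. strict_mono (r :: nat \<Rightarrow> nat) \<and> supporting \<alpha> \<and> \<alpha> \<bullet> v = 1 \<and> \<alpha> \<bullet> w = 0 \<and>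
      scaled_lim (\<lambda>n. P (s (r n))) (\<lambda>n. \<rho> ^ s (r n)) v \<alpha>" if s: "strict_mono (s :: nat \<Rightarrow> nat)" for s
  proof -
    have "inj s" using s by (simp add: strict_mono_on_imp_inj_on)
    then have "inj (\<lambda>n. P (s n))" using injP by (auto simp: inj_def)
    then have unb: "filterlim (\<lambda>n. norm (P (s n))) at_top sequentially" by (intro inj_unbounded P)
    obtain r x \<psi> y \<eta> where r: "strict_mono (r :: nat \<Rightarrow> nat)" and x: "a \<bullet> x = 1" and y: "a \<bullet> y = 1"
      and \<psi>y: "\<psi> \<bullet> y = 0"
      and cv: "scaled_lim (\<lambda>n. P (s (r n))) (\<lambda>n. norm (P (s (r n)))) x \<psi>"
      and cv': "scaled_lim (\<lambda>n. matrix_inv (P (s (r n)))) (\<lambda>n. norm (matrix_inv (P (s (r n))))) y \<eta>"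
      by (rule diverging_limits[OF P unb]) (rule that)
    have sr: "filterlim (\<lambda>n. s (r n)) at_top sequentially"
      using filterlim_compose[OF filterlim_subseq[OF s] filterlim_subseq[OF r]] by simp
    have q0: "(\<lambda>n. (\<mu> / \<rho>) ^ s (r n)) \<longlonglongrightarrow> 0"
      using \<mu>\<rho> by (intro filterlim_compose[OF LIMSEQ_realpow_zero sr]) auto
    have "(\<lambda>n. pr (P (s (r n)) *v (v + w))) \<longlonglongrightarrow> pr v"
    proof -
      have "(\<lambda>n. pr (v + (\<mu> / \<rho>) ^ s (r n) *\<^sub>R w)) \<longlonglongrightarrow> pr (v + 0 *\<^sub>R w)"
        using v by (intro tendsto_pr tendsto_intros q0) simp
      moreover have "pr (P n *v (v + w)) = pr (v + (\<mu> / \<rho>) ^ n *\<^sub>R w)" for n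
      proof -
        have "P n *v (v + w) = \<rho> ^ n *\<^sub>R (v + (\<mu> / \<rho>) ^ n *\<^sub>R w)"
          using \<mu>\<rho> by (simp add: matrix_vector_right_distrib Pv Pw scaleR_add_right power_divide)
        then show ?thesis using \<mu>\<rho> by (simp add: pr_scale)
      qed
      ultimately show ?thesis by simp
    qed
    moreover have "\<psi> \<bullet> (v + w) > 0" "\<eta> \<bullet> (v + w) > 0"
      using cv cv' vwC supporting_pos by (auto simp: scaled_lim_def)
    ultimately have xv: "x = v"
      using scaled_lim_pr[OF cv, of "v + w"] LIMSEQ_unique v x by (simp add: pr_id)
    have "(\<lambda>n. pr (matrix_inv (P (s (r n))) *v (v + w))) \<longlonglongrightarrow> pr w"
    proof -
      have "(\<lambda>n. pr ((\<mu> / \<rho>) ^ s (r n) *\<^sub>R v + w)) \<longlonglongrightarrow> pr (0 *\<^sub>R v + w)"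
        using w by (intro tendsto_pr tendsto_intros q0) simp
      moreover have "pr (matrix_inv (P n) *v (v + w)) = pr ((\<mu> / \<rho>) ^ n *\<^sub>R v + w)" for n
      proof -
        have "matrix_inv (P n) *v (v + w) = (1 / \<mu> ^ n) *\<^sub>R ((\<mu> / \<rho>) ^ n *\<^sub>R v + w)"
          using \<mu>\<rho> by (simp add: matrix_vector_right_distrib Piv Piw scaleR_add_right power_divide)
        then show ?thesis using \<mu>\<rho> by (simp add: pr_scale)
      qed
      ultimately show ?thesis by simp
    qed
    then have yw: "y = w"
      using scaled_lim_pr[OF cv', of "v + w"] LIMSEQ_unique w y \<open>\<eta> \<bullet> (v + w) > 0\<close> by (simp add: pr_id)
    have \<psi>: "supporting \<psi>" using cv by (simp add: scaled_lim_def)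
    have \<psi>v: "\<psi> \<bullet> v > 0"
      using supporting_strict[OF \<psi> wbd vbd] \<psi>y yw vw v w by (simp add: pr_id)
    have "(\<lambda>n. a \<bullet> ((1 / norm (P (s (r n)))) *\<^sub>R (P (s (r n)) *v v))) \<longlonglongrightarrow> a \<bullet> ((\<psi> \<bullet> v) *\<^sub>R x)"
      by (intro tendsto_intros scaled_lim_apply[OF cv])
    then have "(\<lambda>n. \<rho> ^ s (r n) / norm (P (s (r n)))) \<longlonglongrightarrow> \<psi> \<bullet> v"
      using v x by (simp add: Pv)
    then have "(\<lambda>n. inverse (\<rho> ^ s (r n) / norm (P (s (r n))))) \<longlonglongrightarrow> inverse (\<psi> \<bullet> v)"
      using \<psi>v by (intro tendsto_inverse) auto
    then have "(\<lambda>n. inverse (\<rho> ^ s (r n) / norm (P (s (r n)))) *\<^sub>R ((1 / norm (P (s (r n)))) *\<^sub>R P (s (r n))))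
        \<longlonglongrightarrow> inverse (\<psi> \<bullet> v) *\<^sub>R outer x \<psi>"
      using cv by (intro tendsto_scaleR) (auto simp: scaled_lim_def)
    moreover have "norm (P n) \<noteq> 0" for n using G_nonzero[OF P] by simp
    ultimately have L: "(\<lambda>n. (1 / \<rho> ^ s (r n)) *\<^sub>R P (s (r n))) \<longlonglongrightarrow> outer v (inverse (\<psi> \<bullet> v) *\<^sub>R \<psi>)"
      by (simp add: outer_scaleR xv inverse_eq_divide)
    have "supporting (inverse (\<psi> \<bullet> v) *\<^sub>R \<psi>)" using \<psi> \<psi>v by (auto simp: supporting_def)
    then have "scaled_lim (\<lambda>n. P (s (r n))) (\<lambda>n. \<rho> ^ s (r n)) v (inverse (\<psi> \<bullet> v) *\<^sub>R \<psi>)"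
      using L P vbd \<mu>\<rho> by (simp add: scaled_lim_def)
    then show ?thesis using r \<psi>v \<psi>y yw \<open>supporting (inverse (\<psi> \<bullet> v) *\<^sub>R \<psi>)\<close>
      by (intro exI[of _ r] exI[of _ "inverse (\<psi> \<bullet> v) *\<^sub>R \<psi>"]) simp
  qed
  have uniq: "\<alpha> = \<alpha>'" if "(\<lambda>n. (1 / \<rho> ^ s n) *\<^sub>R P (s n)) \<longlonglongrightarrow> outer v \<alpha>"
      "(\<lambda>n. (1 / \<rho> ^ t n) *\<^sub>R P (t n)) \<longlonglongrightarrow> outer v \<alpha>'" "\<alpha> \<bullet> v = 1" "\<alpha>' \<bullet> v = 1" for s t \<alpha> \<alpha>'
  proof -
    have "(\<lambda>n. ((1 / \<rho> ^ s n) *\<^sub>R P (s n)) ** ((1 / \<rho> ^ t n) *\<^sub>R P (t n))) \<longlonglongrightarrow> outer v \<alpha> ** outer v \<alpha>'"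
      "(\<lambda>n. ((1 / \<rho> ^ t n) *\<^sub>R P (t n)) ** ((1 / \<rho> ^ s n) *\<^sub>R P (s n))) \<longlonglongrightarrow> outer v \<alpha>' ** outer v \<alpha>"
      by (intro tendsto_mm that)+
    moreover have "((1 / \<rho> ^ s n) *\<^sub>R P (s n)) ** ((1 / \<rho> ^ t n) *\<^sub>R P (t n)) =
        ((1 / \<rho> ^ t n) *\<^sub>R P (t n)) ** ((1 / \<rho> ^ s n) *\<^sub>R P (s n))" for n
      by (simp add: mm_scaleR P_def mpow_commute mult.commute)
    ultimately have "outer v \<alpha> ** outer v \<alpha>' = outer v \<alpha>' ** outer v \<alpha>"
      using LIMSEQ_unique by simp
    then have "outer v \<alpha>' = outer v \<alpha>" using that by (simp add: outer_mult_outer)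
    then show ?thesis using outer_inj v0 by metis
  qed
  obtain r \<alpha> where r: "strict_mono (r :: nat \<Rightarrow> nat)" and \<alpha>: "supporting \<alpha>" "\<alpha> \<bullet> v = 1" "\<alpha> \<bullet> w = 0"
    and cv: "scaled_lim (\<lambda>n. P (r n)) (\<lambda>n. \<rho> ^ r n) v \<alpha>"
    using sub[of "\<lambda>n. n"] by (auto simp: strict_mono_def)
  have "(\<lambda>n. (1 / \<rho> ^ n) *\<^sub>R P n) \<longlonglongrightarrow> outer v \<alpha>"
  proof (rule ccontr)
    assume "\<not> ?thesis"
    then obtain e where e: "e > 0" "\<not> eventually (\<lambda>n. dist ((1 / \<rho> ^ n) *\<^sub>R P n) (outer v \<alpha>) < e) sequentially"
      unfolding tendsto_iff by blast
    define B where "B = {n. \<not> dist ((1 / \<rho> ^ n) *\<^sub>R P n) (outer v \<alpha>) < e}"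
    have "infinite B" using e(2) unfolding cofinite_eq_sequentially[symmetric] eventually_cofinite B_def .
    define s where "s = enumerate B"
    have s: "strict_mono s" "\<And>n. s n \<in> B"
      using \<open>infinite B\<close> by (simp_all add: s_def strict_mono_enumerate enumerate_in_set)
    obtain r' \<alpha>' where r': "strict_mono (r' :: nat \<Rightarrow> nat)" and \<alpha>': "\<alpha>' \<bullet> v = 1"
      and cv': "scaled_lim (\<lambda>n. P (s (r' n))) (\<lambda>n. \<rho> ^ s (r' n)) v \<alpha>'" using sub[OF s(1)] by blast
    have "\<alpha> = \<alpha>'" using uniq[of r \<alpha> "\<lambda>n. s (r' n)" \<alpha>'] cv cv' \<alpha> \<alpha>' by (simp add: scaled_lim_def)
    then have "(\<lambda>n. (1 / \<rho> ^ s (r' n)) *\<^sub>R P (s (r' n))) \<longlonglongrightarrow> outer v \<alpha>" using cv' by (simp add: scaled_lim_def)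
    from tendstoD[OF this e(1)] obtain n where "dist ((1 / \<rho> ^ s (r' n)) *\<^sub>R P (s (r' n))) (outer v \<alpha>) < e"
      using eventually_happens by fastforce
    then show False using s(2)[of "r' n"] by (simp add: B_def)
  qed
  then have "scaled_lim (mpow \<gamma>) (\<lambda>n. \<rho> ^ n) v \<alpha>" using P vbd \<alpha> \<mu>\<rho> by (simp add: scaled_lim_def P_def)
  then show ?thesis using vbd wbd \<alpha> by blast
qed

end

locale nonelementary_cone_group = cone_group C a G
  for C :: "(real^'m) set" and a :: "real^'m" and G :: "(real^'m^'m) set" +
  assumes infinite_limit_cone: "infinite {q \<in> limit_cone. a \<bullet> q = 1}"

text \<open>A loxodromic element \<open>\<gamma>\<close> with attracting vector \<open>x\<close> and repelling vector \<open>y\<close>. The form \<open>\<alpha>\<close> supports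
  the cone at \<open>y\<close>, the form \<open>\<beta>\<close> supports it at \<open>x\<close>.\<close>

locale loxodromic = nonelementary_cone_group C a G
  for C :: "(real^'m) set" and a :: "real^'m" and G :: "(real^'m^'m) set" +
  fixes \<gamma> :: "real^'m^'m" and x y \<alpha> \<beta> :: "real^'m" and \<rho> \<mu> :: real
  assumes \<gamma>_G: "\<gamma> \<in> G" and x_norm: "a \<bullet> x = 1" and y_norm: "a \<bullet> y = 1" and x_neq_y: "x \<noteq> y"
    and \<gamma>_x: "\<gamma> *v x = \<rho> *\<^sub>R x" and \<gamma>_y: "\<gamma> *v y = \<mu> *\<^sub>R y" and \<mu>_pos: "0 < \<mu>" and \<mu>_\<rho>: "\<mu> < \<rho>"
    and \<alpha>_x: "\<alpha> \<bullet> x = 1" and \<alpha>_y: "\<alpha> \<bullet> y = 0" and \<beta>_y: "\<beta> \<bullet> y = 1" and \<beta>_x: "\<beta> \<bullet> x = 0"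
    and pow_lim: "scaled_lim (mpow \<gamma>) (\<lambda>n. \<rho> ^ n) x \<alpha>"
    and inv_pow_lim: "scaled_lim (mpow (matrix_inv \<gamma>)) (\<lambda>n. (1 / \<mu>) ^ n) y \<beta>"

context nonelementary_cone_group
begin

lemma ex_limit_cone_avoiding: "finite F \<Longrightarrow> \<exists>q\<in>limit_cone. a \<bullet> q = 1 \<and> q \<notin> F"
proof -
  assume "finite F"
  then have "infinite ({q \<in> limit_cone. a \<bullet> q = 1} - F)" using infinite_limit_cone by simp
  then show ?thesis using infinite_imp_nonempty by blast
qed

text \<open>A limit point \<open>q\<close> is the attracting point of a diverging sequence. Should the repelling point be \<open>q\<close> as
  well, compose with an element that moves \<open>q\<close>: this changes only the attracting point. If all limit points are
  fixed by the whole group, take a sequence with attracting point \<open>q\<^sub>1\<close>: were \<open>q\<^sub>1\<close> its repelling point too, it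
  would move every other limit point towards \<open>q\<^sub>1\<close>.\<close>

lemma ex_expanding_sequence:
  obtains g A B x \<psi> y \<eta> where "scaled_lim g A x \<psi>" "scaled_lim (\<lambda>n. matrix_inv (g n)) B y \<eta>"
    "filterlim A at_top sequentially" "filterlim B at_top sequentially"
    "\<psi> \<bullet> y = 0" "\<eta> \<bullet> x = 0" "pr x \<noteq> pr y"
proof (cases "\<exists>q\<in>limit_cone. a \<bullet> q = 1 \<and> (\<exists>h\<in>G. pr (h *v q) \<noteq> q)")
  case True
  then obtain q h where q: "q \<in> limit_cone" "a \<bullet> q = 1" and h: "h \<in> G" "pr (h *v q) \<noteq> q" by blast
  obtain g \<psi> y \<eta> where inf: "filterlim (\<lambda>n. norm (g n)) at_top sequentially"
    and cv: "scaled_lim g (\<lambda>n. norm (g n)) (pr q) \<psi>"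
    and cv': "scaled_lim (\<lambda>n. matrix_inv (g n)) (\<lambda>n. norm (matrix_inv (g n))) y \<eta>"
    and y: "a \<bullet> y = 1" "\<psi> \<bullet> y = 0" "\<eta> \<bullet> pr q = 0"
    by (rule limit_cone_sequence[OF q(1)])
  have pq: "pr q = q" using q pr_id by simp
  have gG: "g n \<in> G" for n using cv by (simp add: scaled_lim_def)
  have inf': "filterlim (\<lambda>n. norm (matrix_inv (g n))) at_top sequentially"
    by (rule G_unbounded_inv[OF gG inf])
  show ?thesis
  proof (cases "y = q")
    case False
    then show ?thesis using that[OF cv cv' inf inf'] y pq by (simp add: pr_id q)
  next
    case True
    have 1: "scaled_lim (\<lambda>n. h ** g n) (\<lambda>n. norm (g n)) (h *v q) \<psi>" using scaled_lim_left[OF cv h(1)] pq by simp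
    have "scaled_lim (\<lambda>n. matrix_inv (g n) ** matrix_inv h) (\<lambda>n. norm (matrix_inv (g n))) y (\<eta> v* matrix_inv h)"
      by (rule scaled_lim_right[OF cv' G_inv[OF h(1)]])
    then have 2: "scaled_lim (\<lambda>n. matrix_inv (h ** g n)) (\<lambda>n. norm (matrix_inv (g n))) y (\<eta> v* matrix_inv h)"
      by (simp add: inv_mult[OF h(1) gG])
    have "(\<eta> v* matrix_inv h) \<bullet> (h *v q) = 0"
      using y pq by (simp add: inner_mv_transpose[symmetric] G_cancel[OF h(1)])
    then show ?thesis using that[OF 1 2 inf inf'] y True h(2) pq by (simp add: pr_id)
  qed
next
  case False
  then have fixed: "pr (h *v q) = q" if "h \<in> G" "q \<in> limit_cone" "a \<bullet> q = 1" for h q using that by blast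
  obtain q1 where q1: "q1 \<in> limit_cone" "a \<bullet> q1 = 1" using ex_limit_cone_avoiding[of "{}"] by blast
  obtain q2 where q2: "q2 \<in> limit_cone" "a \<bullet> q2 = 1" "q2 \<noteq> q1" using ex_limit_cone_avoiding[of "{q1}"] by blast
  obtain g \<psi> y \<eta> where inf: "filterlim (\<lambda>n. norm (g n)) at_top sequentially"
    and cv: "scaled_lim g (\<lambda>n. norm (g n)) (pr q1) \<psi>"
    and cv': "scaled_lim (\<lambda>n. matrix_inv (g n)) (\<lambda>n. norm (matrix_inv (g n))) y \<eta>"
    and y: "a \<bullet> y = 1" "\<psi> \<bullet> y = 0" "\<eta> \<bullet> pr q1 = 0"
    by (rule limit_cone_sequence[OF q1(1)])
  have pq: "pr q1 = q1" using q1 pr_id by simp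
  have gG: "g n \<in> G" for n using cv by (simp add: scaled_lim_def)
  have inf': "filterlim (\<lambda>n. norm (matrix_inv (g n))) at_top sequentially"
    by (rule G_unbounded_inv[OF gG inf])
  have "y \<noteq> q1"
  proof
    assume "y = q1"
    then have "\<psi> \<bullet> q2 > 0"
      using supporting_strict[of \<psi> q1 q2] cv y q1 q2 by (auto simp: scaled_lim_def pr_id limit_cone_def)
    then have "(\<lambda>n. pr (g n *v q2)) \<longlonglongrightarrow> q1" using scaled_lim_pr[OF cv] pq by simp
    moreover have "pr (g n *v q2) = q2" for n using fixed gG q2 by blast
    ultimately show False using q2 by (simp add: LIMSEQ_const_iff)
  qed
  then show ?thesis using that[OF cv cv' inf inf'] y pq by (simp add: pr_id)
qed

lemma ex_loxodromic: "\<exists>\<gamma> x y \<alpha> \<beta> \<rho> \<mu>. loxodromic C a G \<gamma> x y \<alpha> \<beta> \<rho> \<mu>"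
proof -
  obtain g A B x0 \<psi> y0 \<eta> where cv0: "scaled_lim g A x0 \<psi>" "scaled_lim (\<lambda>n. matrix_inv (g n)) B y0 \<eta>"
    and inf: "filterlim A at_top sequentially" "filterlim B at_top sequentially"
    and z: "\<psi> \<bullet> y0 = 0" "\<eta> \<bullet> x0 = 0" "pr x0 \<noteq> pr y0"
    by (rule ex_expanding_sequence)
  have rescale: "scaled_lim f (\<lambda>n. D n) (pr u) ((a \<bullet> u) *\<^sub>R \<xi>)" if "scaled_lim f D u \<xi>" for f D u \<xi>
  proof -
    have u: "u \<in> bd" "supporting \<xi>" using that by (auto simp: scaled_lim_def)
    have "a \<bullet> u > 0" using bd_pos u by blast
    then have "outer (pr u) ((a \<bullet> u) *\<^sub>R \<xi>) = outer u \<xi>" by (simp add: pr_def outer_scaleR)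
    moreover have "supporting ((a \<bullet> u) *\<^sub>R \<xi>)" using u \<open>a \<bullet> u > 0\<close> by (auto simp: supporting_def)
    ultimately show ?thesis using that pr_bd[OF u(1)] by (simp add: scaled_lim_def)
  qed
  have bd0: "x0 \<in> bd" "y0 \<in> bd" "supporting \<psi>" "supporting \<eta>" using cv0 by (auto simp: scaled_lim_def)
  have \<psi>x: "((a \<bullet> x0) *\<^sub>R \<psi>) \<bullet> pr x0 > 0"
    using supporting_strict[OF bd0(3,2,1) z(1)] z(3) bd_pos[OF bd0(1)] by (simp add: pr_def)
  have \<eta>y: "((a \<bullet> y0) *\<^sub>R \<eta>) \<bullet> pr y0 > 0"
    using supporting_strict[OF bd0(4,1,2) z(2)] z(3) bd_pos[OF bd0(2)] by (simp add: pr_def)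
  have "eventually (\<lambda>n. \<exists>v\<in>closure C. \<exists>c\<ge>2. a \<bullet> v = 1 \<and> g n *v v = c *\<^sub>R v) sequentially"
    using eigenvector_near[OF rescale[OF cv0(1)] _ \<psi>x inf(1)] pr_bd[OF bd0(1)] by blast
  moreover have "eventually (\<lambda>n. \<exists>v\<in>closure C. \<exists>c\<ge>2. a \<bullet> v = 1 \<and> matrix_inv (g n) *v v = c *\<^sub>R v) sequentially"
    using eigenvector_near[OF rescale[OF cv0(2)] _ \<eta>y inf(2)] pr_bd[OF bd0(2)] by blast
  ultimately have "eventually (\<lambda>n. (\<exists>v\<in>closure C. \<exists>c\<ge>2. a \<bullet> v = 1 \<and> g n *v v = c *\<^sub>R v) \<and>
      (\<exists>v\<in>closure C. \<exists>c\<ge>2. a \<bullet> v = 1 \<and> matrix_inv (g n) *v v = c *\<^sub>R v)) sequentially"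
    by (rule eventually_conj)
  from eventually_happens'[OF sequentially_bot this] obtain n v c w d where v: "v \<in> closure C" "a \<bullet> v = 1" and c: "c \<ge> 2" "g n *v v = c *\<^sub>R v"
    and w: "w \<in> closure C" "a \<bullet> w = 1" and d: "d \<ge> 2" "matrix_inv (g n) *v w = d *\<^sub>R w"
    by blast
  define \<gamma> where "\<gamma> = g n"
  have \<gamma>: "\<gamma> \<in> G" using cv0 by (simp add: scaled_lim_def \<gamma>_def)
  have ev: "\<gamma> *v v = c *\<^sub>R v" and ew': "matrix_inv \<gamma> *v w = d *\<^sub>R w" using c d by (simp_all add: \<gamma>_def)
  have ew: "\<gamma> *v w = (1 / d) *\<^sub>R w" using inv_eigen[OF G_inv[OF \<gamma>] ew'] d inv_inv[OF \<gamma>] by simp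
  have ev': "matrix_inv \<gamma> *v v = (1 / c) *\<^sub>R v" using inv_eigen[OF \<gamma> ev] c by simp
  have "v \<in> bd \<and> w \<in> bd \<and> (\<exists>\<alpha>. supporting \<alpha> \<and> \<alpha> \<bullet> v = 1 \<and> \<alpha> \<bullet> w = 0 \<and> scaled_lim (mpow \<gamma>) (\<lambda>n. c ^ n) v \<alpha>)"
    by (rule powers_converge_to_projection[OF \<gamma> v w ev ew]) (use c d in auto)
  moreover have "w \<in> bd \<and> v \<in> bd \<and> (\<exists>\<alpha>. supporting \<alpha> \<and> \<alpha> \<bullet> w = 1 \<and> \<alpha> \<bullet> v = 0 \<and>
      scaled_lim (mpow (matrix_inv \<gamma>)) (\<lambda>n. d ^ n) w \<alpha>)"
    by (rule powers_converge_to_projection[OF G_inv[OF \<gamma>] w v ew' ev']) (use c d in auto)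
  ultimately obtain \<alpha> \<beta> where
    "\<alpha> \<bullet> v = 1" "\<alpha> \<bullet> w = 0" "scaled_lim (mpow \<gamma>) (\<lambda>n. c ^ n) v \<alpha>"
    "\<beta> \<bullet> w = 1" "\<beta> \<bullet> v = 0" "scaled_lim (mpow (matrix_inv \<gamma>)) (\<lambda>n. d ^ n) w \<beta>" by blast
  moreover from this have "v \<noteq> w" by auto
  moreover have "1 / d < c"
  proof -
    have "1 / d < 1" using d by simp
    then show ?thesis using c by linarith
  qed
  ultimately have "loxodromic C a G \<gamma> v w \<alpha> \<beta> c (1 / d)"
    using v w \<gamma> ev ew d by unfold_locales auto
  then show ?thesis by blast
qed

end

context loxodromic
begin

lemma x_bd: "x \<in> bd" and y_bd: "y \<in> bd" and \<alpha>_supporting: "supporting \<alpha>" and \<beta>_supporting: "supporting \<beta>"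
  using pow_lim inv_pow_lim by (auto simp: scaled_lim_def)

lemma \<rho>_pos: "\<rho> > 0" using \<mu>_pos \<mu>_\<rho> by linarith

text \<open>The statements about \<open>x\<close> yield those about \<open>y\<close> by passing to the inverse.\<close>

lemma inverse_loxodromic: "loxodromic C a G (matrix_inv \<gamma>) y x \<beta> \<alpha> (1 / \<mu>) (1 / \<rho>)"
proof unfold_locales
  show "matrix_inv \<gamma> *v y = (1 / \<mu>) *\<^sub>R y" "matrix_inv \<gamma> *v x = (1 / \<rho>) *\<^sub>R x"
    using inv_eigen[OF \<gamma>_G] \<gamma>_x \<gamma>_y \<mu>_pos \<rho>_pos by auto
  show "1 / \<rho> < 1 / \<mu>" using \<mu>_pos \<mu>_\<rho> by (simp add: frac_less2)
  show "scaled_lim (mpow (matrix_inv (matrix_inv \<gamma>))) (\<lambda>n. (1 / (1 / \<rho>)) ^ n) x \<alpha>"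
    using pow_lim inv_inv[OF \<gamma>_G] by simp
qed (use G_inv \<gamma>_G x_norm y_norm x_neq_y \<rho>_pos \<alpha>_x \<alpha>_y \<beta>_y \<beta>_x inv_pow_lim in auto)

lemma pr_x: "pr x = x" and pr_y: "pr y = y" using x_norm y_norm by (simp_all add: pr_id)

lemma \<alpha>_pos: "v \<in> bd \<Longrightarrow> pr v \<noteq> y \<Longrightarrow> \<alpha> \<bullet> v > 0"
  using supporting_strict[OF \<alpha>_supporting y_bd _ \<alpha>_y] pr_y by auto

lemma \<beta>_pos: "v \<in> bd \<Longrightarrow> pr v \<noteq> x \<Longrightarrow> \<beta> \<bullet> v > 0"
  using supporting_strict[OF \<beta>_supporting x_bd _ \<beta>_x] pr_x by auto

lemma pow_x: "mpow \<gamma> n *v x = \<rho> ^ n *\<^sub>R x" and pow_y: "mpow \<gamma> n *v y = \<mu> ^ n *\<^sub>R y"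
  by (rule mpow_eigen, rule \<gamma>_x) (rule mpow_eigen, rule \<gamma>_y)

text \<open>A discrete non-elementary group does not fix the attracting point of a loxodromic element. Some
  \<open>h\<close> moves \<open>y\<close>, since otherwise every limit point is \<open>x\<close> or \<open>y\<close>. If \<open>x\<close> were fixed by \<open>G\<close>, the
  elements \<open>\<gamma>\<^sup>-\<^sup>n h \<gamma>\<^sup>n\<close> would be pairwise different, because \<open>h\<close> commutes with no power of \<open>\<gamma>\<close>, and would hence
  diverge; but they keep the images of both \<open>x\<close> and \<open>y\<close> bounded, so the limit form of a subsequence vanishes at
  two different boundary points.\<close>

lemma ex_moving_attracting:
  shows "\<exists>h\<in>G. pr (h *v x) \<noteq> x"
proof (rule ccontr)
  assume "\<not> ?thesis"
  then have fx: "pr (h *v x) = x" if "h \<in> G" for h using that by blast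
  have "\<exists>h\<in>G. pr (h *v y) \<noteq> y"
  proof (rule ccontr)
    assume "\<not> ?thesis"
    then have fy: "pr (h *v y) = y" if "h \<in> G" for h using that by blast
    obtain q where q: "q \<in> limit_cone" "a \<bullet> q = 1" "q \<noteq> x" "q \<noteq> y" using ex_limit_cone_avoiding[of "{x, y}"] by auto
    obtain g \<psi> y' \<eta> where cv: "scaled_lim g (\<lambda>n. norm (g n)) (pr q) \<psi>"
      by (rule limit_cone_sequence[OF q(1)]) (rule that)
    have \<psi>: "supporting \<psi>" and g: "g n \<in> G" for n using cv by (auto simp: scaled_lim_def)
    have no: False if z: "\<psi> \<bullet> z > 0" "\<And>h. h \<in> G \<Longrightarrow> pr (h *v z) = z" "z \<noteq> q" for z
    proof -
      have "(\<lambda>n. pr (g n *v z)) \<longlonglongrightarrow> q" using scaled_lim_pr[OF cv z(1)] q by (simp add: pr_id)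
      then show False using z(2)[OF g] z(3) by (simp add: LIMSEQ_const_iff)
    qed
    have "\<psi> \<bullet> x = 0"
      using no[OF _ fx] q supporting_closure[OF \<psi>, of x] x_bd by (force simp: bd_def)
    then have "\<psi> \<bullet> y > 0" using supporting_strict[OF \<psi> x_bd y_bd] pr_x pr_y x_neq_y by simp
    then show False using no[OF _ fy] q by blast
  qed
  then obtain h where h: "h \<in> G" "pr (h *v y) \<noteq> y" by blast
  define P where "P = mpow \<gamma>"
  have P: "P n \<in> G" for n using G_mpow[OF \<gamma>_G] by (simp add: P_def)
  define k where "k n = matrix_inv (P n) ** (h ** P n)" for n
  have kG: "k n \<in> G" for n using P h by (simp add: k_def G_mult G_inv)
  have hx: "h *v x = (a \<bullet> (h *v x)) *\<^sub>R x" using pr_scaled[OF G_bd[OF h(1) x_bd]] fx[OF h(1)] by simp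
  have hy: "h *v y \<in> bd" using G_bd[OF h(1) y_bd] .
  have hy_x: "pr (h *v y) \<noteq> x"
    using pr_mult_eq_iff[OF h(1) y_bd x_bd] fx[OF h(1)] pr_x pr_y x_neq_y by auto
  \<comment> \<open>Otherwise \<open>h y\<close> is fixed by a power of \<open>\<gamma>\<close>, whereas the powers attract it to \<open>x\<close>.\<close>
  have nocomm: "P d ** h \<noteq> h ** P d" if d: "d \<ge> 1" for d
  proof
    assume c: "P d ** h = h ** P d"
    have "P d *v (h *v y) = h *v (P d *v y)" using c by (simp add: matrix_vector_mul_assoc)
    also have "\<dots> = \<mu> ^ d *\<^sub>R (h *v y)" by (simp add: P_def pow_y matrix_vector_mult_scaleR)
    finally have e: "P d *v (h *v y) = \<mu> ^ d *\<^sub>R (h *v y)" .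
    have e': "P (d * j) *v (h *v y) = (\<mu> ^ d) ^ j *\<^sub>R (h *v y)" for j
      using mpow_eigen[OF e, of j] by (simp add: P_def mpow_mult)
    have sm: "strict_mono (\<lambda>j. d * j)" using d by (simp add: strict_mono_def)
    have "(\<lambda>n. pr (P n *v (h *v y))) \<longlonglongrightarrow> x"
      using scaled_lim_pr[OF pow_lim \<alpha>_pos[OF hy h(2)]] pr_x by (simp add: P_def)
    from LIMSEQ_subseq_LIMSEQ[OF this sm]
    have "(\<lambda>j. pr (P (d * j) *v (h *v y))) \<longlonglongrightarrow> x" by (simp add: o_def)
    moreover have "pr (P (d * j) *v (h *v y)) = pr (h *v y)" for j
      unfolding e' using \<mu>_pos by (intro pr_scale) simp
    ultimately show False using hy_x by (simp add: LIMSEQ_const_iff)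
  qed
  have neq: "k m \<noteq> k n" if mn: "m < n" for m n
  proof
    assume e: "k m = k n"
    obtain d where d: "n = m + d" "d \<ge> 1" using mn by (metis add.commute less_iff_Suc_add Suc_eq_plus1 le_add2 add.assoc)
    have Pn: "P n = P m ** P d" "P n = P d ** P m" using d by (simp_all add: P_def mpow_add mpow_commute)
    have i: "P n ** matrix_inv (P m) = P d"
      using Pn(2) by (simp add: matrix_mul_assoc[symmetric] G_cancel[OF P])
    have "P n ** (k m) ** matrix_inv (P m) = P d ** h"
      unfolding k_def by (metis (no_types, lifting) G_cancel(1)[OF P] i matrix_mul_assoc matrix_mul_rid)
    moreover have "P n ** (k n) ** matrix_inv (P m) = h ** P d"
      unfolding k_def by (metis (no_types, lifting) G_cancel(1)[OF P] i matrix_mul_assoc matrix_mul_lid)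
    ultimately show False using e nocomm[OF d(2)] by simp
  qed
  have "inj k" by (rule linorder_injI) (use neq in blast)
  then have unb: "filterlim (\<lambda>n. norm (k n)) at_top sequentially" by (intro inj_unbounded kG)
  obtain r x1 \<psi> y1 \<eta> where r: "strict_mono (r :: nat \<Rightarrow> nat)" and x1: "a \<bullet> x1 = 1"
    and cv: "scaled_lim (\<lambda>n. k (r n)) (\<lambda>n. norm (k (r n))) x1 \<psi>"
    by (rule diverging_limits[OF kG unb]) (rule that)
  have unbr: "filterlim (\<lambda>n. norm (k (r n))) at_top sequentially"
    using filterlim_compose[OF unb filterlim_subseq[OF r]] by simp
  have inv0: "(\<lambda>n. 1 / norm (k (r n))) \<longlonglongrightarrow> 0"
    by (intro tendsto_divide_0[OF tendsto_const] filterlim_at_top_imp_at_infinity unbr)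
  \<comment> \<open>The limit form vanishes at each vector with a convergent, hence bounded, orbit.\<close>
  have zero: "\<psi> \<bullet> u = 0" if lim: "(\<lambda>n. k n *v u) \<longlonglongrightarrow> l" for u l
  proof -
    have "(\<lambda>n. (1 / norm (k (r n))) *\<^sub>R (k (r n) *v u)) \<longlonglongrightarrow> 0 *\<^sub>R l"
      using LIMSEQ_subseq_LIMSEQ[OF lim r] by (intro tendsto_scaleR inv0) (simp add: o_def)
    then have "(\<psi> \<bullet> u) *\<^sub>R x1 = 0" using LIMSEQ_unique[OF scaled_lim_apply[OF cv]] by simp
    then show ?thesis using x1 by auto
  qed
  have "k n *v x = (a \<bullet> (h *v x)) *\<^sub>R x" for n
  proof -
    have "k n *v x = matrix_inv (P n) *v (h *v (P n *v x))"
      by (simp add: k_def matrix_vector_mul_assoc)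
    also have "P n *v x = \<rho> ^ n *\<^sub>R x" by (simp add: P_def pow_x)
    also have "h *v \<dots> = (a \<bullet> (h *v x)) *\<^sub>R (P n *v x)"
      by (subst matrix_vector_mult_scaleR, subst hx) (simp add: P_def pow_x)
    finally show ?thesis by (simp add: matrix_vector_mult_scaleR G_cancel[OF P])
  qed
  then have \<psi>x: "\<psi> \<bullet> x = 0" by (intro zero[of x "(a \<bullet> (h *v x)) *\<^sub>R x"]) simp
  have "k n *v y = (1 / (1 / \<mu>) ^ n) *\<^sub>R (mpow (matrix_inv \<gamma>) n *v (h *v y))" for n
  proof -
    have "k n *v y = matrix_inv (P n) *v (h *v (P n *v y))"
      by (simp add: k_def matrix_vector_mul_assoc)
    then show ?thesis
      by (simp add: P_def pow_y matrix_vector_mult_scaleR mpow_inv[OF \<gamma>_G] power_divide)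
  qed
  then have \<psi>y: "\<psi> \<bullet> y = 0"
    using scaled_lim_apply[OF inv_pow_lim, of "h *v y"] by (intro zero[of y "(\<beta> \<bullet> (h *v y)) *\<^sub>R y"]) simp
  have "supporting \<psi>" using cv by (simp add: scaled_lim_def)
  then show False using supporting_strict[OF _ x_bd y_bd \<psi>x] pr_x pr_y x_neq_y \<psi>y by simp
qed

text \<open>A sequence with attracting point \<open>q\<close> brings \<open>h x\<close> close to \<open>q\<close>, unless \<open>h x\<close> is its repelling point;
  at least one of \<open>x\<close> and a moved copy of \<open>x\<close> is not.\<close>

lemma attracting_orbit_dense:
  assumes q: "q \<in> limit_cone" and N: "open N" "q \<in> N"
  shows "\<exists>u\<in>G. \<exists>c>0. c *\<^sub>R (u *v x) \<in> N"
proof -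
  obtain g \<psi> y' \<eta> where cv: "scaled_lim g (\<lambda>n. norm (g n)) (pr q) \<psi>"
    by (rule limit_cone_sequence[OF q]) (rule that)
  have \<psi>: "supporting \<psi>" and g: "g n \<in> G" for n using cv by (auto simp: scaled_lim_def)
  obtain h0 where h0: "h0 \<in> G" "pr (h0 *v x) \<noteq> x" using ex_moving_attracting by blast
  have "\<exists>h\<in>G. \<psi> \<bullet> (h *v x) > 0"
  proof (cases "\<psi> \<bullet> x = 0")
    case True
    then have "\<psi> \<bullet> (h0 *v x) > 0"
      using supporting_strict[OF \<psi> x_bd G_bd[OF h0(1) x_bd]] pr_x h0(2) by auto
    then show ?thesis using h0 by blast
  next
    case False
    then have "\<psi> \<bullet> (mat 1 *v x) > 0" using supporting_closure[OF \<psi>, of x] x_bd by (simp add: bd_def)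
    then show ?thesis using G_one by blast
  qed
  then obtain h where h: "h \<in> G" "\<psi> \<bullet> (h *v x) > 0" by blast
  define d where "d = (a \<bullet> q) / (\<psi> \<bullet> (h *v x))"
  have qb: "q \<in> bd" using q by (simp add: limit_cone_def)
  have d: "d > 0" using bd_pos[OF qb] h by (simp add: d_def)
  have "(\<lambda>n. d *\<^sub>R ((1 / norm (g n)) *\<^sub>R (g n *v (h *v x)))) \<longlonglongrightarrow> d *\<^sub>R ((\<psi> \<bullet> (h *v x)) *\<^sub>R pr q)"
    by (intro tendsto_intros scaled_lim_apply[OF cv])
  moreover have "d *\<^sub>R ((\<psi> \<bullet> (h *v x)) *\<^sub>R pr q) = q" using h pr_scaled[OF qb] by (simp add: d_def)
  ultimately have "eventually (\<lambda>n. d *\<^sub>R ((1 / norm (g n)) *\<^sub>R (g n *v (h *v x))) \<in> N) sequentially"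
    using N topological_tendstoD by fastforce
  then obtain n where n: "d *\<^sub>R ((1 / norm (g n)) *\<^sub>R (g n *v (h *v x))) \<in> N"
    using eventually_happens sequentially_bot by blast
  then have "(d * (1 / norm (g n))) *\<^sub>R ((g n ** h) *v x) \<in> N" by (simp add: matrix_vector_mul_assoc)
  moreover have "d * (1 / norm (g n)) > 0" using d G_nonzero[OF g] by simp
  ultimately show ?thesis using G_mult[OF g h(1)] by blast
qed

lemma ex_moving_repelling: "\<exists>h\<in>G. pr (h *v y) \<noteq> y"
  by (rule loxodromic.ex_moving_attracting[OF inverse_loxodromic])

lemma repelling_orbit_dense:
  assumes "q \<in> limit_cone" "open N" "q \<in> N"
  shows "\<exists>u\<in>G. \<exists>c>0. c *\<^sub>R (u *v y) \<in> N"
  by (rule loxodromic.attracting_orbit_dense[OF inverse_loxodromic assms])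

end

section \<open>Translation values\<close>

text \<open>Inverses exist up to closure: by Dirichlet's theorem some multiple \<open>k s\<close>, \<open>k \<ge> 1\<close>, is close to an
  integer multiple of the period \<open>l\<close>, so \<open>(k - 1) s\<close> is close to \<open>- s\<close> modulo \<open>l\<close>.\<close>

lemma
  fixes S :: "real set"
  assumes add: "\<forall>s\<in>S. \<forall>t\<in>S. s + t \<in> S" and l: "l > 0" "l \<in> S" "- l \<in> S"
  shows semigroup_closure_add: "\<And>s t. s \<in> closure S \<Longrightarrow> t \<in> closure S \<Longrightarrow> s + t \<in> closure S"
    and semigroup_closure_uminus: "\<And>s. s \<in> closure S \<Longrightarrow> - s \<in> closure S"
proof -
  show cadd: "s + t \<in> closure S" if st: "s \<in> closure S" "t \<in> closure S" for s t
  proof -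
    obtain f g where f: "\<And>n. f n \<in> S" "f \<longlonglongrightarrow> s" and g: "\<And>n. g n \<in> S" "g \<longlonglongrightarrow> t"
      using st unfolding closure_sequential by blast
    show ?thesis by (rule closure_limI[of "\<lambda>n. f n + g n"]) (use add f g in \<open>auto intro: tendsto_add\<close>)
  qed
  have zero: "0 \<in> S" using bspec[OF bspec[OF add l(2)] l(3)] by simp
  have mult: "real m * s \<in> S" if "s \<in> S" for m s
    by (induction m) (use add that in \<open>auto simp: zero distrib_right\<close>)
  have imult: "of_int h * l \<in> S" for h
  proof (cases "h \<ge> 0")
    case True
    then show ?thesis using mult[OF l(2), of "nat h"] by simp
  next
    case False
    then show ?thesis using mult[OF l(3), of "nat (- h)"] by simp
  qed
  have neg: "- s \<in> closure S" if s: "s \<in> S" for s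
    unfolding closure_approachable
  proof (intro allI impI)
    fix e :: real assume e: "e > 0"
    obtain N :: nat where N: "l / e < real N" using reals_Archimedean2 by blast
    have N0: "N > 0"
    proof (rule ccontr)
      assume "\<not> N > 0"
      then have "l / e < 0" using N by simp
      then show False using l e by (simp add: divide_less_0_iff)
    qed
    obtain h k where k: "0 < k" "\<bar>of_int k * (s / l) - of_int h\<bar> < 1 / N"
      using Dirichlet_approx[OF N0, of "s / l"] by metis
    have "real (nat (k - 1)) * s + of_int (- h) * l \<in> S" by (intro bspec[OF bspec[OF add]] mult s imult)
    moreover have "real (nat (k - 1)) = of_int k - 1" using k by simp
    ultimately have tS: "(of_int k - 1) * s - of_int h * l \<in> S" by simp
    have "\<bar>of_int k * s - of_int h * l\<bar> = \<bar>of_int k * (s / l) - of_int h\<bar> * l"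
      using l(1) by (simp add: abs_mult_pos' left_diff_distrib abs_mult_pos)
    also have "\<dots> < 1 / N * l" using k(2) l(1) by (rule mult_strict_right_mono)
    also have "\<dots> < e" using N N0 e by (simp add: field_simps)
    finally show "\<exists>t\<in>S. dist t (- s) < e"
      using tS by (intro bexI[OF _ tS]) (simp add: dist_real_def left_diff_distrib)
  qed
  show "- s \<in> closure S" if s: "s \<in> closure S" for s
  proof -
    obtain f where f: "\<And>n. f n \<in> S" "f \<longlonglongrightarrow> s" using s unfolding closure_sequential by blast
    have "- s \<in> closure (closure S)"
      by (rule closure_limI[of "\<lambda>n. - f n"]) (intro neg f tendsto_minus)+
    then show ?thesis by simp
  qed
qed

lemma semigroup_with_period_dense:
  fixes S :: "real set"
  assumes add: "\<forall>s\<in>S. \<forall>t\<in>S. s + t \<in> S" and l: "l > 0" "l \<in> S" "- l \<in> S"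
    and small: "\<And>e. e > 0 \<Longrightarrow> \<exists>d\<in>closure S. d \<noteq> 0 \<and> \<bar>d\<bar> < e"
  shows "closure S = UNIV"
proof -
  note cadd = semigroup_closure_add[OF add l] and cneg = semigroup_closure_uminus[OF add l]
  have zero: "0 \<in> closure S" using bspec[OF bspec[OF add l(2)] l(3)] closure_subset by auto
  have nmult: "real m * s \<in> closure S" if "s \<in> closure S" for m s
    by (induction m) (auto simp: zero distrib_right intro: cadd that)
  have imult: "of_int h * s \<in> closure S" if "s \<in> closure S" for h s
  proof (cases "h \<ge> 0")
    case True
    then show ?thesis using nmult[OF that, of "nat h"] by simp
  next
    case False
    then show ?thesis using nmult[OF cneg[OF that], of "nat (- h)"] by simp
  qed
  have "z \<in> closure (closure S)" for z
    unfolding closure_approachable[of z]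
  proof (intro allI impI)
    fix e :: real assume "e > 0"
    then obtain d where d: "d \<in> closure S" "d \<noteq> 0" "\<bar>d\<bar> < e" using small by blast
    have d': "\<bar>d\<bar> \<in> closure S" using d cneg by (auto simp: abs_if)
    have "\<bar>z - of_int \<lfloor>z / \<bar>d\<bar>\<rfloor> * \<bar>d\<bar>\<bar> < e"
    proof -
      have 1: "of_int \<lfloor>z / \<bar>d\<bar>\<rfloor> * \<bar>d\<bar> \<le> z" using d by (simp add: floor_divide_lower)
      have "z < (of_int \<lfloor>z / \<bar>d\<bar>\<rfloor> + 1) * \<bar>d\<bar>" using d by (intro floor_divide_upper) simp
      then show ?thesis using 1 d by (simp add: distrib_right)
    qed
    then show "\<exists>t\<in>closure S. dist t z < e"
      using imult[OF d', of "\<lfloor>z / \<bar>d\<bar>\<rfloor>"] by (auto simp: dist_real_def abs_minus_commute)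
  qed
  then show ?thesis by auto
qed

context loxodromic
begin

text \<open>Twice the translation length of \<open>\<gamma>\<close> for the Hilbert distance.\<close>

definition period :: real where "period = ln \<rho> - ln \<mu>"

lemma period_pos: "period > 0" using \<mu>_pos \<mu>_\<rho> \<rho>_pos by (simp add: period_def)

text \<open>The set of \<open>s\<close> for which there are words with the same attracting and repelling behaviour as \<open>\<gamma>\<^sup>n\<close>
  whose total expansion exceeds that of \<open>\<gamma>\<^sup>n\<close> by \<open>s\<close> in the limit.\<close>

definition translation_values :: "real set" where
  "translation_values = {s. \<exists>w A B. scaled_lim w A x \<alpha> \<and> scaled_lim (\<lambda>n. matrix_inv (w n)) B y \<beta> \<and>
     (\<lambda>n. ln (A n) + ln (B n) - real n * period) \<longlonglongrightarrow> s}"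

lemma translation_valuesI:
  "scaled_lim w A x \<alpha> \<Longrightarrow> scaled_lim (\<lambda>n. matrix_inv (w n)) B y \<beta> \<Longrightarrow>
    (\<lambda>n. ln (A n) + ln (B n) - real n * period) \<longlonglongrightarrow> s \<Longrightarrow> s \<in> translation_values"
  unfolding translation_values_def by blast

lemma filterlim_halves:
  "filterlim (\<lambda>n::nat. n div 2) at_top sequentially" "filterlim (\<lambda>n::nat. n - n div 2) at_top sequentially"
proof -
  show 1: "filterlim (\<lambda>n::nat. n div 2) at_top sequentially"
    unfolding filterlim_at_top eventually_sequentially
  proof
    fix Z :: nat show "\<exists>N. \<forall>n\<ge>N. Z \<le> n div 2" by (rule exI[of _ "2 * Z"]) auto
  qed
  show "filterlim (\<lambda>n::nat. n - n div 2) at_top sequentially"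
    by (rule filterlim_at_top_mono[OF 1]) (intro always_eventually allI, linarith)
qed

lemma translation_values_zero: "0 \<in> translation_values"
proof (rule translation_valuesI[OF pow_lim])
  show "scaled_lim (\<lambda>n. matrix_inv (mpow \<gamma> n)) (\<lambda>n. (1 / \<mu>) ^ n) y \<beta>"
    using inv_pow_lim by (simp add: mpow_inv[OF \<gamma>_G, symmetric])
  have "ln (\<rho> ^ n) + ln ((1 / \<mu>) ^ n) - real n * period = 0" for n
    using \<rho>_pos \<mu>_pos by (simp add: ln_realpow ln_div period_def algebra_simps)
  then show "(\<lambda>n. ln (\<rho> ^ n) + ln ((1 / \<mu>) ^ n) - real n * period) \<longlonglongrightarrow> 0"
    by (intro tendsto_eventually always_eventually) blast
qed

text \<open>Put the first half of one word, the letter \<open>h\<close>, and the second half of the other word side by side.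
  Splitting \<open>n\<close> as \<open>n div 2\<close> and \<open>n - n div 2\<close> makes both indices tend to infinity while their sum stays \<open>n\<close>.\<close>

lemma translation_values_join:
  assumes "s \<in> translation_values" "t \<in> translation_values" and h: "h \<in> G" and pos: "\<alpha> \<bullet> (h *v x) > 0" "\<beta> \<bullet> (matrix_inv h *v y) > 0"
  shows "s + t + (ln (\<alpha> \<bullet> (h *v x)) + ln (\<beta> \<bullet> (matrix_inv h *v y))) \<in> translation_values"
proof -
  obtain w A B where w: "scaled_lim w A x \<alpha>" "scaled_lim (\<lambda>n. matrix_inv (w n)) B y \<beta>"
    "(\<lambda>n. ln (A n) + ln (B n) - real n * period) \<longlonglongrightarrow> s" using assms(1) unfolding translation_values_def by blast
  obtain w' A' B' where w': "scaled_lim w' A' x \<alpha>" "scaled_lim (\<lambda>n. matrix_inv (w' n)) B' y \<beta>"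
    "(\<lambda>n. ln (A' n) + ln (B' n) - real n * period) \<longlonglongrightarrow> t" using assms(2) unfolding translation_values_def by blast
  let ?j = "\<lambda>n::nat. n div 2" and ?k = "\<lambda>n::nat. n - n div 2"
  have G: "w n \<in> G" "w' n \<in> G" and P: "A n > 0" "B n > 0" "A' n > 0" "B' n > 0" for n
    using w w' by (auto simp: scaled_lim_def)
  have 1: "scaled_lim (\<lambda>n. w (?j n) ** (h ** w' (?k n))) (\<lambda>n. A (?j n) * A' (?k n) * (\<alpha> \<bullet> (h *v x))) x \<alpha>"
    by (rule scaled_lim_join[OF w(1) w'(1) h pos(1) filterlim_halves])
  have "scaled_lim (\<lambda>n. matrix_inv (w' (?k n)) ** (matrix_inv h ** matrix_inv (w (?j n))))
      (\<lambda>n. B' (?k n) * B (?j n) * (\<beta> \<bullet> (matrix_inv h *v y))) y \<beta>"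
    by (rule scaled_lim_join[OF w'(2) w(2) G_inv[OF h] pos(2) filterlim_halves(2,1)])
  then have 2: "scaled_lim (\<lambda>n. matrix_inv (w (?j n) ** (h ** w' (?k n))))
      (\<lambda>n. B' (?k n) * B (?j n) * (\<beta> \<bullet> (matrix_inv h *v y))) y \<beta>"
    by (simp add: inv_mult G h G_mult matrix_mul_assoc)
  have "(\<lambda>n. (ln (A (?j n)) + ln (B (?j n)) - real (?j n) * period) +
       (ln (A' (?k n)) + ln (B' (?k n)) - real (?k n) * period) +
       (ln (\<alpha> \<bullet> (h *v x)) + ln (\<beta> \<bullet> (matrix_inv h *v y)))) \<longlonglongrightarrow>
      s + t + (ln (\<alpha> \<bullet> (h *v x)) + ln (\<beta> \<bullet> (matrix_inv h *v y)))"
    by (intro tendsto_add tendsto_const filterlim_compose[OF w(3) filterlim_halves(1)]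
        filterlim_compose[OF w'(3) filterlim_halves(2)])
  moreover have "(ln (A (?j n)) + ln (B (?j n)) - real (?j n) * period) +
       (ln (A' (?k n)) + ln (B' (?k n)) - real (?k n) * period) +
       (ln (\<alpha> \<bullet> (h *v x)) + ln (\<beta> \<bullet> (matrix_inv h *v y))) =
     ln (A (?j n) * A' (?k n) * (\<alpha> \<bullet> (h *v x))) + ln (B' (?k n) * B (?j n) * (\<beta> \<bullet> (matrix_inv h *v y)))
       - real n * period" for n
  proof -
    have "real n = real (?j n) + real (?k n)" by simp
    then have "real n * period = real (?j n) * period + real (?k n) * period" by (simp only: distrib_right)
    then show ?thesis using P pos by (simp add: ln_mult mult_pos_pos less_imp_neq[symmetric])
  qed
  ultimately show ?thesis by (intro translation_valuesI[OF 1 2]) simp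
qed

lemma translation_values_junction:
  assumes "h \<in> G" "\<alpha> \<bullet> (h *v x) > 0" "\<beta> \<bullet> (matrix_inv h *v y) > 0"
  shows "ln (\<alpha> \<bullet> (h *v x)) + ln (\<beta> \<bullet> (matrix_inv h *v y)) \<in> translation_values"
  using translation_values_join[OF translation_values_zero translation_values_zero assms] by simp

lemma translation_values_add: "s \<in> translation_values \<Longrightarrow> t \<in> translation_values \<Longrightarrow> s + t \<in> translation_values"
  using translation_values_join[OF _ _ G_one] \<alpha>_x \<beta>_y by (simp add: inv_one)

lemma translation_values_period: "period \<in> translation_values"
proof -
  have "ln (\<rho> ^ Suc n) + ln ((1 / \<mu>) ^ Suc n) - real n * period = period" for n
    using \<rho>_pos \<mu>_pos by (simp add: ln_realpow ln_div ln_mult period_def algebra_simps)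
  moreover have "scaled_lim (\<lambda>n. mpow \<gamma> (Suc n)) (\<lambda>n. \<rho> ^ Suc n) x \<alpha>"
    "scaled_lim (\<lambda>n. mpow (matrix_inv \<gamma>) (Suc n)) (\<lambda>n. (1 / \<mu>) ^ Suc n) y \<beta>"
    by (intro scaled_lim_compose[OF pow_lim] scaled_lim_compose[OF inv_pow_lim] filterlim_Suc)+
  ultimately show ?thesis
    by (intro translation_valuesI[of "\<lambda>n. mpow \<gamma> (Suc n)" "\<lambda>n. \<rho> ^ Suc n" "\<lambda>n. (1 / \<mu>) ^ Suc n"])
      (simp_all only: mpow_inv[OF \<gamma>_G, symmetric] tendsto_const)
qed

lemma translation_values_minus_period: "- period \<in> translation_values"
proof -
  have p: "filterlim (\<lambda>n::nat. n - 1) at_top sequentially" by (rule filterlim_minus_const_nat_at_top)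
  have "ln (\<rho> ^ (n - 1)) + ln ((1 / \<mu>) ^ (n - 1)) - real n * period = - period" if "n \<ge> 1" for n
    using \<rho>_pos \<mu>_pos that by (simp add: ln_realpow ln_div period_def of_nat_diff algebra_simps)
  then have "(\<lambda>n. ln (\<rho> ^ (n - 1)) + ln ((1 / \<mu>) ^ (n - 1)) - real n * period) \<longlonglongrightarrow> - period"
    by (intro tendsto_eventually) (auto simp: eventually_sequentially)
  moreover have "scaled_lim (\<lambda>n. mpow \<gamma> (n - 1)) (\<lambda>n. \<rho> ^ (n - 1)) x \<alpha>"
    "scaled_lim (\<lambda>n. mpow (matrix_inv \<gamma>) (n - 1)) (\<lambda>n. (1 / \<mu>) ^ (n - 1)) y \<beta>"
    by (intro scaled_lim_compose[OF pow_lim] scaled_lim_compose[OF inv_pow_lim] p)+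
  ultimately show ?thesis
    by (intro translation_valuesI[of "\<lambda>n. mpow \<gamma> (n - 1)" "\<lambda>n. \<rho> ^ (n - 1)" "\<lambda>n. (1 / \<mu>) ^ (n - 1)"])
      (simp_all only: mpow_inv[OF \<gamma>_G, symmetric])
qed

lemma translation_values_add_closed: "\<forall>s\<in>translation_values. \<forall>t\<in>translation_values. s + t \<in> translation_values" using translation_values_add by blast

lemmas translation_values_closure_add = semigroup_closure_add[OF translation_values_add_closed period_pos translation_values_period translation_values_minus_period]
lemmas translation_values_closure_uminus = semigroup_closure_uminus[OF translation_values_add_closed period_pos translation_values_period translation_values_minus_period]

lemma translation_values_minus_periods: "s \<in> translation_values \<Longrightarrow> s - real n * period \<in> translation_values"
proof (induction n)
  case (Suc n)
  then have "(s - real n * period) + - period \<in> translation_values" by (intro translation_values_add translation_values_minus_period) auto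
  then show ?case by (simp add: algebra_simps)
qed simp

text \<open>Insert the letter \<open>h\<^sub>1 \<gamma>\<^sup>-\<^sup>n h\<close> into a word, with \<open>h\<^sub>1\<close> fixed such that it moves \<open>y\<close>. As \<open>n\<close> tends to infinity
  its contribution splits: one part depends on \<open>h\<^sub>1\<close> only and is the constant \<open>\<kappa>\<close>, the other is symmetric in
  \<open>h\<close> and its inverse and involves only the attracting point \<open>x\<close>.\<close>

lemma ex_shifted_horospherical_values:
  "\<exists>\<kappa>. \<forall>h\<in>G. \<beta> \<bullet> (h *v x) > 0 \<longrightarrow> \<beta> \<bullet> (matrix_inv h *v x) > 0 \<longrightarrow>
     ln (\<beta> \<bullet> (h *v x)) + ln (\<beta> \<bullet> (matrix_inv h *v x)) + \<kappa> \<in> closure translation_values"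
proof -
  obtain h1 where h1: "h1 \<in> G" "pr (h1 *v y) \<noteq> y" using ex_moving_repelling by blast
  have h1': "pr (matrix_inv h1 *v y) \<noteq> y"
    using pr_mult_eq_iff[OF h1(1) G_bd[OF G_inv[OF h1(1)] y_bd] y_bd] h1 G_cancel[OF h1(1)] pr_y by auto
  have p1: "\<alpha> \<bullet> (h1 *v y) > 0" "\<alpha> \<bullet> (matrix_inv h1 *v y) > 0"
    using \<alpha>_pos h1 h1' G_bd y_bd G_inv by blast+
  define \<kappa> where "\<kappa> = ln (\<alpha> \<bullet> (h1 *v y)) + ln (\<alpha> \<bullet> (matrix_inv h1 *v y))"
  have "ln (\<beta> \<bullet> (h *v x)) + ln (\<beta> \<bullet> (matrix_inv h *v x)) + \<kappa> \<in> closure translation_values"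
    if h: "h \<in> G" and p: "\<beta> \<bullet> (h *v x) > 0" "\<beta> \<bullet> (matrix_inv h *v x) > 0" for h
  proof -
    \<comment> \<open>The scaling of \<open>k n\<close> involves \<open>\<mu>\<close> and that of its inverse involves \<open>\<rho>\<close>: together \<open>n\<close> periods.\<close>
    define k where "k n = h1 ** (mpow (matrix_inv \<gamma>) n ** h)" for n
    have kG: "k n \<in> G" for n unfolding k_def by (intro G_mult G_mpow G_inv h h1 \<gamma>_G)
    have ki: "matrix_inv (k n) = matrix_inv h ** mpow \<gamma> n ** matrix_inv h1" for n
      unfolding k_def
      by (simp add: inv_mult h1 h G_mult G_mpow G_inv \<gamma>_G mpow_inv[symmetric] inv_inv)
    have "(\<lambda>n. \<alpha> \<bullet> (h1 *v ((1 / (1 / \<mu>) ^ n) *\<^sub>R (mpow (matrix_inv \<gamma>) n *v (h *v x)))))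
        \<longlonglongrightarrow> \<alpha> \<bullet> (h1 *v ((\<beta> \<bullet> (h *v x)) *\<^sub>R y))"
      by (intro tendsto_inner tendsto_const tendsto_mv scaled_lim_apply[OF inv_pow_lim])
    then have L1: "(\<lambda>n. \<mu> ^ n * (\<alpha> \<bullet> (k n *v x))) \<longlonglongrightarrow> (\<beta> \<bullet> (h *v x)) * (\<alpha> \<bullet> (h1 *v y))"
      by (simp add: k_def matrix_vector_mult_scaleR matrix_vector_mul_assoc matrix_mul_assoc power_divide)
    have "(\<lambda>n. \<beta> \<bullet> (matrix_inv h *v ((1 / \<rho> ^ n) *\<^sub>R (mpow \<gamma> n *v (matrix_inv h1 *v y)))))
        \<longlonglongrightarrow> \<beta> \<bullet> (matrix_inv h *v ((\<alpha> \<bullet> (matrix_inv h1 *v y)) *\<^sub>R x))"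
      by (intro tendsto_inner tendsto_const tendsto_mv scaled_lim_apply[OF pow_lim])
    then have L2: "(\<lambda>n. (1 / \<rho> ^ n) * (\<beta> \<bullet> (matrix_inv (k n) *v y)))
        \<longlonglongrightarrow> (\<alpha> \<bullet> (matrix_inv h1 *v y)) * (\<beta> \<bullet> (matrix_inv h *v x))"
      by (simp add: ki matrix_vector_mult_scaleR matrix_vector_mul_assoc matrix_mul_assoc)
    have q: "(\<beta> \<bullet> (h *v x)) * (\<alpha> \<bullet> (h1 *v y)) > 0" "(\<alpha> \<bullet> (matrix_inv h1 *v y)) * (\<beta> \<bullet> (matrix_inv h *v x)) > 0"
      using p p1 by simp_all
    have e: "eventually (\<lambda>n. \<mu> ^ n * (\<alpha> \<bullet> (k n *v x)) > 0 \<and> (1 / \<rho> ^ n) * (\<beta> \<bullet> (matrix_inv (k n) *v y)) > 0) sequentially"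
      using order_tendstoD(1)[OF L1 q(1)] order_tendstoD(1)[OF L2 q(2)] by (rule eventually_conj)
    have "(\<lambda>n. ln (\<mu> ^ n * (\<alpha> \<bullet> (k n *v x))) + ln ((1 / \<rho> ^ n) * (\<beta> \<bullet> (matrix_inv (k n) *v y))))
       \<longlonglongrightarrow> ln ((\<beta> \<bullet> (h *v x)) * (\<alpha> \<bullet> (h1 *v y))) + ln ((\<alpha> \<bullet> (matrix_inv h1 *v y)) * (\<beta> \<bullet> (matrix_inv h *v x)))"
      using q by (intro tendsto_add tendsto_ln L1 L2) auto
    moreover have "ln ((\<beta> \<bullet> (h *v x)) * (\<alpha> \<bullet> (h1 *v y))) + ln ((\<alpha> \<bullet> (matrix_inv h1 *v y)) * (\<beta> \<bullet> (matrix_inv h *v x)))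
        = ln (\<beta> \<bullet> (h *v x)) + ln (\<beta> \<bullet> (matrix_inv h *v x)) + \<kappa>"
      using p p1 by (simp add: ln_mult \<kappa>_def)
    ultimately have lim: "(\<lambda>n. ln (\<mu> ^ n * (\<alpha> \<bullet> (k n *v x))) + ln ((1 / \<rho> ^ n) * (\<beta> \<bullet> (matrix_inv (k n) *v y))))
       \<longlonglongrightarrow> ln (\<beta> \<bullet> (h *v x)) + ln (\<beta> \<bullet> (matrix_inv h *v x)) + \<kappa>" by simp
    have inT: "eventually (\<lambda>n. ln (\<mu> ^ n * (\<alpha> \<bullet> (k n *v x))) + ln ((1 / \<rho> ^ n) * (\<beta> \<bullet> (matrix_inv (k n) *v y)))
        \<in> closure translation_values) sequentially"
      using e
    proof (rule eventually_mono)
      fix n assume "\<mu> ^ n * (\<alpha> \<bullet> (k n *v x)) > 0 \<and> (1 / \<rho> ^ n) * (\<beta> \<bullet> (matrix_inv (k n) *v y)) > 0"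
      then have pp: "\<alpha> \<bullet> (k n *v x) > 0" "\<beta> \<bullet> (matrix_inv (k n) *v y) > 0"
        using \<mu>_pos \<rho>_pos by (simp_all add: zero_less_mult_iff zero_less_divide_iff)
      have "ln (\<mu> ^ n * (\<alpha> \<bullet> (k n *v x))) + ln ((1 / \<rho> ^ n) * (\<beta> \<bullet> (matrix_inv (k n) *v y)))
         = ln (\<alpha> \<bullet> (k n *v x)) + ln (\<beta> \<bullet> (matrix_inv (k n) *v y)) - real n * period"
        using pp \<mu>_pos \<rho>_pos by (simp add: ln_mult ln_div ln_realpow period_def algebra_simps)
      also have "\<dots> \<in> translation_values" by (intro translation_values_minus_periods translation_values_junction kG pp)
      finally show "ln (\<mu> ^ n * (\<alpha> \<bullet> (k n *v x))) + ln ((1 / \<rho> ^ n) * (\<beta> \<bullet> (matrix_inv (k n) *v y)))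
        \<in> closure translation_values" using closure_subset by blast
    qed
    show ?thesis by (rule Lim_in_closed_set[OF closed_closure inT _ lim]) simp
  qed
  then show ?thesis by blast
qed

section \<open>Cross-ratios and density of the translation values\<close>

text \<open>Finitely many points cannot be dense in the infinite limit set.\<close>

lemma infinite_orbit: "infinite ((\<lambda>h. pr (h *v x)) ` G)"
proof
  let ?O = "(\<lambda>h. pr (h *v x)) ` G"
  assume fin: "finite ?O"
  then obtain q where q: "q \<in> limit_cone" "a \<bullet> q = 1" "q \<notin> ?O" using ex_limit_cone_avoiding by blast
  have "q \<in> bd" "pr q = q" using q by (auto simp: limit_cone_def pr_id)
  then obtain N where N: "open N" "q \<in> N" "\<And>u. u \<in> N \<Longrightarrow> pr u \<notin> ?O"
    using pr_neq_nhd[OF _ fin, of q] q by auto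
  obtain u c where u: "u \<in> G" "c > 0" "c *\<^sub>R (u *v x) \<in> N" using attracting_orbit_dense[OF q(1) N(1,2)] by blast
  then have "pr (u *v x) \<notin> ?O" using N(3)[OF u(3)] by (simp add: pr_scale)
  then show False using u by blast
qed

text \<open>The form \<open>\<beta>\<close> transported by \<open>h\<close>; it supports the cone at \<open>h x\<close>.\<close>

definition form :: "real^'m^'m \<Rightarrow> real^'m" where
  "form h = \<beta> v* matrix_inv h"

lemma form_inner: "form h \<bullet> v = \<beta> \<bullet> (matrix_inv h *v v)"
  by (simp add: form_def inner_mv_transpose)

lemma form_supporting: "h \<in> G \<Longrightarrow> supporting (form h)"
  unfolding form_def by (intro supporting_transpose G_inv \<beta>_supporting)

lemma form_self: "h \<in> G \<Longrightarrow> form h \<bullet> (h *v x) = 0"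
  by (simp add: form_inner G_cancel \<beta>_x)

lemma form_pos: "h \<in> G \<Longrightarrow> v \<in> bd \<Longrightarrow> pr (h *v x) \<noteq> pr v \<Longrightarrow> form h \<bullet> v > 0"
  using supporting_strict[OF form_supporting G_bd[OF _ x_bd] _ form_self] by blast

text \<open>The values of \<open>ex_shifted_horospherical_values\<close> at \<open>h\<inverse> k\<close>. In this form each summand is linear in the
  conjugate \<open>outer (k *v x) (form k)\<close> of \<open>outer x \<beta>\<close>.\<close>

lemma ex_cross_ratio_shift:
  "\<exists>\<kappa>. \<forall>h\<in>G. \<forall>k\<in>G. form h \<bullet> (k *v x) > 0 \<longrightarrow> form k \<bullet> (h *v x) > 0 \<longrightarrow>
     ln (form h \<bullet> (k *v x)) + ln (form k \<bullet> (h *v x)) + \<kappa> \<in> closure translation_values"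
proof -
  obtain \<kappa> where \<kappa>: "\<And>h. h \<in> G \<Longrightarrow> \<beta> \<bullet> (h *v x) > 0 \<Longrightarrow> \<beta> \<bullet> (matrix_inv h *v x) > 0 \<Longrightarrow>
     ln (\<beta> \<bullet> (h *v x)) + ln (\<beta> \<bullet> (matrix_inv h *v x)) + \<kappa> \<in> closure translation_values"
    using ex_shifted_horospherical_values by blast
  have "ln (form h \<bullet> (k *v x)) + ln (form k \<bullet> (h *v x)) + \<kappa> \<in> closure translation_values"
    if "h \<in> G" "k \<in> G" "form h \<bullet> (k *v x) > 0" "form k \<bullet> (h *v x) > 0" for h k
    using \<kappa>[of "matrix_inv h ** k"] that
    by (simp add: form_inner G_mult G_inv inv_mult inv_inv matrix_vector_mul_assoc)
  then show ?thesis by blast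
qed

text \<open>For \<open>X = outer v \<psi>\<close> this is the trace of \<open>X ** Y\<close>, regarded as a functional of \<open>Y\<close>.\<close>

definition pairing :: "real^'m \<Rightarrow> real^'m \<Rightarrow> real^'m^'m \<Rightarrow> real" where
  "pairing \<psi> v Y = \<psi> \<bullet> (Y *v v)"

lemma linear_pairing: "linear (pairing \<psi> v)"
  by (rule linearI) (simp_all add: pairing_def matrix_vector_mult_add_rdistrib inner_add_right mv_scaleR_left)

lemma pairing_outer: "pairing \<psi> v (outer u \<xi>) = (\<xi> \<bullet> v) * (\<psi> \<bullet> u)"
  by (simp add: pairing_def outer_mv)

text \<open>The unknown constant \<open>\<kappa>\<close> cancels in the logarithm of a cross-ratio.\<close>

lemma cross_ratio_in_closure:
  assumes "\<kappa> + s1 \<in> closure translation_values" "\<kappa> + s2 \<in> closure translation_values" "\<kappa> + s3 \<in> closure translation_values" "\<kappa> + s4 \<in> closure translation_values"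
  shows "s1 - s2 + (s3 - s4) \<in> closure translation_values"
proof -
  have "(\<kappa> + s1) + - (\<kappa> + s2) + ((\<kappa> + s3) + - (\<kappa> + s4)) \<in> closure translation_values"
    by (intro translation_values_closure_add translation_values_closure_uminus assms)
  then show ?thesis by simp
qed

text \<open>The core of the argument: the translation values are not confined to a discrete group. Choose orbit points \<open>[h n x]\<close>,
  pairwise different, that converge to a boundary point \<open>z\<close>, and let \<open>B\<close> be a finite basis of the span of all
  conjugates of \<open>outer x \<beta>\<close> based off \<open>z\<close>. The pairings \<open>Q n\<close> with the normalized conjugates at \<open>h n x\<close>
  converge to a limit that is positive on \<open>B\<close>, so the logarithms of the cross-ratios of \<open>Q n\<close> and \<open>Q m\<close> at members of
  \<open>B\<close> are small. If they all vanish, then \<open>Q n\<close> is a multiple of \<open>Q m\<close> on the span of \<open>B\<close>; this fails at the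
  conjugate based at \<open>h m x\<close>, where \<open>Q m\<close> is zero and \<open>Q n\<close> is positive.\<close>

lemma small_translation_values:
  assumes e: "e > 0"
  shows "\<exists>d\<in>closure translation_values. d \<noteq> 0 \<and> \<bar>d\<bar> < e"
proof (rule ccontr)
  assume none: "\<not> ?thesis"
  obtain f where f: "inj (f :: nat \<Rightarrow> _)" "range f \<subseteq> (\<lambda>h. pr (h *v x)) ` G"
    using infinite_countable_subset[OF infinite_orbit] by blast
  then have "\<forall>n. \<exists>h\<in>G. f n = pr (h *v x)" by blast
  then obtain h0 where h0: "\<And>n. h0 n \<in> G" "\<And>n. f n = pr (h0 n *v x)" by metis
  obtain r1 z where r1: "strict_mono (r1 :: nat \<Rightarrow> nat)"
      "(\<lambda>n. (1 / norm (h0 (r1 n) *v x)) *\<^sub>R (h0 (r1 n) *v x)) \<longlonglongrightarrow> z"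
    using sphere_subseq[of "\<lambda>n. h0 n *v x"] by blast
  obtain r2 \<psi> where r2: "strict_mono (r2 :: nat \<Rightarrow> nat)"
      "(\<lambda>n. (1 / norm (form (h0 (r1 (r2 n))))) *\<^sub>R form (h0 (r1 (r2 n)))) \<longlonglongrightarrow> \<psi>"
    using sphere_subseq[of "\<lambda>n. form (h0 (r1 n))"] by blast
  define h where "h n = h0 (r1 (r2 n))" for n
  define X where "X n = (1 / norm (h n *v x)) *\<^sub>R (h n *v x)" for n
  define \<Psi> where "\<Psi> n = (1 / norm (form (h n))) *\<^sub>R form (h n)" for n
  have hG: "h n \<in> G" for n by (simp add: h_def h0)
  have distinct: "pr (h m *v x) \<noteq> pr (h n *v x)" if "m \<noteq> n" for m n
  proof -
    have "r1 (r2 m) \<noteq> r1 (r2 n)" using r1(1) r2(1) that by (metis strict_mono_eq)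
    then show ?thesis using f(1) h0(2) unfolding h_def by (metis injD)
  qed
  have Xlim: "X \<longlonglongrightarrow> z" using LIMSEQ_subseq_LIMSEQ[OF r1(2) r2(1)] by (simp add: X_def[abs_def] h_def o_def)
  have \<Psi>lim: "\<Psi> \<longlonglongrightarrow> \<psi>" using r2(2) by (simp add: \<Psi>_def[abs_def] h_def)
  have hx: "h n *v x \<in> bd" for n using G_bd[OF hG x_bd] .
  have hx0: "norm (h n *v x) > 0" for n using hx[of n] by (simp add: bd_def)
  have f0: "norm (form (h n)) > 0" for n using form_supporting[OF hG] by (simp add: supporting_def)
  have Xcl: "X n \<in> closure C" for n
    unfolding X_def using hx[of n] hx0 by (intro closure_scale) (auto simp: bd_def)
  have z: "z \<in> closure C" using closure_limI[OF Xcl Xlim] by simp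
  have "norm (X n) = 1" "norm (\<Psi> n) = 1" for n using hx0[of n] f0[of n] by (auto simp: X_def \<Psi>_def)
  then have "norm z = 1" "norm \<psi> = 1"
    using tendsto_norm[OF Xlim] tendsto_norm[OF \<Psi>lim] by (simp_all add: LIMSEQ_const_iff)
  then have z0: "z \<noteq> 0" and \<psi>0: "\<psi> \<noteq> 0" by auto
  have \<psi>: "supporting \<psi>"
    unfolding supporting_def
  proof (intro conjI ballI \<psi>0)
    fix c assume c: "c \<in> C"
    have "(\<lambda>n. \<Psi> n \<bullet> c) \<longlonglongrightarrow> \<psi> \<bullet> c" by (intro tendsto_intros \<Psi>lim)
    moreover have "\<Psi> n \<bullet> c \<ge> 0" for n
      using form_supporting[OF hG] c f0 by (simp add: \<Psi>_def supporting_def)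
    ultimately show "\<psi> \<bullet> c \<ge> 0" by (intro LIMSEQ_le_const) auto
  qed
  have "(\<lambda>n. \<Psi> n \<bullet> X n) \<longlonglongrightarrow> \<psi> \<bullet> z" by (intro tendsto_intros \<Psi>lim Xlim)
  moreover have "\<Psi> n \<bullet> X n = 0" for n using form_self[OF hG] by (simp add: \<Psi>_def X_def)
  ultimately have \<psi>z: "\<psi> \<bullet> z = 0" by (simp add: LIMSEQ_const_iff)
  have zbd: "z \<in> bd" using supporting_zero_bd[OF \<psi> z z0 \<psi>z] .
  define V where "V = (\<lambda>k. outer (k *v x) (form k)) ` {k \<in> G. pr (k *v x) \<noteq> pr z}"
  obtain B where B: "B \<subseteq> V" "independent B" "V \<subseteq> span B"
    using maximal_independent_subset[of V] by blast
  have finB: "finite B" using B(2) by (rule finiteI_independent)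
  define Q where "Q n = pairing (\<Psi> n) (X n)" for n
  have Qlim: "(\<lambda>n. Q n Y) \<longlonglongrightarrow> pairing \<psi> z Y" for Y
    unfolding Q_def pairing_def by (intro tendsto_intros tendsto_mv \<Psi>lim Xlim)
  have Qpos: "pairing \<psi> z Y > 0" if "Y \<in> B" for Y
  proof -
    obtain k where k: "k \<in> G" "pr (k *v x) \<noteq> pr z" "Y = outer (k *v x) (form k)"
      using subsetD[OF B(1) \<open>Y \<in> B\<close>] by (auto simp: V_def)
    have "form k \<bullet> z > 0" using form_pos[OF k(1) zbd k(2)] .
    moreover have "\<psi> \<bullet> (k *v x) > 0"
      using supporting_strict[OF \<psi> zbd G_bd[OF k(1) x_bd] \<psi>z] k(2) by auto
    ultimately show ?thesis by (simp add: k(3) pairing_outer)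
  qed
  have ev: "eventually (\<lambda>n. \<forall>Y\<in>B. Q n Y > 0 \<and> \<bar>ln (Q n Y) - ln (pairing \<psi> z Y)\<bar> < e / 4) sequentially"
  proof (rule eventually_ball_finite[OF finB], rule ballI)
    fix Y assume Y: "Y \<in> B"
    have "(\<lambda>n. ln (Q n Y)) \<longlonglongrightarrow> ln (pairing \<psi> z Y)"
      using Qpos[OF Y] by (intro tendsto_ln Qlim) simp
    from tendstoD[OF this, of "e / 4"] have "eventually (\<lambda>n. dist (ln (Q n Y)) (ln (pairing \<psi> z Y)) < e / 4) sequentially"
      using e by simp
    then show "eventually (\<lambda>n. Q n Y > 0 \<and> \<bar>ln (Q n Y) - ln (pairing \<psi> z Y)\<bar> < e / 4) sequentially"
      using order_tendstoD(1)[OF Qlim Qpos[OF Y]] by eventually_elim (simp add: dist_real_def)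
  qed
  then obtain M where M: "\<And>n Y. n \<ge> M \<Longrightarrow> Y \<in> B \<Longrightarrow> Q n Y > 0 \<and> \<bar>ln (Q n Y) - ln (pairing \<psi> z Y)\<bar> < e / 4"
    unfolding eventually_sequentially by blast
  \<comment> \<open>At most one of the points is \<open>z\<close> itself.\<close>
  obtain m where m: "m \<ge> M" "pr (h m *v x) \<noteq> pr z"
    using distinct[of M "Suc M"] by (metis le_refl le_Suc_eq n_not_Suc_n)
  define n where "n = Suc m"
  have n: "n \<ge> M" "n \<noteq> m" using m by (auto simp: n_def)
  obtain \<kappa> where \<kappa>: "\<And>h k. h \<in> G \<Longrightarrow> k \<in> G \<Longrightarrow> form h \<bullet> (k *v x) > 0 \<Longrightarrow> form k \<bullet> (h *v x) > 0 \<Longrightarrow>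
     ln (form h \<bullet> (k *v x)) + ln (form k \<bullet> (h *v x)) + \<kappa> \<in> closure translation_values"
    using ex_cross_ratio_shift by blast
  \<comment> \<open>The normalization of the functional \<open>Q i\<close> contributes a constant \<open>c\<close> that depends on \<open>i\<close> only.\<close>
  have val: "\<exists>c. \<forall>Y\<in>B. Q i Y > 0 \<longrightarrow> (\<exists>s. \<kappa> + s \<in> closure translation_values \<and> ln (Q i Y) = s + c)" for i
  proof (rule exI[of _ "ln (1 / norm (h i *v x)) + ln (1 / norm (form (h i)))"], intro ballI impI)
    fix Y assume Y: "Y \<in> B" and pos: "Q i Y > 0"
    obtain k where k: "k \<in> G" "Y = outer (k *v x) (form k)"
      using subsetD[OF B(1) Y] by (auto simp: V_def)
    define u where "u = form k \<bullet> (h i *v x)"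
    define w where "w = form (h i) \<bullet> (k *v x)"
    define c1 where "c1 = 1 / norm (h i *v x)"
    define c2 where "c2 = 1 / norm (form (h i))"
    have c: "c1 > 0" "c2 > 0" using hx0[of i] f0[of i] by (auto simp: c1_def c2_def)
    have Q: "Q i Y = (c1 * u) * (c2 * w)"
      by (simp add: Q_def k(2) pairing_outer u_def w_def c1_def c2_def X_def \<Psi>_def)
    have uw: "u \<ge> 0" "w \<ge> 0"
      unfolding u_def w_def
      using supporting_closure form_supporting hG k hx G_bd x_bd by (auto simp: bd_def)
    have "u \<noteq> 0" "w \<noteq> 0" using pos unfolding Q by auto
    then have pos': "u > 0" "w > 0" using uw by auto
    have "ln (Q i Y) = (ln w + ln u) + (ln c1 + ln c2)"
      using pos' c by (simp add: Q ln_mult mult_pos_pos)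
    moreover have "\<kappa> + (ln w + ln u) \<in> closure translation_values"
      using \<kappa>[OF hG k(1)] pos' by (simp add: u_def w_def add.commute)
    ultimately show "\<exists>s. \<kappa> + s \<in> closure translation_values \<and> ln (Q i Y) = s + (ln (1 / norm (h i *v x)) + ln (1 / norm (form (h i))))"
      by (auto simp: c1_def c2_def)
  qed
  have eq: "Q n Y * Q m Y' = Q n Y' * Q m Y" if Y: "Y \<in> B" "Y' \<in> B" for Y Y'
  proof -
    note MM = M[OF n(1) Y(1)] M[OF n(1) Y(2)] M[OF m(1) Y(1)] M[OF m(1) Y(2)]
    obtain c where c: "\<And>Y. Y \<in> B \<Longrightarrow> Q n Y > 0 \<Longrightarrow> \<exists>s. \<kappa> + s \<in> closure translation_values \<and> ln (Q n Y) = s + c"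
      using val[of n] by blast
    obtain c' where c': "\<And>Y. Y \<in> B \<Longrightarrow> Q m Y > 0 \<Longrightarrow> \<exists>s. \<kappa> + s \<in> closure translation_values \<and> ln (Q m Y) = s + c'"
      using val[of m] by blast
    obtain s1 s2 s3 s4 where s: "\<kappa> + s1 \<in> closure translation_values" "ln (Q n Y) = s1 + c"
      "\<kappa> + s2 \<in> closure translation_values" "ln (Q n Y') = s2 + c"
      "\<kappa> + s3 \<in> closure translation_values" "ln (Q m Y') = s3 + c'"
      "\<kappa> + s4 \<in> closure translation_values" "ln (Q m Y) = s4 + c'"
      using c[OF Y(1)] c[OF Y(2)] c'[OF Y(1)] c'[OF Y(2)] MM by blast
    define d where "d = s1 - s2 + (s3 - s4)"
    have d: "d = ln (Q n Y) - ln (Q n Y') + (ln (Q m Y') - ln (Q m Y))" by (simp add: d_def s)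
    have "d \<in> closure translation_values" unfolding d_def using s by (intro cross_ratio_in_closure)
    moreover have "\<bar>d\<bar> < e" using MM unfolding d by linarith
    ultimately have "d = 0" using none by blast
    then have "ln (Q n Y * Q m Y') = ln (Q n Y' * Q m Y)" using MM d by (simp add: ln_mult)
    then show ?thesis using MM by simp
  qed
  have "\<exists>c. \<forall>Y\<in>B. Q n Y = c * Q m Y"
  proof (cases "B = {}")
    case False
    then obtain Y0 where Y0: "Y0 \<in> B" by blast
    have "Q n Y = (Q n Y0 / Q m Y0) * Q m Y" if "Y \<in> B" for Y
      using eq[OF Y0 that] M[OF m(1) Y0] by (simp add: field_simps)
    then show ?thesis by blast
  qed simp
  then obtain c where c: "\<And>Y. Y \<in> B \<Longrightarrow> Q n Y = c * Q m Y" by blast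
  define Y where "Y = outer (h m *v x) (form (h m))"
  have "Y \<in> span B" using B(3) hG m(2) by (auto simp: V_def Y_def)
  moreover have "linear (Q n)" "linear (\<lambda>Y. c * Q m Y)"
    unfolding Q_def using linear_compose_scale_right[OF linear_pairing, of c "\<Psi> m" "X m"]
    by (simp_all add: linear_pairing)
  ultimately have "Q n Y = c * Q m Y" using linear_eq_on[of "Q n" "\<lambda>Y. c * Q m Y" Y B] c by blast
  moreover have "Q m Y = 0" by (simp add: Q_def Y_def pairing_outer X_def form_self[OF hG])
  moreover have "Q n Y > 0"
  proof -
    have "form (h m) \<bullet> (h n *v x) > 0" "form (h n) \<bullet> (h m *v x) > 0"
      using form_pos[OF hG hx] distinct n(2) by metis+
    then show ?thesis using hx0[of n] f0[of n] by (simp add: Q_def Y_def pairing_outer X_def \<Psi>_def)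
  qed
  ultimately show False by simp
qed

lemma translation_values_dense: "closure translation_values = UNIV"
  by (rule semigroup_with_period_dense[OF translation_values_add_closed period_pos translation_values_period translation_values_minus_period small_translation_values])

section \<open>Realizing all large times\<close>

text \<open>Surround the word \<open>w n\<close> of a translation value by \<open>u\<close> and the inverse of \<open>v\<close>. The rescaled vectors
  \<open>g n *v q'\<close> and \<open>matrix_inv (g n) *v p\<close> converge to multiples of \<open>u *v x\<close> and \<open>v *v y\<close>, and the logarithm of the
  product of the two scaling factors tends to the period times \<open>n\<close> plus \<open>s\<close> minus a constant \<open>K\<close>. A deviation of
  less than \<open>\<delta>\<close> from the prescribed value \<open>t\<close> is absorbed in the first factor. It matters that \<open>K\<close> and \<open>\<delta>\<close> do not
  depend on \<open>s\<close>.\<close>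

lemma times_near_translation_values_realized:
  assumes u: "u \<in> G" "c > 0" "c *\<^sub>R (u *v x) \<in> N" and v: "v \<in> G" "c' > 0" "c' *\<^sub>R (v *v y) \<in> N'"
    and N: "open N" "open N'" and q': "q' \<in> bd" "pr q' \<noteq> pr (v *v y)" and p: "p \<in> bd" "pr p \<noteq> pr (u *v x)"
  shows "\<exists>K. \<exists>\<delta>>0. \<forall>s\<in>translation_values. \<exists>n0. \<forall>n\<ge>n0. \<forall>t. \<bar>real n * period + s - K - t\<bar> < \<delta> \<longrightarrow>
    (\<exists>g\<in>G. \<exists>\<sigma>>0. \<exists>\<tau>>0. \<sigma> * \<tau> = exp t \<and> (1 / \<sigma>) *\<^sub>R (g *v q') \<in> N \<and> (1 / \<tau>) *\<^sub>R (matrix_inv g *v p) \<in> N')"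
proof -
  define b where "b = \<alpha> \<bullet> (matrix_inv v *v q')"
  define b' where "b' = \<beta> \<bullet> (matrix_inv u *v p)"
  have "pr (matrix_inv v *v q') \<noteq> y"
    using pr_mult_eq_iff[OF v(1) G_bd[OF G_inv[OF v(1)] q'(1)] y_bd] q'(2) G_cancel[OF v(1)] pr_y by auto
  then have b: "b > 0" unfolding b_def using \<alpha>_pos G_bd[OF G_inv[OF v(1)] q'(1)] by blast
  have "pr (matrix_inv u *v p) \<noteq> x"
    using pr_mult_eq_iff[OF u(1) G_bd[OF G_inv[OF u(1)] p(1)] x_bd] p(2) G_cancel[OF u(1)] pr_x by auto
  then have b': "b' > 0" unfolding b'_def using \<beta>_pos G_bd[OF G_inv[OF u(1)] p(1)] by blast
  \<comment> \<open>The rescaled images converge to \<open>b (u x)\<close> and \<open>b' (v y)\<close>, but \<open>c (u x)\<close> and \<open>c' (v y)\<close> are wanted.\<close>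
  define K where "K = ln (c / b) + ln (c' / b')"
  have "((\<lambda>z. exp (fst z) *\<^sub>R snd z) \<longlongrightarrow> exp (fst (0::real, c *\<^sub>R (u *v x))) *\<^sub>R snd (0::real, c *\<^sub>R (u *v x)))
      (nhds (0::real, c *\<^sub>R (u *v x)))"
    by (intro tendsto_scaleR tendsto_exp tendsto_fst tendsto_snd filterlim_ident)
  then have "eventually (\<lambda>z. exp (fst z) *\<^sub>R snd z \<in> N) (nhds (0::real, c *\<^sub>R (u *v x)))"
    using N(1) u(3) by (intro topological_tendstoD) auto
  then obtain P Q where PQ: "eventually P (nhds (0::real))" "eventually Q (nhds (c *\<^sub>R (u *v x)))"
    "\<And>r w. P r \<Longrightarrow> Q w \<Longrightarrow> exp r *\<^sub>R w \<in> N"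
    unfolding nhds_prod eventually_prod_filter by auto
  obtain \<delta> where \<delta>: "\<delta> > 0" "\<And>r. \<bar>r\<bar> < \<delta> \<Longrightarrow> P r"
    using PQ(1) unfolding eventually_nhds_metric by (auto simp: dist_real_def)
  have "\<exists>n0. \<forall>n\<ge>n0. \<forall>t. \<bar>real n * period + s - K - t\<bar> < \<delta> / 2 \<longrightarrow>
    (\<exists>g\<in>G. \<exists>\<sigma>>0. \<exists>\<tau>>0. \<sigma> * \<tau> = exp t \<and> (1 / \<sigma>) *\<^sub>R (g *v q') \<in> N \<and> (1 / \<tau>) *\<^sub>R (matrix_inv g *v p) \<in> N')"
    if s: "s \<in> translation_values" for s
  proof -
    obtain w A B where w: "scaled_lim w A x \<alpha>" "scaled_lim (\<lambda>n. matrix_inv (w n)) B y \<beta>"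
      and lim: "(\<lambda>n. ln (A n) + ln (B n) - real n * period) \<longlonglongrightarrow> s" using s unfolding translation_values_def by blast
    have wG: "w n \<in> G" and A: "A n > 0" and B: "B n > 0" for n using w by (auto simp: scaled_lim_def)
    define g where "g n = u ** (w n ** matrix_inv v)" for n
    have gG: "g n \<in> G" for n unfolding g_def by (intro G_mult G_inv u v wG)
    have gi: "matrix_inv (g n) = v ** matrix_inv (w n) ** matrix_inv u" for n
      by (simp add: g_def inv_mult G_mult G_inv u v wG inv_inv)
    have "(\<lambda>n. (c / b) *\<^sub>R (u *v ((1 / A n) *\<^sub>R (w n *v (matrix_inv v *v q')))))
        \<longlonglongrightarrow> (c / b) *\<^sub>R (u *v (b *\<^sub>R x))"
      unfolding b_def by (intro tendsto_scaleR tendsto_const tendsto_mv scaled_lim_apply[OF w(1)])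
    then have "(\<lambda>n. (c / b / A n) *\<^sub>R (g n *v q')) \<longlonglongrightarrow> c *\<^sub>R (u *v x)"
      using b by (simp add: g_def matrix_vector_mult_scaleR matrix_vector_mul_assoc matrix_mul_assoc)
    then have e1: "eventually (\<lambda>n. Q ((c / b / A n) *\<^sub>R (g n *v q'))) sequentially"
      using PQ(2) by (simp add: filterlim_iff)
    have "(\<lambda>n. (c' / b') *\<^sub>R (v *v ((1 / B n) *\<^sub>R (matrix_inv (w n) *v (matrix_inv u *v p)))))
        \<longlonglongrightarrow> (c' / b') *\<^sub>R (v *v (b' *\<^sub>R y))"
      unfolding b'_def by (intro tendsto_scaleR tendsto_const tendsto_mv scaled_lim_apply[OF w(2)])
    then have "(\<lambda>n. (c' / b' / B n) *\<^sub>R (matrix_inv (g n) *v p)) \<longlonglongrightarrow> c' *\<^sub>R (v *v y)"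
      using b' by (simp add: gi matrix_vector_mult_scaleR matrix_vector_mul_assoc matrix_mul_assoc)
    then have e2: "eventually (\<lambda>n. (c' / b' / B n) *\<^sub>R (matrix_inv (g n) *v p) \<in> N') sequentially"
      using N(2) v(3) topological_tendstoD by blast
    have e3: "eventually (\<lambda>n. dist (ln (A n) + ln (B n) - real n * period) s < \<delta> / 2) sequentially"
      using lim \<delta> by (intro tendstoD) auto
    obtain n0 where n0: "\<And>n. n \<ge> n0 \<Longrightarrow> Q ((c / b / A n) *\<^sub>R (g n *v q')) \<and>
        (c' / b' / B n) *\<^sub>R (matrix_inv (g n) *v p) \<in> N' \<and> \<bar>ln (A n) + ln (B n) - real n * period - s\<bar> < \<delta> / 2"
      using eventually_conj[OF e1 eventually_conj[OF e2 e3]]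
      unfolding eventually_sequentially dist_real_def by blast
    have "\<exists>g\<in>G. \<exists>\<sigma>>0. \<exists>\<tau>>0. \<sigma> * \<tau> = exp t \<and> (1 / \<sigma>) *\<^sub>R (g *v q') \<in> N \<and> (1 / \<tau>) *\<^sub>R (matrix_inv g *v p) \<in> N'"
      if n: "n \<ge> n0" and t: "\<bar>real n * period + s - K - t\<bar> < \<delta> / 2" for n t
    proof -
      \<comment> \<open>The defect \<open>r\<close> of the logarithm is shifted into \<open>\<sigma>\<close>, which moves the first image within \<open>N\<close>.\<close>
      define r where "r = ln (A n) + ln (B n) - K - t"
      have "r = (ln (A n) + ln (B n) - real n * period - s) + (real n * period + s - K - t)" by (simp add: r_def)
      then have "\<bar>r\<bar> < \<delta>" using n0[OF n] t by linarith
      then have inN: "exp r *\<^sub>R ((c / b / A n) *\<^sub>R (g n *v q')) \<in> N" using \<delta>(2) PQ(3) n0[OF n] by blast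
      define \<sigma> where "\<sigma> = A n / (exp r * (c / b))"
      define \<tau> where "\<tau> = B n / (c' / b')"
      have pos: "\<sigma> > 0" "\<tau> > 0" using A[of n] B[of n] b b' u v by (auto simp: \<sigma>_def \<tau>_def)
      have "\<sigma> * \<tau> = exp (ln (\<sigma> * \<tau>))" using pos by simp
      also have "ln (\<sigma> * \<tau>) = t"
        using pos A[of n] B[of n] b b' u(2) v(2)
        by (simp add: ln_mult ln_div \<sigma>_def \<tau>_def r_def K_def divide_pos_pos mult_pos_pos)
      finally have "\<sigma> * \<tau> = exp t" .
      moreover have "(1 / \<sigma>) *\<^sub>R (g n *v q') \<in> N" using inN by (simp add: \<sigma>_def mult.commute)
      moreover have "(1 / \<tau>) *\<^sub>R (matrix_inv (g n) *v p) \<in> N'" using n0[OF n] by (simp add: \<tau>_def mult.commute)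
      ultimately show ?thesis using gG pos by blast
    qed
    then show ?thesis by blast
  qed
  moreover have "\<delta> / 2 > 0" using \<delta> by simp
  ultimately show ?thesis by blast
qed

end

context nonelementary_cone_group
begin

text \<open>Finitely many translation values come within \<open>\<delta>\<close> of every point of one period, and each of them, shifted by
  large multiples of the period and by \<open>K\<close>, realizes all times within \<open>\<delta>\<close>.\<close>

theorem all_large_times_realized:
  assumes p: "p \<in> bd" and q: "q \<in> limit_cone" and pq: "pr p \<noteq> pr q"
    and p': "p' \<in> limit_cone" and q': "q' \<in> bd" and pq': "pr p' \<noteq> pr q'"
    and N: "open N" "q \<in> N" "open N'" "p' \<in> N'"
  shows "\<exists>T. \<forall>t\<ge>T. \<exists>g\<in>G. \<exists>\<sigma>>0. \<exists>\<tau>>0. \<sigma> * \<tau> = exp t \<and>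
    (1 / \<sigma>) *\<^sub>R (g *v q') \<in> N \<and> (1 / \<tau>) *\<^sub>R (matrix_inv g *v p) \<in> N'"
proof -
  obtain \<gamma> x y \<alpha> \<beta> \<rho> \<mu> where lox: "loxodromic C a G \<gamma> x y \<alpha> \<beta> \<rho> \<mu>" using ex_loxodromic by blast
  interpret L: loxodromic C a G \<gamma> x y \<alpha> \<beta> \<rho> \<mu> by (rule lox)
  have "q \<in> bd" "p' \<in> bd" using q p' by (auto simp: limit_cone_def)
  obtain N1 where N1: "open N1" "q \<in> N1" "\<And>w. w \<in> N1 \<Longrightarrow> pr w \<noteq> pr p"
    using pr_neq_nhd[OF \<open>q \<in> bd\<close>, of "{pr p}"] pq by auto
  obtain N2 where N2: "open N2" "p' \<in> N2" "\<And>w. w \<in> N2 \<Longrightarrow> pr w \<noteq> pr q'"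
    using pr_neq_nhd[OF \<open>p' \<in> bd\<close>, of "{pr q'}"] pq' by auto
  obtain u c where u: "u \<in> G" "c > 0" "c *\<^sub>R (u *v x) \<in> N \<inter> N1"
    using L.attracting_orbit_dense[OF q, of "N \<inter> N1"] N N1 by auto
  obtain v c' where v: "v \<in> G" "c' > 0" "c' *\<^sub>R (v *v y) \<in> N' \<inter> N2"
    using L.repelling_orbit_dense[OF p', of "N' \<inter> N2"] N N2 by auto
  have d: "pr q' \<noteq> pr (v *v y)" "pr p \<noteq> pr (u *v x)"
    using N1(3)[of "c *\<^sub>R (u *v x)"] N2(3)[of "c' *\<^sub>R (v *v y)"] u v by (auto simp: pr_scale)
  let ?good = "\<lambda>t. \<exists>g\<in>G. \<exists>\<sigma>>0. \<exists>\<tau>>0. \<sigma> * \<tau> = exp t \<and>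
    (1 / \<sigma>) *\<^sub>R (g *v q') \<in> N \<and> (1 / \<tau>) *\<^sub>R (matrix_inv g *v p) \<in> N'"
  obtain K \<delta> where \<delta>: "\<delta> > 0" and K: "\<And>s. s \<in> L.translation_values \<Longrightarrow> \<exists>n0. \<forall>n\<ge>n0. \<forall>t.
      \<bar>real n * L.period + s - K - t\<bar> < \<delta> \<longrightarrow> ?good t"
    using L.times_near_translation_values_realized[OF u(1,2) _ v(1,2) _ N(1,3) q' d(1) p d(2)] u(3) v(3) by blast
  have "\<exists>s\<in>L.translation_values. dist s r < \<delta> / 2" for r
  proof -
    have "r \<in> closure L.translation_values" using L.translation_values_dense by simp
    then show ?thesis unfolding closure_approachable using half_gt_zero[OF \<delta>] by blast
  qed
  then have "\<forall>i::nat. \<exists>s. s \<in> L.translation_values \<and> dist s (real i * (\<delta> / 2)) < \<delta> / 2" by blast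
  then obtain s where s: "\<And>i. s i \<in> L.translation_values" "\<And>i. dist (s i) (real i * (\<delta> / 2)) < \<delta> / 2"
    by metis
  obtain n0 where n0: "\<And>i n t. n \<ge> n0 i \<Longrightarrow> \<bar>real n * L.period + s i - K - t\<bar> < \<delta> \<Longrightarrow> ?good t"
    using K[OF s(1)] by metis
  define J where "J = nat \<lceil>L.period / (\<delta> / 2)\<rceil>"
  define M where "M = Max (n0 ` {..J})"
  have M: "n0 i \<le> M" if "i \<le> J" for i unfolding M_def using that by (intro Max_ge) auto
  have "?good t" if t: "t \<ge> (real M + 1) * L.period - K" for t
  proof -
    define n where "n = nat \<lfloor>(t + K) / L.period\<rfloor>"
    define r where "r = t + K - real n * L.period"
    \<comment> \<open>Both \<open>r\<close> and \<open>s i\<close> differ from the grid point \<open>i \<delta> / 2\<close> by less than \<open>\<delta> / 2\<close>.\<close>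
    define i where "i = nat \<lfloor>r / (\<delta> / 2)\<rfloor>"
    have "(t + K) / L.period \<ge> real M + 1" using t L.period_pos by (simp add: field_simps)
    then have nM: "n \<ge> M" and n0': "\<lfloor>(t + K) / L.period\<rfloor> \<ge> 0"
      unfolding n_def by linarith+
    have rn: "real n = of_int \<lfloor>(t + K) / L.period\<rfloor>" using n0' by (simp add: n_def)
    have "real n * L.period \<le> t + K" unfolding rn using L.period_pos by (rule floor_divide_lower)
    moreover have "t + K < (real n + 1) * L.period" unfolding rn using L.period_pos by (rule floor_divide_upper)
    ultimately have r: "0 \<le> r" "r < L.period" by (auto simp: r_def distrib_right)
    have "0 \<le> r / (\<delta> / 2)" using r \<delta> by simp
    then have ri: "real i = of_int \<lfloor>r / (\<delta> / 2)\<rfloor>" by (simp add: i_def)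
    have i1: "real i * (\<delta> / 2) \<le> r" unfolding ri using \<delta> by (intro floor_divide_lower) simp
    have i2: "r < (real i + 1) * (\<delta> / 2)" unfolding ri using \<delta> by (intro floor_divide_upper) simp
    have "r / (\<delta> / 2) \<le> L.period / (\<delta> / 2)" using r \<delta> by (intro divide_right_mono) auto
    then have "i \<le> J" unfolding i_def J_def by linarith
    have "(real i + 1) * (\<delta> / 2) = real i * (\<delta> / 2) + \<delta> / 2" by (simp add: distrib_right)
    then have "\<bar>s i - r\<bar> < \<delta>" using s(2)[of i] i1 i2 unfolding dist_real_def by linarith
    then have "\<bar>real n * L.period + s i - K - t\<bar> < \<delta>" by (simp add: r_def)
    then show ?thesis using n0 M[OF \<open>i \<le> J\<close>] nM order_trans by blast
  qed
  then show ?thesis by blast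
qed

end

section \<open>Projective space and discrete groups of matrices\<close>

lemma mem_pt: "v \<in> pt v"
  by (auto simp: pt_def intro: exI[of _ 1])

lemma pt_scaleR:
  assumes "c \<noteq> 0" shows "pt (c *\<^sub>R v) = pt v"
proof
  show "pt (c *\<^sub>R v) \<subseteq> pt v"
  proof
    fix w assume "w \<in> pt (c *\<^sub>R v)"
    then obtain d where "d \<noteq> 0" "w = (d * c) *\<^sub>R v" by (auto simp: pt_def)
    then show "w \<in> pt v" using assms unfolding pt_def by (intro CollectI exI[of _ "d * c"]) simp
  qed
  show "pt v \<subseteq> pt (c *\<^sub>R v)"
  proof
    fix w assume "w \<in> pt v"
    then obtain d where "d \<noteq> 0" "w = d *\<^sub>R v" by (auto simp: pt_def)
    then show "w \<in> pt (c *\<^sub>R v)" using assms unfolding pt_def by (intro CollectI exI[of _ "d / c"]) simp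
  qed
qed

lemma pt_minus: "pt (- v) = pt v"
  using pt_scaleR[of "-1" v] by simp

lemma pt_eqD: "pt v = pt w \<Longrightarrow> \<exists>c. c \<noteq> 0 \<and> v = c *\<^sub>R w"
  using mem_pt[of v] by (auto simp: pt_def)

lemma topspace_proj: "topspace proj_space = pt ` (- {0})"
  by (simp add: proj_space_def topspace_quotient_topology)

lemma openin_proj: "openin proj_space S \<longleftrightarrow> S \<subseteq> pt ` (- {0}) \<and> open {v. v \<noteq> 0 \<and> pt v \<in> S}"
proof -
  have "open (- {0 :: real^'m})" by (rule open_Compl) (rule closed_singleton)
  moreover have "{v \<in> - {0}. pt v \<in> S} = {v. v \<noteq> 0 \<and> pt v \<in> S}" by auto
  ultimately show ?thesis
    unfolding proj_space_def openin_quotient_topology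
    using openin_open_eq[of "- {0}" "{v. v \<noteq> 0 \<and> pt v \<in> S}"] by auto
qed

text \<open>Closures in projective space are computed upstairs, because the set of nonzero representatives of any
  subset is invariant under scaling and so is the complement of its closure.\<close>

lemma pt_in_closure_of:
  assumes v: "v \<noteq> 0"
  shows "pt v \<in> proj_space closure_of S \<longleftrightarrow> v \<in> closure {w. w \<noteq> 0 \<and> pt w \<in> S}" (is "_ \<longleftrightarrow> v \<in> closure ?S")
proof
  assume L: "pt v \<in> proj_space closure_of S"
  show "v \<in> closure ?S"
  proof (rule ccontr)
    assume n: "v \<notin> closure ?S"
    let ?U = "- closure ?S - {0}"
    have inv: "c *\<^sub>R u \<in> ?U" if u: "u \<in> ?U" and c: "c \<noteq> 0" for u c
    proof -
      have "c *\<^sub>R u \<notin> closure ?S"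
      proof
        assume "c *\<^sub>R u \<in> closure ?S"
        then obtain f where f: "\<And>n. f n \<in> ?S" "f \<longlonglongrightarrow> c *\<^sub>R u" unfolding closure_sequential by blast
        have "(\<lambda>n. (1 / c) *\<^sub>R f n) \<longlonglongrightarrow> (1 / c) *\<^sub>R (c *\<^sub>R u)" by (intro tendsto_intros f)
        moreover have "(1 / c) *\<^sub>R f n \<in> ?S" for n using f(1)[of n] c by (simp add: pt_scaleR)
        ultimately have "(1 / c) *\<^sub>R (c *\<^sub>R u) \<in> closure ?S" by (intro closure_limI)
        then show False using u c by simp
      qed
      then show ?thesis using u c by simp
    qed
    have "{u. u \<noteq> 0 \<and> pt u \<in> pt ` ?U} = ?U"
    proof
      show "{u. u \<noteq> 0 \<and> pt u \<in> pt ` ?U} \<subseteq> ?U"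
      proof
        fix u assume "u \<in> {u. u \<noteq> 0 \<and> pt u \<in> pt ` ?U}"
        then obtain w where w: "w \<in> ?U" "pt u = pt w" by auto
        then obtain c where "c \<noteq> 0" "u = c *\<^sub>R w" using pt_eqD by blast
        then show "u \<in> ?U" using inv[OF w(1)] by simp
      qed
    qed auto
    then have "openin proj_space (pt ` ?U)" unfolding openin_proj by (auto simp: open_Diff)
    moreover have "pt v \<in> pt ` ?U" using n v by (intro imageI) simp
    ultimately have 1: "pt v \<in> pt ` ?U \<and> openin proj_space (pt ` ?U)" by (rule conjI[rotated])
    have "\<forall>T. pt v \<in> T \<and> openin proj_space T \<longrightarrow> (\<exists>z. z \<in> S \<and> z \<in> T)"
      using L[unfolded in_closure_of] by (rule conjunct2)
    from mp[OF spec[OF this] 1] have "\<exists>z. z \<in> S \<and> z \<in> pt ` ?U" .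
    then obtain u where u: "u \<in> ?U" "pt u \<in> S" by auto
    then have "u \<in> ?S" by simp
    then have "u \<in> closure ?S" using closure_subset by (rule rev_subsetD)
    then show False using u by simp
  qed
next
  assume R: "v \<in> closure ?S"
  show "pt v \<in> proj_space closure_of S"
    unfolding in_closure_of
  proof (intro conjI allI impI)
    show "pt v \<in> topspace proj_space" using v by (auto simp: topspace_proj)
    fix T assume T: "pt v \<in> T \<and> openin proj_space T"
    then have "open {w. w \<noteq> 0 \<and> pt w \<in> T}" "v \<in> {w. w \<noteq> 0 \<and> pt w \<in> T}" using v by (auto simp: openin_proj)
    then have "{w. w \<noteq> 0 \<and> pt w \<in> T} \<inter> ?S \<noteq> {}" using R open_Int_closure_eq_empty by blast
    then show "\<exists>y. y \<in> S \<and> y \<in> T" by blast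
  qed
qed

lemma SL_subgroup_inv:
  assumes "subgroup \<Gamma> (SL :: (real^'m^'m) monoid)" "A \<in> \<Gamma>" shows "matrix_inv A \<in> \<Gamma>"
proof -
  interpret group "SL :: (real^'m^'m) monoid" by (rule group_SL)
  have "A \<in> carrier SL" using subgroup.subset[OF assms(1)] assms(2) by blast
  then have "A \<otimes>\<^bsub>SL\<^esub> inv\<^bsub>SL\<^esub> A = \<one>\<^bsub>SL\<^esub>" by (rule r_inv)
  then have "A ** inv\<^bsub>SL\<^esub> A = mat 1" by (simp add: SL_def)
  then have "matrix_inv A = inv\<^bsub>SL\<^esub> A" by (rule matrix_inv_eqI)
  then show ?thesis using subgroup.m_inv_closed[OF assms] by simp
qed

lemma SL_subgroup_mult:
  "subgroup \<Gamma> (SL :: (real^'m^'m) monoid) \<Longrightarrow> A \<in> \<Gamma> \<Longrightarrow> B \<in> \<Gamma> \<Longrightarrow> A ** B \<in> \<Gamma>"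
  using subgroup.m_closed[of \<Gamma> SL A B] by (simp add: SL_def)

lemma SL_subgroup_one: "subgroup \<Gamma> (SL :: (real^'m^'m) monoid) \<Longrightarrow> mat 1 \<in> \<Gamma>"
  using subgroup.one_closed[of \<Gamma> SL] by (simp add: SL_def)

lemma SL_subgroup_det: "subgroup \<Gamma> (SL :: (real^'m^'m) monoid) \<Longrightarrow> A \<in> \<Gamma> \<Longrightarrow> det A = 1"
  using subgroup.subset[of \<Gamma> SL] by (auto simp: SL_def)

lemma SL_subgroup_invertible:
  "subgroup \<Gamma> (SL :: (real^'m^'m) monoid) \<Longrightarrow> A \<in> \<Gamma> \<Longrightarrow> invertible A"
  using SL_subgroup_det[of \<Gamma> A] by (simp add: invertible_det_nz)

text \<open>A bounded infinite part contains a sequence of different elements converging to some \<open>L\<close> with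
  \<open>det L = 1\<close>. The inverses are bounded since \<open>L\<close> is invertible, so the quotients of consecutive terms
  converge to the identity without ever being equal to it.\<close>

lemma discrete_subgroup_finite:
  assumes \<Gamma>: "subgroup \<Gamma> (SL :: (real^'m^'m) monoid)" and disc: "discrete \<Gamma>"
  shows "finite {A \<in> \<Gamma>. norm A \<le> R}"
proof (rule ccontr)
  assume inf: "infinite {A \<in> \<Gamma>. norm A \<le> R}"
  obtain f where f: "inj (f :: nat \<Rightarrow> _)" "range f \<subseteq> {A \<in> \<Gamma>. norm A \<le> R}"
    using infinite_countable_subset[OF inf] by blast
  have "seq_compact (cball (0 :: real^'m^'m) R)" by (simp add: compact_imp_seq_compact)
  moreover have "\<forall>n. f n \<in> cball 0 R" using f(2) by auto
  ultimately obtain L r where r: "strict_mono (r :: nat \<Rightarrow> nat)" "(f \<circ> r) \<longlonglongrightarrow> L"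
    by (blast elim: seq_compactE)
  define h where "h = f \<circ> r"
  have h: "h n \<in> \<Gamma>" for n using f(2) by (auto simp: h_def)
  have hne: "h (Suc n) \<noteq> h n" for n
    using f(1) strict_monoD[OF r(1), of n "Suc n"] by (auto simp: h_def dest: injD)
  have lim: "h \<longlonglongrightarrow> L" using r(2) by (simp add: h_def)
  have "(\<lambda>n. det (h n)) \<longlonglongrightarrow> det L" by (rule tendsto_det[OF lim])
  then have "det L = 1" using SL_subgroup_det[OF \<Gamma> h] by (simp add: LIMSEQ_const_iff)
  then have iL: "invertible L" by (simp add: invertible_det_nz)
  obtain K where K: "K > 0" "\<And>(A :: real^'m^'m) (B :: real^'m^'m). norm (A ** B) \<le> norm A * norm B * K"
    using bounded_matrix_mult[where 'n='m] by auto
  define I where "I = norm (matrix_inv L)"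
  define D where "D = norm (mat 1 :: real^'m^'m)"
  have bound: "norm (matrix_inv (h n)) \<le> 2 * (I * D * K)" if small: "I * K * K * norm (L - h n) \<le> 1 / 2" for n
  proof -
    let ?Z = "matrix_inv (h n)"
    have "L ** ?Z = mat 1 + (L - h n) ** ?Z"
      using matrix_inv_cancel(1)[OF SL_subgroup_invertible[OF \<Gamma> h]]
      by (simp add: mm_diff_left)
    then have "?Z = matrix_inv L ** (mat 1 + (L - h n) ** ?Z)"
      using matrix_inv_cancel(2)[OF iL] by (metis matrix_mul_assoc matrix_mul_lid)
    then have "norm ?Z \<le> I * norm (mat 1 + (L - h n) ** ?Z) * K" using K(2) I_def by metis
    also have "\<dots> \<le> I * (D + norm (L - h n) * norm ?Z * K) * K"
    proof -
      have "norm (mat 1 + (L - h n) ** ?Z) \<le> D + norm (L - h n) * norm ?Z * K"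
        using norm_triangle_ineq[of "mat 1" "(L - h n) ** ?Z"] K(2)[of "L - h n" ?Z] by (simp add: D_def)
      then show ?thesis using K(1) by (intro mult_right_mono mult_left_mono) (auto simp: I_def)
    qed
    also have "\<dots> = I * D * K + (I * K * K * norm (L - h n)) * norm ?Z" by (simp add: algebra_simps)
    also have "\<dots> \<le> I * D * K + 1 / 2 * norm ?Z" by (intro add_left_mono mult_right_mono small) simp
    finally show ?thesis by simp
  qed
  have "(\<lambda>n. I * K * K * norm (L - h n)) \<longlonglongrightarrow> I * K * K * norm (L - L)" by (intro tendsto_intros lim)
  then have e1: "eventually (\<lambda>n. I * K * K * norm (L - h n) < 1 / 2) sequentially"
    using order_tendstoD(2)[where a="1 / 2"] by fastforce
  obtain e where e: "e > 0" "\<And>A. A \<in> \<Gamma> \<Longrightarrow> dist (mat 1) A < e \<Longrightarrow> A = mat 1"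
    using discreteD[OF disc SL_subgroup_one[OF \<Gamma>]] unfolding isolated_in_dist_Ex_iff by blast
  have "(\<lambda>n. 2 * (I * D * K) * norm (h (Suc n) - h n) * K) \<longlonglongrightarrow> 2 * (I * D * K) * norm (L - L) * K"
    by (intro tendsto_intros lim filterlim_compose[OF lim filterlim_Suc])
  then have e2: "eventually (\<lambda>n. 2 * (I * D * K) * norm (h (Suc n) - h n) * K < e) sequentially"
    using order_tendstoD(2)[where a=e] e(1) by fastforce
  obtain n where n: "I * K * K * norm (L - h n) < 1 / 2" "2 * (I * D * K) * norm (h (Suc n) - h n) * K < e"
    using eventually_happens'[OF sequentially_bot eventually_conj[OF e1 e2]] by blast
  let ?Z = "matrix_inv (h n)"
  have Z1: "?Z ** h n = mat 1" by (rule matrix_inv_cancel(2)[OF SL_subgroup_invertible[OF \<Gamma> h]])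
  have Zh: "?Z ** h (Suc n) - mat 1 = ?Z ** (h (Suc n) - h n)" by (simp add: mm_diff_right Z1)
  have "norm (?Z ** (h (Suc n) - h n)) \<le> norm ?Z * norm (h (Suc n) - h n) * K" by (rule K(2))
  also have "\<dots> \<le> 2 * (I * D * K) * norm (h (Suc n) - h n) * K"
    using bound[of n] n(1) K(1) by (intro mult_right_mono) auto
  finally have "dist (?Z ** h (Suc n)) (mat 1) < e" using n(2) Zh by (simp add: dist_norm)
  then have "dist (mat 1) (?Z ** h (Suc n)) < e" by (simp add: dist_commute)
  then have "?Z ** h (Suc n) = mat 1"
    using e(2) SL_subgroup_mult[OF \<Gamma> SL_subgroup_inv[OF \<Gamma> h] h] by blast
  then have "h n ** (?Z ** h (Suc n)) = h n" by simp
  then have "h (Suc n) = h n"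
    by (simp add: matrix_mul_assoc matrix_inv_cancel(1)[OF SL_subgroup_invertible[OF \<Gamma> h]])
  then show False using hne by blast
qed

text \<open>Vectors with values of opposite sign would have a convex combination with value \<open>0\<close>.\<close>

lemma functional_sign_on_convex:
  fixes D :: "(real^'m) set" and \<phi> :: "real^'m \<Rightarrow> real"
  assumes cD: "convex D" and lin: "linear \<phi>" and nz: "\<And>v. v \<in> D \<Longrightarrow> \<phi> v \<noteq> 0"
  shows "(\<forall>v\<in>D. \<phi> v > 0) \<or> (\<forall>v\<in>D. \<phi> v < 0)"
proof (rule ccontr)
  assume "\<not> ?thesis"
  then obtain v w where v: "v \<in> D" "\<phi> v < 0" and w: "w \<in> D" "\<phi> w > 0" using nz by (metis linorder_neqE_linordered_idom)
  define s where "s = \<phi> w - \<phi> v"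
  have s: "s > 0" using v w by (simp add: s_def)
  have "(\<phi> w / s) *\<^sub>R v + (- \<phi> v / s) *\<^sub>R w \<in> D"
    using s v w by (intro convexD[OF cD]) (auto simp: s_def diff_divide_distrib[symmetric] divide_simps)
  moreover have "\<phi> ((\<phi> w / s) *\<^sub>R v + (- \<phi> v / s) *\<^sub>R w) = 0"
    by (simp add: linear_add[OF lin] linear_scale[OF lin] linear_neg[OF lin] linear_diff[OF lin])
  ultimately show False using nz by blast
qed

section \<open>The cone over a properly convex set\<close>

locale convex_quotient =
  fixes \<Omega> :: "(real^'m) set set" and \<Gamma> :: "(real^'m^'m) set" and x\<^sub>0 :: "(real^'m) set" and a :: "real^'m"
  assumes open_\<Omega>: "openin proj_space \<Omega>"
    and properly_\<Omega>: "properly_convex \<Omega>"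
    and strictly_\<Omega>: "proj_strictly_convex \<Omega>"
    and subgroup_\<Gamma>: "subgroup \<Gamma> SL" and \<Gamma>_Aut: "\<Gamma> \<subseteq> proj_Aut \<Omega>"
    and discrete_\<Gamma>: "discrete \<Gamma>"
    and x0_\<Omega>: "x\<^sub>0 \<in> \<Omega>"
    and nonelem: "non_elementary \<Gamma> x\<^sub>0"
    and chart_a: "chart_contains_closure a \<Omega>"
begin

definition C :: "(real^'m) set" where "C = {v. a \<bullet> v > 0 \<and> pt v \<in> \<Omega>}"

text \<open>An automorphism of \<open>\<Omega>\<close> maps the cone to itself or to its negative; the sign is corrected here.\<close>

definition G :: "(real^'m^'m) set" where
  "G = {B. (B \<in> \<Gamma> \<or> - B \<in> \<Gamma>) \<and> (\<forall>v\<in>C. B *v v \<in> C)}"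

lemma \<Omega>_topspace: "\<Omega> \<subseteq> pt ` (- {0})"
  using open_\<Omega> by (simp add: openin_proj)

lemma \<Omega>_closure: "\<Omega> \<subseteq> proj_space closure_of \<Omega>"
  using \<Omega>_topspace by (intro closure_of_subset) (simp add: topspace_proj)

lemma chart_nonzero: "chart_contains_closure b \<Omega> \<Longrightarrow> pt v \<in> proj_space closure_of \<Omega> \<Longrightarrow> b \<bullet> v \<noteq> 0"
proof -
  assume "chart_contains_closure b \<Omega>" "pt v \<in> proj_space closure_of \<Omega>"
  then obtain w where "pt v = pt w" "b \<bullet> w \<noteq> 0"
    by (auto simp: chart_contains_closure_def affine_chart_def)
  then show ?thesis using pt_eqD[of v w] by auto
qed

lemma \<Omega>_rep: "p \<in> \<Omega> \<Longrightarrow> \<exists>v\<in>C. p = pt v"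
proof -
  assume p: "p \<in> \<Omega>"
  then obtain v where v: "p = pt v" "v \<noteq> 0" using \<Omega>_topspace by auto
  then have "a \<bullet> v \<noteq> 0" using chart_nonzero[OF chart_a] p \<Omega>_closure by auto
  then have "v \<in> C \<or> - v \<in> C" using p v by (auto simp: C_def pt_minus)
  then show ?thesis using v pt_minus by metis
qed

lemma C_open: "open C"
proof -
  have "C = {v. a \<bullet> v > 0} \<inter> {v. v \<noteq> 0 \<and> pt v \<in> \<Omega>}" by (auto simp: C_def)
  then show ?thesis using open_\<Omega> by (simp add: openin_proj open_Int open_halfspace_gt)
qed

lemma C_scaleR: "v \<in> C \<Longrightarrow> c > 0 \<Longrightarrow> c *\<^sub>R v \<in> C"
  by (simp add: C_def pt_scaleR)

lemma chart_cone_convex: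
  assumes b: "chart_contains_closure b \<Omega>" and cv: "convex (in_chart b \<Omega>)"
  shows "convex {v. b \<bullet> v > 0 \<and> pt v \<in> \<Omega>}"
proof (rule convexI)
  fix v w and s t :: real
  assume v: "v \<in> {v. b \<bullet> v > 0 \<and> pt v \<in> \<Omega>}" and w: "w \<in> {v. b \<bullet> v > 0 \<and> pt v \<in> \<Omega>}"
    and st: "s \<ge> 0" "t \<ge> 0" "s + t = 1"
  define \<sigma> \<tau> where "\<sigma> = b \<bullet> v" and "\<tau> = b \<bullet> w"
  have pos: "\<sigma> > 0" "\<tau> > 0" using v w by (auto simp: \<sigma>_def \<tau>_def)
  define m where "m = s * \<sigma> + t * \<tau>"
  have m: "m > 0"
  proof (cases "s = 0")
    case True then show ?thesis using st pos by (simp add: m_def)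
  next
    case False
    then have "s * \<sigma> > 0" "t * \<tau> \<ge> 0" using st pos by auto
    then show ?thesis by (simp add: m_def)
  qed
  have "(1 / \<sigma>) *\<^sub>R v \<in> in_chart b \<Omega>" "(1 / \<tau>) *\<^sub>R w \<in> in_chart b \<Omega>"
    using v w pos by (auto simp: in_chart_def pt_scaleR \<sigma>_def \<tau>_def)
  moreover have "s * \<sigma> / m + t * \<tau> / m = 1" using m by (simp add: m_def add_divide_distrib[symmetric])
  ultimately have "(s * \<sigma> / m) *\<^sub>R ((1 / \<sigma>) *\<^sub>R v) + (t * \<tau> / m) *\<^sub>R ((1 / \<tau>) *\<^sub>R w) \<in> in_chart b \<Omega>"
    using st pos m by (intro convexD[OF cv]) auto
  then have "(1 / m) *\<^sub>R (s *\<^sub>R v + t *\<^sub>R w) \<in> in_chart b \<Omega>"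
    using pos by (simp add: scaleR_add_right)
  then have "pt (s *\<^sub>R v + t *\<^sub>R w) \<in> \<Omega>" using m by (simp add: in_chart_def pt_scaleR)
  moreover have "b \<bullet> (s *\<^sub>R v + t *\<^sub>R w) > 0" using m by (simp add: inner_add_right m_def \<sigma>_def \<tau>_def)
  ultimately show "s *\<^sub>R v + t *\<^sub>R w \<in> {v. b \<bullet> v > 0 \<and> pt v \<in> \<Omega>}" by simp
qed

text \<open>Convexity is known in some chart \<open>b\<close>, not in the chart \<open>a\<close>. As both contain the closure of \<open>\<Omega>\<close>, the
  form \<open>a\<close> has no zero on the convex cone built with \<open>b\<close>, which is therefore \<open>C\<close> or its negative.\<close>

lemma C_convex: "convex C"
proof -
  obtain b where b: "chart_contains_closure b \<Omega>" "convex (in_chart b \<Omega>)"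
    using properly_\<Omega> by (auto simp: properly_convex_def)
  let ?D = "{v. b \<bullet> v > 0 \<and> pt v \<in> \<Omega>}"
  have D: "convex ?D" by (rule chart_cone_convex[OF b])
  have anz: "a \<bullet> v \<noteq> 0" "b \<bullet> v \<noteq> 0" if "pt v \<in> \<Omega>" for v
    using chart_nonzero[OF chart_a] chart_nonzero[OF b(1)] that \<Omega>_closure by auto
  have "linear (\<lambda>v. a \<bullet> v)" by (simp add: linear_iff inner_add_right)
  then consider "\<forall>v\<in>?D. a \<bullet> v > 0" | "\<forall>v\<in>?D. a \<bullet> v < 0"
    using functional_sign_on_convex[OF D, of "\<lambda>v. a \<bullet> v"] anz by (auto simp: pt_scaleR)
  then show ?thesis
  proof cases
    case 1
    have "C = ?D"
    proof (rule Set.set_eqI)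
      fix v
      show "v \<in> C \<longleftrightarrow> v \<in> ?D"
        using 1 anz[of v] bspec[OF 1, of "- v"] by (cases "b \<bullet> v > 0") (auto simp: C_def pt_minus)
    qed
    then show ?thesis using D by simp
  next
    case 2
    have "C = uminus ` ?D"
    proof (rule Set.set_eqI)
      fix v
      have "v \<in> uminus ` ?D \<longleftrightarrow> - v \<in> ?D" by (metis (no_types, lifting) image_iff minus_minus)
      then show "v \<in> C \<longleftrightarrow> v \<in> uminus ` ?D"
        using anz[of v] bspec[OF 2, of v] bspec[OF 2, of "- v"]
        by (cases "b \<bullet> v > 0") (auto simp: C_def pt_minus)
    qed
    then show ?thesis using convex_negations[OF D] by simp
  qed
qed

lemma pt_closure_iff:
  assumes "a \<bullet> v > 0"
  shows "pt v \<in> proj_space closure_of \<Omega> \<longleftrightarrow> v \<in> closure C"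
proof -
  have v: "v \<noteq> 0" using assms by auto
  let ?S = "{w. w \<noteq> 0 \<and> pt w \<in> \<Omega>}"
  have C: "C = {v. a \<bullet> v > 0} \<inter> ?S" by (auto simp: C_def)
  have "v \<in> closure ?S \<longleftrightarrow> v \<in> closure C"
  proof
    assume "v \<in> closure ?S"
    then have "v \<in> {v. a \<bullet> v > 0} \<inter> closure ?S" using assms by simp
    then show "v \<in> closure C"
      unfolding C using open_Int_closure_subset[OF open_halfspace_gt] by blast
  next
    assume "v \<in> closure C"
    then show "v \<in> closure ?S" using closure_mono[of C ?S] C by blast
  qed
  then show ?thesis using pt_in_closure_of[OF v] by simp
qed

lemma a_pos_on_closure: "v \<in> closure C \<Longrightarrow> v \<noteq> 0 \<Longrightarrow> a \<bullet> v > 0"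
proof -
  assume v: "v \<in> closure C" "v \<noteq> 0"
  have "C \<subseteq> {v. a \<bullet> v \<ge> 0}" by (auto simp: C_def)
  then have "closure C \<subseteq> {v. a \<bullet> v \<ge> 0}" by (intro closure_minimal closed_halfspace_ge)
  then have ge: "a \<bullet> v \<ge> 0" using v by blast
  have "C \<subseteq> {w. w \<noteq> 0 \<and> pt w \<in> \<Omega>}" by (auto simp: C_def)
  then have "pt v \<in> proj_space closure_of \<Omega>"
    using pt_in_closure_of[OF v(2)] v(1) closure_mono by blast
  then show ?thesis using chart_nonzero[OF chart_a] ge by (simp add: order_le_less)
qed

lemma pt_boundary_iff:
  assumes "a \<bullet> v > 0"
  shows "pt v \<in> proj_boundary \<Omega> \<longleftrightarrow> v \<in> closure C \<and> v \<notin> C"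
  using pt_closure_iff[OF assms] assms
  by (simp add: frontier_of_def interior_of_openin[OF open_\<Omega>] C_def)

text \<open>If a supporting form vanishes at two points, it vanishes on the segment between them, which is then a
  segment in the boundary.\<close>

lemma strict_support:
  assumes \<psi>: "\<psi> \<noteq> 0" "\<And>z. z \<in> C \<Longrightarrow> \<psi> \<bullet> z \<ge> 0" and x: "x \<in> closure C" "a \<bullet> x = 1" "\<psi> \<bullet> x = 0"
    and y: "y \<in> closure C" "a \<bullet> y = 1" "\<psi> \<bullet> y = 0"
  shows "x = y"
proof (rule ccontr)
  assume "x \<noteq> y"
  have "pt x \<noteq> pt y"
  proof
    assume "pt x = pt y"
    then obtain c where "x = c *\<^sub>R y" using pt_eqD by blast
    then show False using x y \<open>x \<noteq> y\<close> by auto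
  qed
  moreover have "pt z \<in> proj_boundary \<Omega>" if z: "z \<in> closed_segment x y" for z
  proof -
    obtain s where s: "z = (1 - s) *\<^sub>R x + s *\<^sub>R y" using z by (auto simp: closed_segment_def)
    have az: "a \<bullet> z = 1" and \<psi>z: "\<psi> \<bullet> z = 0" by (simp_all add: s inner_add_right x y)
    have "z \<in> closure C"
      using closed_segment_subset[OF x(1) y(1) convex_closure[OF C_convex]] z by blast
    moreover have "z \<notin> C" using nonneg_on_open_pos[OF C_open \<psi>(1,2), of z] \<psi>z by auto
    ultimately show ?thesis using pt_boundary_iff[of z] az by simp
  qed
  moreover have "x \<noteq> 0" "y \<noteq> 0" using x y by auto
  ultimately show False using strictly_\<Omega> unfolding proj_strictly_convex_def by blast
qed

lemma \<Gamma>_preserves: "A \<in> \<Gamma> \<Longrightarrow> pt v \<in> \<Omega> \<Longrightarrow> pt (A *v v) \<in> \<Omega>"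
  using \<Gamma>_Aut by (auto simp: proj_Aut_def proj_act_pt[symmetric])

lemma \<Gamma>_nonzero: "A \<in> \<Gamma> \<Longrightarrow> v \<in> C \<Longrightarrow> a \<bullet> (A *v v) \<noteq> 0"
  using chart_nonzero[OF chart_a] \<Gamma>_preserves \<Omega>_closure by (auto simp: C_def)

lemma \<Gamma>_G: "A \<in> \<Gamma> \<Longrightarrow> A \<in> G \<or> - A \<in> G"
proof -
  assume A: "A \<in> \<Gamma>"
  have "linear (\<lambda>v. a \<bullet> (A *v v))"
    by (simp add: linear_iff inner_add_right matrix_vector_right_distrib matrix_vector_mult_scaleR)
  then have "(\<forall>v\<in>C. a \<bullet> (A *v v) > 0) \<or> (\<forall>v\<in>C. a \<bullet> (A *v v) < 0)"
    using \<Gamma>_nonzero[OF A] by (intro functional_sign_on_convex C_convex) auto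
  then show ?thesis
    using A \<Gamma>_preserves[OF A] by (auto simp: G_def C_def mv_minus_left pt_minus)
qed

lemma G_\<Gamma>: "B \<in> G \<Longrightarrow> \<exists>A\<in>\<Gamma>. A = B \<or> A = - B"
  by (auto simp: G_def)

lemma G_inverse:
  assumes "B \<in> G" shows "invertible B" "matrix_inv B \<in> G"
proof -
  obtain A where A: "A \<in> \<Gamma>" "A = B \<or> A = - B" using G_\<Gamma>[OF assms] by blast
  have iA: "A ** matrix_inv A = mat 1" "matrix_inv A ** A = mat 1"
    using matrix_inv_cancel[OF SL_subgroup_invertible[OF subgroup_\<Gamma> A(1)]] by auto
  have neg: "(- M) ** (- N) = M ** N" for M N :: "real^'m^'m"
    using mm_scaleR[of "-1" M "-1" N] by simp
  show inv: "invertible B"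
    using A(2) iA neg unfolding invertible_def by (metis minus_minus)
  have eq: "matrix_inv B = matrix_inv A \<or> matrix_inv B = - matrix_inv A"
    using A(2) iA neg matrix_inv_eqI by (metis minus_minus)
  have iG: "matrix_inv A \<in> \<Gamma>" by (rule SL_subgroup_inv[OF subgroup_\<Gamma> A(1)])
  have "matrix_inv B *v v \<in> C" if v: "v \<in> C" for v
  proof -
    let ?w = "matrix_inv B *v v"
    have w: "pt ?w \<in> \<Omega>" "a \<bullet> ?w \<noteq> 0"
      using eq \<Gamma>_preserves[OF iG] \<Gamma>_nonzero[OF iG v] v by (auto simp: C_def mv_minus_left pt_minus)
    have "\<not> a \<bullet> ?w < 0"
    proof
      assume "a \<bullet> ?w < 0"
      then have "- ?w \<in> C" using w by (simp add: C_def pt_minus)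
      then have "B *v (- ?w) \<in> C" using assms by (simp add: G_def)
      then have "- v \<in> C"
        using matrix_inv_cancel(3)[OF inv, of v] mv_minus_left[of B ?w]
        by (metis matrix_vector_mult_scaleR scaleR_minus1_left)
      then show False using v by (auto simp: C_def)
    qed
    then show ?thesis using w by (simp add: C_def)
  qed
  then show "matrix_inv B \<in> G" using eq iG by (auto simp: G_def)
qed

lemma G_product: "A \<in> G \<Longrightarrow> B \<in> G \<Longrightarrow> A ** B \<in> G"
proof -
  assume A: "A \<in> G" and B: "B \<in> G"
  obtain A' B' where A': "A' \<in> \<Gamma>" "A' = A \<or> A' = - A" and B': "B' \<in> \<Gamma>" "B' = B \<or> B' = - B"
    using G_\<Gamma>[OF A] G_\<Gamma>[OF B] by blast
  have "A' ** B' \<in> \<Gamma>" by (rule SL_subgroup_mult[OF subgroup_\<Gamma> A'(1) B'(1)])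
  moreover have "A' ** B' = A ** B \<or> A' ** B' = - (A ** B)"
    using A'(2) B'(2) mm_scaleR[of "-1" A "-1" B] mm_scaleR[of "-1" A 1 B] mm_scaleR[of 1 A "-1" B] by auto
  moreover have "(A ** B) *v v \<in> C" if "v \<in> C" for v
    using A B that by (simp add: G_def matrix_vector_mul_assoc[symmetric])
  ultimately show ?thesis by (auto simp: G_def)
qed

lemma G_bounded_finite: "finite {A \<in> G. norm A \<le> R}"
proof -
  let ?F = "{A \<in> \<Gamma>. norm A \<le> R}"
  have "{A \<in> G. norm A \<le> R} \<subseteq> ?F \<union> uminus ` ?F"
  proof
    fix A assume "A \<in> {A \<in> G. norm A \<le> R}"
    then have "A \<in> ?F \<or> - A \<in> ?F" by (auto simp: G_def)
    moreover have "A = - (- A)" by simp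
    ultimately show "A \<in> ?F \<union> uminus ` ?F" by blast
  qed
  then show ?thesis using discrete_subgroup_finite[OF subgroup_\<Gamma> discrete_\<Gamma>] finite_subset by blast
qed

lemma cone_group_cone: "cone_group C a G"
proof
  show "open C" "convex C" by (fact C_open C_convex)+
  show "C \<noteq> {}" using \<Omega>_rep[OF x0_\<Omega>] by blast
  show "c *\<^sub>R v \<in> C" if "v \<in> C" "c > 0" for v c using that by (rule C_scaleR)
  show "a \<bullet> v > 0" if "v \<in> C" for v using that by (simp add: C_def)
  show "a \<bullet> v > 0" if "v \<in> closure C" "v \<noteq> 0" for v using that by (rule a_pos_on_closure)
  show "x = y" if "\<psi> \<noteq> 0" "\<And>z. z \<in> C \<Longrightarrow> \<psi> \<bullet> z \<ge> 0" "x \<in> closure C" "y \<in> closure C"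
    "a \<bullet> x = 1" "a \<bullet> y = 1" "\<psi> \<bullet> x = 0" "\<psi> \<bullet> y = 0" for \<psi> x y
    by (rule strict_support[OF that(1,2,3,5,7,4,6,8)])
  show "mat 1 \<in> G" using SL_subgroup_one[OF subgroup_\<Gamma>] by (simp add: G_def)
  show "A ** B \<in> G" if "A \<in> G" "B \<in> G" for A B using that by (rule G_product)
  show "matrix_inv A \<in> G" "invertible A" if "A \<in> G" for A using that by (fact G_inverse)+
  show "A *v v \<in> C" if "A \<in> G" "v \<in> C" for A v using that by (simp add: G_def)
  show "finite {A \<in> G. norm A \<le> R}" for R by (rule G_bounded_finite)
qed

end

section \<open>Directions, chords and the geodesic flow\<close>

lemma dir_subset:
  assumes "l \<noteq> 0" "m > 0"
  shows "dir (l *\<^sub>R v) (l *\<^sub>R (m *\<^sub>R \<xi> + c *\<^sub>R v)) \<subseteq> dir v \<xi>"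
proof
  fix z assume "z \<in> dir (l *\<^sub>R v) (l *\<^sub>R (m *\<^sub>R \<xi> + c *\<^sub>R v))"
  then obtain l' m' c' where z: "z = (l' *\<^sub>R l *\<^sub>R v, l' *\<^sub>R (m' *\<^sub>R l *\<^sub>R (m *\<^sub>R \<xi> + c *\<^sub>R v) + c' *\<^sub>R l *\<^sub>R v))"
    "l' \<noteq> 0" "m' > 0" by (auto simp: dir_def)
  have "z = ((l' * l) *\<^sub>R v, (l' * l) *\<^sub>R ((m' * m) *\<^sub>R \<xi> + (m' * c + c') *\<^sub>R v))"
    by (simp add: z algebra_simps)
  moreover have "l' * l \<noteq> 0" "m' * m > 0" using z assms by simp_all
  ultimately show "z \<in> dir v \<xi>" unfolding dir_def by blast
qed

lemma dir_rescale:
  assumes "l \<noteq> 0" "m > 0"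
  shows "dir (l *\<^sub>R v) (l *\<^sub>R (m *\<^sub>R \<xi> + c *\<^sub>R v)) = dir v \<xi>"
proof
  show "dir (l *\<^sub>R v) (l *\<^sub>R (m *\<^sub>R \<xi> + c *\<^sub>R v)) \<subseteq> dir v \<xi>" by (rule dir_subset[OF assms])
  let ?v = "l *\<^sub>R v" and ?\<xi> = "l *\<^sub>R (m *\<^sub>R \<xi> + c *\<^sub>R v)"
  have 1: "(1 / l) *\<^sub>R ?v = v" using assms by simp
  have "(1 / m) *\<^sub>R ?\<xi> + (- c / m) *\<^sub>R ?v = l *\<^sub>R \<xi>"
    using assms by (simp add: scaleR_add_right)
  then have 2: "(1 / l) *\<^sub>R ((1 / m) *\<^sub>R ?\<xi> + (- c / m) *\<^sub>R ?v) = \<xi>" using assms by simp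
  show "dir v \<xi> \<subseteq> dir ?v ?\<xi>"
    using dir_subset[of "1 / l" "1 / m" ?v ?\<xi> "- c / m"] assms unfolding 1 2 by simp
qed

lemma dir_neg: "dir (- v) (- \<xi>) = dir v \<xi>"
  using dir_rescale[of "-1" 1 v \<xi> 0] by simp

lemma dir_act_dir: "dir_act A (dir v \<xi>) = dir (A *v v) (A *v \<xi>)"
proof -
  have *: "(case (l *\<^sub>R v, l *\<^sub>R (m *\<^sub>R \<xi> + c *\<^sub>R v)) of (v, \<xi>) \<Rightarrow> (A *v v, A *v \<xi>)) =
     (l *\<^sub>R (A *v v), l *\<^sub>R (m *\<^sub>R (A *v \<xi>) + c *\<^sub>R (A *v v)))" for l m c
    by (simp add: matrix_vector_mult_scaleR matrix_vector_right_distrib)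
  show ?thesis
  proof
    show "dir_act A (dir v \<xi>) \<subseteq> dir (A *v v) (A *v \<xi>)"
    proof
      fix z assume "z \<in> dir_act A (dir v \<xi>)"
      then obtain l m c where "l \<noteq> 0" "m > 0" "z = (case (l *\<^sub>R v, l *\<^sub>R (m *\<^sub>R \<xi> + c *\<^sub>R v)) of (v, \<xi>) \<Rightarrow> (A *v v, A *v \<xi>))"
        unfolding dir_act_def dir_def by blast
      then show "z \<in> dir (A *v v) (A *v \<xi>)" unfolding * dir_def by blast
    qed
    show "dir (A *v v) (A *v \<xi>) \<subseteq> dir_act A (dir v \<xi>)"
    proof
      fix z assume "z \<in> dir (A *v v) (A *v \<xi>)"
      then obtain l m c where "l \<noteq> 0" "m > 0" "z = (l *\<^sub>R (A *v v), l *\<^sub>R (m *\<^sub>R (A *v \<xi>) + c *\<^sub>R (A *v v)))"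
        unfolding dir_def by blast
      moreover from this have "(l *\<^sub>R v, l *\<^sub>R (m *\<^sub>R \<xi> + c *\<^sub>R v)) \<in> dir v \<xi>" unfolding dir_def by blast
      ultimately show "z \<in> dir_act A (dir v \<xi>)" unfolding dir_act_def by (metis (no_types, lifting) * image_eqI)
    qed
  qed
qed

lemma chart_reps_dir:
  assumes "a \<bullet> v = 1" "a \<bullet> \<xi> = 0"
  shows "chart_reps a (dir v \<xi>) = {(v, m *\<^sub>R \<xi>) | m. m > 0}"
proof
  show "chart_reps a (dir v \<xi>) \<subseteq> {(v, m *\<^sub>R \<xi>) | m. m > 0}"
    using assms by (auto simp: chart_reps_def dir_def inner_add_right)
  show "{(v, m *\<^sub>R \<xi>) | m. m > 0} \<subseteq> chart_reps a (dir v \<xi>)"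
  proof
    fix z assume "z \<in> {(v, m *\<^sub>R \<xi>) | m. m > 0}"
    then obtain m where m: "m > 0" "z = (1 *\<^sub>R v, 1 *\<^sub>R (m *\<^sub>R \<xi> + 0 *\<^sub>R v))" by auto
    have "z \<in> dir v \<xi>" unfolding dir_def
      by (rule CollectI, rule exI[of _ 1], rule exI[of _ m], rule exI[of _ 0]) (use m in simp)
    then show "z \<in> chart_reps a (dir v \<xi>)" using m assms by (auto simp: chart_reps_def)
  qed
qed

lemma bex_positive_multiples:
  "(\<exists>(v, \<xi>) \<in> {(u, m *\<^sub>R w) | m. m > 0}. R v \<xi>) \<longleftrightarrow> (\<exists>m>0. R u (m *\<^sub>R w))"
  by auto

lemma chart_coord_pt: "a \<bullet> v = 1 \<Longrightarrow> chart_coord a (pt v) = v"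
  unfolding chart_coord_def
proof (rule the_equality)
  fix w assume "a \<bullet> v = 1" "w \<in> pt v \<and> a \<bullet> w = 1"
  then show "w = v" by (auto simp: pt_def)
qed (simp add: mem_pt)

lemma cancel_common_square:
  "d \<noteq> 0 \<Longrightarrow> (x * d * (y * d)) / (z * d * (w * d)) = (x / w) / (z / y)" for d :: real
  by (simp add: field_simps)

text \<open>The arc length for the Hilbert distance along a chord that is parametrized affinely by \<open>(0, 1)\<close>.\<close>

definition logit :: "real \<Rightarrow> real" where "logit \<theta> = 1 / 2 * ln (\<theta> / (1 - \<theta>))"

lemma logit_strict_mono:
  assumes "0 < s" "s < t" "t < 1" shows "logit s < logit t"
proof -
  have "s / (1 - s) < t / (1 - t)" using assms by (intro frac_less) auto
  moreover have "s / (1 - s) > 0" "t / (1 - t) > 0" using assms by (auto intro!: divide_pos_pos)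
  ultimately show ?thesis by (simp add: logit_def)
qed

lemma logit_less_iff: "0 < s \<Longrightarrow> s < 1 \<Longrightarrow> 0 < t \<Longrightarrow> t < 1 \<Longrightarrow> logit s < logit t \<longleftrightarrow> s < t"
  using logit_strict_mono[of s t] logit_strict_mono[of t s] by (metis less_asym linorder_neqE_linordered_idom)

lemma logit_inj: "0 < s \<Longrightarrow> s < 1 \<Longrightarrow> 0 < t \<Longrightarrow> t < 1 \<Longrightarrow> logit s = logit t \<Longrightarrow> s = t"
  using logit_strict_mono[of s t] logit_strict_mono[of t s] by (metis less_irrefl linorder_neqE_linordered_idom)

context cone_group
begin

definition chord :: "real^'m \<Rightarrow> real^'m \<Rightarrow> real \<Rightarrow> real^'m" where
  "chord P Q \<theta> = (1 - \<theta>) *\<^sub>R P + \<theta> *\<^sub>R Q"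

lemma chord_swap: "chord P Q \<theta> = chord Q P (1 - \<theta>)"
  by (simp add: chord_def add.commute)

lemma chord_add: "chord P Q \<theta> + s *\<^sub>R (Q - P) = chord P Q (\<theta> + s)"
  by (simp add: chord_def algebra_simps)

lemma chord_diff: "chord P Q \<theta> - chord P Q \<tau> = (\<theta> - \<tau>) *\<^sub>R (Q - P)"
  by (simp add: chord_def algebra_simps)

lemma chord_a: "a \<bullet> P = 1 \<Longrightarrow> a \<bullet> Q = 1 \<Longrightarrow> a \<bullet> chord P Q \<theta> = 1"
  by (simp add: chord_def inner_add_right)

lemma chord_inside:
  assumes "P \<in> bd" "Q \<in> bd" "pr P \<noteq> pr Q" "0 < \<theta>" "\<theta> < 1"
  shows "chord P Q \<theta> \<in> C"
  unfolding chord_def using assms by (intro bd_add_C bd_scale) (auto simp: pr_scale)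

text \<open>A form supporting the cone at \<open>Q\<close> is positive at \<open>P\<close>, hence negative beyond \<open>Q\<close>.\<close>

lemma chord_outside:
  assumes PQ: "P \<in> bd" "Q \<in> bd" "pr P \<noteq> pr Q" and \<theta>: "\<theta> > 1"
  shows "chord P Q \<theta> \<notin> closure C"
proof
  assume c: "chord P Q \<theta> \<in> closure C"
  obtain \<psi> where \<psi>: "supporting \<psi>" "\<psi> \<bullet> Q = 0" using supporting_exists[OF PQ(2)] by blast
  have "\<psi> \<bullet> P > 0" using supporting_strict[OF \<psi>(1) PQ(2,1) \<psi>(2)] PQ(3) by simp
  then have "\<psi> \<bullet> chord P Q \<theta> < 0" using \<theta> \<psi> by (simp add: chord_def inner_add_right mult_neg_pos)
  then show False using supporting_closure[OF \<psi>(1) c] by simp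
qed

lemma chord_exit:
  assumes "P \<in> bd" "Q \<in> bd" "pr P \<noteq> pr Q" "\<theta> > 0" "chord P Q \<theta> \<in> closure C" "chord P Q \<theta> \<notin> C"
  shows "\<theta> = 1"
  using chord_inside[OF assms(1-4)] chord_outside[OF assms(1-3), of \<theta>] assms(5,6) by fastforce

end

context convex_quotient
begin

sublocale cone_group C a G by (rule cone_group_cone)

lemma in_chart_boundary_iff: "v \<in> in_chart a (proj_boundary \<Omega>) \<longleftrightarrow> v \<in> bd \<and> a \<bullet> v = 1"
  using pt_boundary_iff[of v] by (auto simp: in_chart_def bd_def)

lemma boundary_hit_chord:
  assumes P: "P \<in> bd" "a \<bullet> P = 1" and Q: "Q \<in> bd" "a \<bullet> Q = 1" and PQ: "P \<noteq> Q"
    and \<tau>: "0 < \<tau>" and m: "m > 0" and \<tau>1: "\<tau> < 1"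
  shows "boundary_hit a \<Omega> (chord P Q \<tau>) (m *\<^sub>R (Q - P)) = Q"
  unfolding boundary_hit_def
proof (rule the_equality)
  have ne: "pr P \<noteq> pr Q" using P Q PQ by (simp add: pr_id)
  have "chord P Q \<tau> + ((1 - \<tau>) / m) *\<^sub>R m *\<^sub>R (Q - P) = Q" using m by (simp add: chord_add) (simp add: chord_def)
  then have "\<exists>s>0. Q = chord P Q \<tau> + s *\<^sub>R m *\<^sub>R (Q - P)"
    using m \<tau>1 by (intro exI[of _ "(1 - \<tau>) / m"]) simp
  then show "Q \<in> in_chart a (proj_boundary \<Omega>) \<and> (\<exists>s>0. Q = chord P Q \<tau> + s *\<^sub>R m *\<^sub>R (Q - P))"
    using Q by (simp add: in_chart_boundary_iff)
  fix p assume p: "p \<in> in_chart a (proj_boundary \<Omega>) \<and> (\<exists>s>0. p = chord P Q \<tau> + s *\<^sub>R m *\<^sub>R (Q - P))"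
  then obtain s where s: "s > 0" "p = chord P Q (\<tau> + s * m)" by (auto simp: chord_add)
  have "\<tau> + s * m > 0" using s m \<tau> by (simp add: add_pos_pos)
  then have "\<tau> + s * m = 1"
    using p s(2) by (intro chord_exit[OF P(1) Q(1) ne]) (auto simp: in_chart_boundary_iff bd_def)
  then show "p = Q" using s by (simp add: chord_def)
qed

lemma boundary_hit_chord_back:
  assumes P: "P \<in> bd" "a \<bullet> P = 1" and Q: "Q \<in> bd" "a \<bullet> Q = 1" and PQ: "P \<noteq> Q"
    and \<tau>: "0 < \<tau>" and m: "m < 0" and \<tau>1: "\<tau> < 1"
  shows "boundary_hit a \<Omega> (chord P Q \<tau>) (m *\<^sub>R (Q - P)) = P"
proof -
  have "m *\<^sub>R (Q - P) = (- m) *\<^sub>R (P - Q)" by (simp add: algebra_simps)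
  then show ?thesis
    using boundary_hit_chord[OF Q P, of "1 - \<tau>" "- m"] PQ \<tau> m \<tau>1 by (simp add: chord_swap[of P Q])
qed

lemma hilbert_dist_chord:
  assumes P: "P \<in> bd" "a \<bullet> P = 1" and Q: "Q \<in> bd" "a \<bullet> Q = 1" and PQ: "P \<noteq> Q"
    and \<tau>: "0 < \<tau>" "\<tau> < 1" and \<theta>: "0 < \<theta>" "\<theta> < 1"
  shows "hilbert_dist a \<Omega> (pt (chord P Q \<tau>)) (pt (chord P Q \<theta>)) = \<bar>logit \<theta> - logit \<tau>\<bar>"
proof (cases "\<theta> = \<tau>")
  case True
  then show ?thesis by (simp add: hilbert_dist_def)
next
  case False
  let ?X = "chord P Q \<tau>" and ?Y = "chord P Q \<theta>"
  define d where "d = norm (Q - P)"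
  have d: "d > 0" using PQ by (simp add: d_def)
  have cc: "chart_coord a (pt ?X) = ?X" "chart_coord a (pt ?Y) = ?Y"
    by (simp_all add: chart_coord_pt chord_a P Q)
  have "?X \<noteq> ?Y" using chord_diff[of P Q \<theta> \<tau>] False PQ by auto
  then have ne: "pt ?X \<noteq> pt ?Y" using cc by metis
  have nP: "norm (P - chord P Q s) = \<bar>s\<bar> * d" for s
    using chord_diff[of P Q 0 s] by (simp add: chord_def[of P Q 0] d_def)
  have nQ: "norm (Q - chord P Q s) = \<bar>1 - s\<bar> * d" for s
    using chord_diff[of P Q 1 s] by (simp add: chord_def[of P Q 1] d_def)
  have XY: "?X - ?Y = (\<tau> - \<theta>) *\<^sub>R (Q - P)" and YX: "?Y - ?X = (\<theta> - \<tau>) *\<^sub>R (Q - P)"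
    by (rule chord_diff)+
  show ?thesis
  proof (cases "\<tau> < \<theta>")
    case True
    have "boundary_hit a \<Omega> ?X (?X - ?Y) = P"
      unfolding XY using True by (intro boundary_hit_chord_back P Q PQ \<tau>) simp
    moreover have "boundary_hit a \<Omega> ?X (?Y - ?X) = Q"
      unfolding YX using True by (intro boundary_hit_chord P Q PQ \<tau>) simp
    ultimately have "hilbert_dist a \<Omega> (pt ?X) (pt ?Y) = 1/2 * ln ((\<theta> * d * ((1 - \<tau>) * d)) / (\<tau> * d * ((1 - \<theta>) * d)))"
      using ne \<tau> \<theta> by (simp add: hilbert_dist_def cc nP nQ Let_def)
    also have "(\<theta> * d * ((1 - \<tau>) * d)) / (\<tau> * d * ((1 - \<theta>) * d)) = (\<theta> / (1 - \<theta>)) / (\<tau> / (1 - \<tau>))"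
      using d by (intro cancel_common_square) simp
    also have "1/2 * ln \<dots> = logit \<theta> - logit \<tau>"
      using \<tau> \<theta> by (subst ln_div) (simp_all add: logit_def)
    also have "\<dots> = \<bar>logit \<theta> - logit \<tau>\<bar>" using logit_strict_mono[OF \<tau>(1) True \<theta>(2)] by simp
    finally show ?thesis .
  next
    case f: False
    then have lt: "\<theta> < \<tau>" using False by simp
    have "boundary_hit a \<Omega> ?X (?X - ?Y) = Q"
      unfolding XY using lt by (intro boundary_hit_chord P Q PQ \<tau>) simp
    moreover have "boundary_hit a \<Omega> ?X (?Y - ?X) = P"
      unfolding YX using lt by (intro boundary_hit_chord_back P Q PQ \<tau>) simp
    ultimately have "hilbert_dist a \<Omega> (pt ?X) (pt ?Y) = 1/2 * ln (((1 - \<theta>) * d * (\<tau> * d)) / ((1 - \<tau>) * d * (\<theta> * d)))"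
      using ne \<tau> \<theta> by (simp add: hilbert_dist_def cc nP nQ Let_def)
    also have "((1 - \<theta>) * d * (\<tau> * d)) / ((1 - \<tau>) * d * (\<theta> * d)) = (\<tau> / (1 - \<tau>)) / (\<theta> / (1 - \<theta>))"
      using d cancel_common_square[of d "1 - \<theta>" \<tau> "1 - \<tau>" \<theta>] by simp
    also have "1/2 * ln \<dots> = logit \<tau> - logit \<theta>"
      using \<tau> \<theta> by (subst ln_div) (simp_all add: logit_def)
    also have "\<dots> = \<bar>logit \<theta> - logit \<tau>\<bar>" using logit_strict_mono[OF \<theta>(1) lt \<tau>(2)] by simp
    finally show ?thesis .
  qed
qed

lemma chord_dir_reps:
  assumes "a \<bullet> P = 1" "a \<bullet> Q = 1"
  shows "chart_reps a (dir (chord P Q \<tau>) (Q - P)) = {(chord P Q \<tau>, m *\<^sub>R (Q - P)) | m. m > 0}"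
  using assms by (intro chart_reps_dir) (simp_all add: chord_a inner_diff_right)

lemma fwd_end_chord:
  assumes P: "P \<in> bd" "a \<bullet> P = 1" and Q: "Q \<in> bd" "a \<bullet> Q = 1" and PQ: "P \<noteq> Q"
    and \<tau>: "0 < \<tau>" "\<tau> < 1"
  shows "fwd_end a \<Omega> (dir (chord P Q \<tau>) (Q - P)) = pt Q"
proof -
  have "(\<exists>(v, \<xi>) \<in> chart_reps a (dir (chord P Q \<tau>) (Q - P)). p = pt (boundary_hit a \<Omega> v \<xi>)) \<longleftrightarrow> p = pt Q" for p
    unfolding chord_dir_reps[OF P(2) Q(2)] bex_positive_multiples
    using boundary_hit_chord[OF P Q PQ \<tau>(1) _ \<tau>(2)] zero_less_one by metis
  then show ?thesis by (simp add: fwd_end_def)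
qed

lemma bwd_end_chord:
  assumes P: "P \<in> bd" "a \<bullet> P = 1" and Q: "Q \<in> bd" "a \<bullet> Q = 1" and PQ: "P \<noteq> Q"
    and \<tau>: "0 < \<tau>" "\<tau> < 1"
  shows "bwd_end a \<Omega> (dir (chord P Q \<tau>) (Q - P)) = pt P"
proof -
  have "boundary_hit a \<Omega> (chord P Q \<tau>) (- (m *\<^sub>R (Q - P))) = P" if "m > 0" for m
    using boundary_hit_chord_back[OF P Q PQ \<tau>(1) _ \<tau>(2), of "- m"] that by (simp add: algebra_simps)
  then have "(\<exists>(v, \<xi>) \<in> chart_reps a (dir (chord P Q \<tau>) (Q - P)). p = pt (boundary_hit a \<Omega> v (- \<xi>))) \<longleftrightarrow> p = pt P" for p
    unfolding chord_dir_reps[OF P(2) Q(2)] bex_positive_multiples using zero_less_one by metis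
  then show ?thesis by (simp add: bwd_end_def)
qed

text \<open>A representative of the direction is \<open>(chord P Q \<tau>, m *\<^sub>R (Q - P))\<close> with \<open>m > 0\<close>, and moving by \<open>s\<close> leads to
  the parameter \<open>\<tau> + s m\<close>. The sign and the distance required of \<open>s\<close> say together that the arc length grows by
  \<open>t\<close>, which determines the parameter.\<close>

lemma geodesic_flow_chord:
  assumes P: "P \<in> bd" "a \<bullet> P = 1" and Q: "Q \<in> bd" "a \<bullet> Q = 1" and PQ: "P \<noteq> Q"
    and \<tau>: "0 < \<tau>" "\<tau> < 1" and \<theta>: "0 < \<theta>" "\<theta> < 1" and t: "logit \<theta> - logit \<tau> = t"
  shows "geodesic_flow a \<Omega> t (dir (chord P Q \<tau>) (Q - P)) = dir (chord P Q \<theta>) (Q - P)"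
proof -
  let ?P = "\<lambda>w'. \<exists>(v, \<xi>) \<in> chart_reps a (dir (chord P Q \<tau>) (Q - P)). \<exists>s.
        w' = dir (v + s *\<^sub>R \<xi>) \<xi> \<and> pt (v + s *\<^sub>R \<xi>) \<in> \<Omega> \<and>
        sgn s = sgn t \<and> hilbert_dist a \<Omega> (pt v) (pt (v + s *\<^sub>R \<xi>)) = \<bar>t\<bar>"
  have ne: "pr P \<noteq> pr Q" using P Q PQ by (simp add: pr_id)
  have sgn_logit: "sgn (logit \<sigma> - logit \<tau>) = sgn (\<sigma> - \<tau>)" if "0 < \<sigma>" "\<sigma> < 1" for \<sigma>
    using logit_less_iff[OF that \<tau>] logit_less_iff[OF \<tau> that] logit_inj[OF that \<tau>]
    by (auto simp: sgn_if)
  have "(THE w'. ?P w') = dir (chord P Q \<theta>) (Q - P)"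
  proof (rule the_equality)
    have "(chord P Q \<tau>, 1 *\<^sub>R (Q - P)) \<in> chart_reps a (dir (chord P Q \<tau>) (Q - P))"
      unfolding chord_dir_reps[OF P(2) Q(2)] using zero_less_one by blast
    moreover have "chord P Q \<tau> + (\<theta> - \<tau>) *\<^sub>R 1 *\<^sub>R (Q - P) = chord P Q \<theta>" by (simp add: chord_add)
    moreover have "pt (chord P Q \<theta>) \<in> \<Omega>" using chord_inside[OF P(1) Q(1) ne \<theta>] by (simp add: C_def)
    moreover have "sgn (\<theta> - \<tau>) = sgn t" using sgn_logit[OF \<theta>] t by simp
    moreover have "hilbert_dist a \<Omega> (pt (chord P Q \<tau>)) (pt (chord P Q \<theta>)) = \<bar>t\<bar>"
      using hilbert_dist_chord[OF P Q PQ \<tau> \<theta>] t by simp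
    ultimately show "?P (dir (chord P Q \<theta>) (Q - P))"
      by (intro bexI[of _ "(chord P Q \<tau>, 1 *\<^sub>R (Q - P))"]) (auto intro!: exI[of _ "\<theta> - \<tau>"])
  next
    fix w' assume "?P w'"
    then obtain m s where m: "m > 0" and w': "w' = dir (chord P Q \<tau> + s *\<^sub>R m *\<^sub>R (Q - P)) (m *\<^sub>R (Q - P))"
      and in\<Omega>: "pt (chord P Q \<tau> + s *\<^sub>R m *\<^sub>R (Q - P)) \<in> \<Omega>" and sg: "sgn s = sgn t"
      and dist: "hilbert_dist a \<Omega> (pt (chord P Q \<tau>)) (pt (chord P Q \<tau> + s *\<^sub>R m *\<^sub>R (Q - P))) = \<bar>t\<bar>"
      unfolding chord_dir_reps[OF P(2) Q(2)] by auto
    define \<sigma> where "\<sigma> = \<tau> + s * m"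
    have eq: "chord P Q \<tau> + s *\<^sub>R m *\<^sub>R (Q - P) = chord P Q \<sigma>" by (simp add: chord_add \<sigma>_def)
    have inC: "chord P Q \<sigma> \<in> C" using in\<Omega>[unfolded eq] chord_a[OF P(2) Q(2)] by (simp add: C_def)
    have "chord P Q \<sigma> \<in> closure C" using inC closure_subset by blast
    then have "\<sigma> \<le> 1" "\<sigma> \<ge> 0"
      using chord_outside[OF P(1) Q(1) ne, of \<sigma>] chord_outside[OF Q(1) P(1) ne[symmetric], of "1 - \<sigma>"]
      by (force simp: chord_swap[of P Q])+
    moreover have "\<sigma> \<noteq> 0" "\<sigma> \<noteq> 1" using inC P Q by (auto simp: chord_def bd_def)
    ultimately have \<sigma>: "0 < \<sigma>" "\<sigma> < 1" by auto
    have "sgn (logit \<sigma> - logit \<tau>) = sgn t"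
      using sgn_logit[OF \<sigma>] sg m by (simp add: \<sigma>_def sgn_mult)
    moreover have "\<bar>logit \<sigma> - logit \<tau>\<bar> = \<bar>t\<bar>"
      using dist[unfolded eq] hilbert_dist_chord[OF P Q PQ \<tau> \<sigma>] by simp
    ultimately have "logit \<sigma> - logit \<tau> = t"
      by (subst sgn_mult_abs[symmetric]) (simp only: sgn_mult_abs)
    then have "logit \<sigma> = logit \<theta>" using t by linarith
    then have "\<sigma> = \<theta>" by (rule logit_inj[OF \<sigma> \<theta>])
    moreover have "dir (chord P Q \<sigma>) (m *\<^sub>R (Q - P)) = dir (chord P Q \<sigma>) (Q - P)"
      using dir_rescale[of 1 m "chord P Q \<sigma>" "Q - P" 0] m by simp
    ultimately show "w' = dir (chord P Q \<theta>) (Q - P)" unfolding w' eq by simp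
  qed
  then show ?thesis by (simp add: geodesic_flow_def)
qed

text \<open>The direction at \<open>[p + q]\<close> towards \<open>[q]\<close>. These are the coordinates in which the flow and the group act
  linearly.\<close>

definition ray :: "real^'m \<Rightarrow> real^'m \<Rightarrow> ((real^'m) \<times> (real^'m)) set" where
  "ray p q = dir (p + q) q"

text \<open>Passing to the chart: the parameter of \<open>p + q\<close> on the chord is the weight of \<open>q\<close>.\<close>

lemma ray_chord:
  assumes p: "p \<in> bd" and q: "q \<in> bd"
  shows "ray p q = dir (chord (pr p) (pr q) (a \<bullet> q / (a \<bullet> p + a \<bullet> q))) (pr q - pr p)"
proof -
  define s where "s = a \<bullet> p + a \<bullet> q"
  have pos: "a \<bullet> p > 0" "a \<bullet> q > 0" using bd_pos p q by auto
  then have s: "s > 0" by (simp add: s_def)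
  have 1: "chord (pr p) (pr q) (a \<bullet> q / s) = (1 / s) *\<^sub>R (p + q)"
  proof -
    have "1 - a \<bullet> q / s = a \<bullet> p / s" using s by (simp add: s_def field_simps)
    then show ?thesis using pos by (simp add: chord_def pr_def scaleR_add_right)
  qed
  have 2: "pr q - pr p = (1 / s) *\<^sub>R ((s * (s / (a \<bullet> q * (a \<bullet> p)))) *\<^sub>R q + (- s / (a \<bullet> p)) *\<^sub>R (p + q))"
  proof -
    have "s / (a \<bullet> q * (a \<bullet> p)) - 1 / (a \<bullet> p) = 1 / (a \<bullet> q)"
      using pos by (simp add: s_def field_simps)
    then have "(s / (a \<bullet> q * (a \<bullet> p))) *\<^sub>R q - (1 / (a \<bullet> p)) *\<^sub>R q = (1 / (a \<bullet> q)) *\<^sub>R q"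
      by (metis scaleR_left_diff_distrib)
    then show ?thesis using s by (simp add: pr_def scaleR_add_right algebra_simps)
  qed
  have "s * (s / (a \<bullet> q * (a \<bullet> p))) > 0" using s pos by simp
  then have "dir ((1 / s) *\<^sub>R (p + q)) ((1 / s) *\<^sub>R ((s * (s / (a \<bullet> q * (a \<bullet> p)))) *\<^sub>R q + (- s / (a \<bullet> p)) *\<^sub>R (p + q)))
      = dir (p + q) q" using s by (intro dir_rescale) auto
  then show ?thesis unfolding ray_def s_def[symmetric] 1 2 by simp
qed

lemma ray_param:
  assumes "p \<in> bd" "q \<in> bd"
  shows "0 < a \<bullet> q / (a \<bullet> p + a \<bullet> q)" "a \<bullet> q / (a \<bullet> p + a \<bullet> q) < 1"
    "logit (a \<bullet> q / (a \<bullet> p + a \<bullet> q)) = 1 / 2 * ln ((a \<bullet> q) / (a \<bullet> p))"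
proof -
  have pos: "a \<bullet> p > 0" "a \<bullet> q > 0" using bd_pos assms by auto
  then show "0 < a \<bullet> q / (a \<bullet> p + a \<bullet> q)" "a \<bullet> q / (a \<bullet> p + a \<bullet> q) < 1" by (simp_all add: field_simps)
  have "1 - a \<bullet> q / (a \<bullet> p + a \<bullet> q) = a \<bullet> p / (a \<bullet> p + a \<bullet> q)" using pos by (simp add: field_simps)
  then show "logit (a \<bullet> q / (a \<bullet> p + a \<bullet> q)) = 1 / 2 * ln ((a \<bullet> q) / (a \<bullet> p))"
    using pos by (simp add: logit_def)
qed

lemma ray_ends:
  assumes p: "p \<in> bd" and q: "q \<in> bd" and pq: "pr p \<noteq> pr q"
  shows "fwd_end a \<Omega> (ray p q) = pt q" "bwd_end a \<Omega> (ray p q) = pt p"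
proof -
  have "pt (pr p) = pt p" "pt (pr q) = pt q" using bd_pos[OF p] bd_pos[OF q] by (simp_all add: pr_def pt_scaleR)
  then show "fwd_end a \<Omega> (ray p q) = pt q" "bwd_end a \<Omega> (ray p q) = pt p"
    using fwd_end_chord[of "pr p" "pr q"] bwd_end_chord[of "pr p" "pr q"] pr_bd[OF p] pr_bd[OF q] pq ray_param[OF p q]
    by (simp_all add: ray_chord[OF p q])
qed

text \<open>In the coordinates \<open>(p, q)\<close> the arc length is half the logarithm of \<open>(a \<bullet> q) / (a \<bullet> p)\<close>, up to a
  constant.\<close>

lemma geodesic_flow_ray:
  assumes p: "p \<in> bd" and q: "q \<in> bd" and pq: "pr p \<noteq> pr q"
  shows "geodesic_flow a \<Omega> t (ray p q) = ray (exp (- t) *\<^sub>R p) (exp t *\<^sub>R q)"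
proof -
  let ?p = "exp (- t) *\<^sub>R p" and ?q = "exp t *\<^sub>R q"
  have p': "?p \<in> bd" and q': "?q \<in> bd" using bd_scale p q by auto
  have pos: "a \<bullet> p > 0" "a \<bullet> q > 0" using bd_pos p q by auto
  have "ln ((a \<bullet> ?q) / (a \<bullet> ?p)) = ln ((a \<bullet> q) / (a \<bullet> p)) + 2 * t"
    using pos by (simp add: ln_mult ln_div)
  then have "logit (a \<bullet> ?q / (a \<bullet> ?p + a \<bullet> ?q)) - logit (a \<bullet> q / (a \<bullet> p + a \<bullet> q)) = t"
    unfolding ray_param(3)[OF p q] ray_param(3)[OF p' q'] by (simp add: add_divide_distrib)
  from geodesic_flow_chord[OF _ _ _ _ pq ray_param(1,2)[OF p q] ray_param(1,2)[OF p' q'] this]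
  show ?thesis unfolding ray_chord[OF p q] ray_chord[OF p' q'] using pr_bd[OF p] pr_bd[OF q] by (simp add: pr_scale)
qed

lemma ray_scale: "c > 0 \<Longrightarrow> ray (c *\<^sub>R p) (c *\<^sub>R q) = ray p q"
  unfolding ray_def using dir_rescale[of c 1 "p + q" q 0] by (simp add: scaleR_add_right)

lemma dir_act_ray: "dir_act A (ray p q) = ray (A *v p) (A *v q)"
  by (simp add: ray_def dir_act_dir matrix_vector_right_distrib)

lemma dir_act_ray_minus: "dir_act (- A) (ray p q) = dir_act A (ray p q)"
  by (simp add: ray_def dir_act_dir mv_minus_left dir_neg)

section \<open>The cone over the limit set\<close>

definition \<Lambda> :: "(real^'m) set" where "\<Lambda> = {v \<in> bd. pt v \<in> limit_set \<Gamma> x\<^sub>0}"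

lemma orbit_subset: "(\<lambda>A. proj_act A x\<^sub>0) ` \<Gamma> \<subseteq> \<Omega>"
  using \<Gamma>_Aut x0_\<Omega> by (auto simp: proj_Aut_def)

lemma limit_set_rep:
  assumes "z \<in> limit_set \<Gamma> x\<^sub>0"
  obtains v where "z = pt v" "a \<bullet> v = 1" "v \<in> closure C"
proof -
  have "z \<in> proj_space closure_of \<Omega>"
    using assms closure_of_mono[OF orbit_subset] by (auto simp: limit_set_def)
  moreover from this obtain w where w: "z = pt w" "w \<noteq> 0"
    using closure_of_subset_topspace[of proj_space \<Omega>] by (auto simp: topspace_proj)
  ultimately have n: "a \<bullet> w \<noteq> 0" using chart_nonzero[OF chart_a] by simp
  define v where "v = (1 / (a \<bullet> w)) *\<^sub>R w"
  have v: "z = pt v" "a \<bullet> v = 1" using w n by (simp_all add: v_def pt_scaleR)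
  then have "v \<in> closure C" using pt_closure_iff[of v] \<open>z \<in> proj_space closure_of \<Omega>\<close> by simp
  then show ?thesis using that v by blast
qed

text \<open>Approximate \<open>v\<close> by multiples \<open>c n *\<^sub>R (B n *v u)\<close> of orbit vectors. Each element of the group occurs only
  finitely often among the \<open>B n\<close>, since \<open>[v]\<close> is not itself an orbit point; hence \<open>B n\<close> diverges.\<close>

lemma limit_set_limit_cone:
  assumes v: "pt v \<in> limit_set \<Gamma> x\<^sub>0" "a \<bullet> v > 0"
  shows "v \<in> limit_cone"
proof -
  have v0: "v \<noteq> 0" using v by auto
  obtain u where u: "u \<in> C" "x\<^sub>0 = pt u" using \<Omega>_rep[OF x0_\<Omega>] by blast
  let ?O = "(\<lambda>A. proj_act A x\<^sub>0) ` \<Gamma>"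
  have vO: "pt v \<in> proj_space closure_of ?O" "pt v \<notin> ?O" using v by (auto simp: limit_set_def)
  then have "v \<in> closure {w. w \<noteq> 0 \<and> pt w \<in> ?O}" using pt_in_closure_of[OF v0] by blast
  then obtain w where w: "\<And>n. pt (w n) \<in> ?O" "w \<longlonglongrightarrow> v" unfolding closure_sequential by blast
  have "\<exists>B c. B \<in> G \<and> c \<noteq> 0 \<and> w n = c *\<^sub>R (B *v u)" for n
  proof -
    obtain A where A: "A \<in> \<Gamma>" "pt (w n) = pt (A *v u)" using w(1)[of n] by (auto simp: u(2) proj_act_pt)
    then obtain c where c: "c \<noteq> 0" "w n = c *\<^sub>R (A *v u)" using pt_eqD by blast
    then have "w n = (- c) *\<^sub>R ((- A) *v u)" by (simp add: mv_minus_left)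
    then show ?thesis using \<Gamma>_G[OF A(1)] c by (metis neg_equal_0_iff_equal)
  qed
  then obtain B c where B: "\<And>n. B n \<in> G" and c: "\<And>n. c n \<noteq> 0" and wB: "\<And>n. w n = c n *\<^sub>R (B n *v u)"
    by metis
  have "(\<lambda>n. a \<bullet> w n) \<longlonglongrightarrow> a \<bullet> v" by (intro tendsto_intros w)
  then have "eventually (\<lambda>n. a \<bullet> w n > 0) sequentially" using v(2) by (rule order_tendstoD)
  moreover have "c n > 0" if "a \<bullet> w n > 0" for n
    using that a_pos[OF G_C[OF B u(1)], of n] by (simp add: wB zero_less_mult_iff)
  ultimately have cpos: "eventually (\<lambda>n. c n > 0) sequentially" by (rule eventually_mono)
  have lim: "(\<lambda>n. c n *\<^sub>R (B n *v u)) \<longlonglongrightarrow> v" using w(2) by (simp add: wB[symmetric])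
  have prw: "(\<lambda>n. pr (B n *v u)) \<longlonglongrightarrow> pr v"
  proof -
    have "pr (c n *\<^sub>R (B n *v u)) = pr (B n *v u)" for n using c by (rule pr_scale)
    then show ?thesis using tendsto_pr[OF lim] v(2) by simp
  qed
  have avoid: "eventually (\<lambda>n. B n \<noteq> D) sequentially" if D: "D \<in> G" for D
  proof -
    have ne: "pr (D *v u) \<noteq> pr v"
    proof
      assume e: "pr (D *v u) = pr v"
      have "a \<bullet> (D *v u) > 0" using a_pos[OF G_C[OF D u(1)]] .
      then have "pt (D *v u) = pt v" using e v(2) pt_scaleR[of "1 / (a \<bullet> (D *v u))" "D *v u"] pt_scaleR[of "1 / (a \<bullet> v)" v]
        by (simp add: pr_def)
      moreover obtain A where "A \<in> \<Gamma>" "A = D \<or> A = - D" using G_\<Gamma>[OF D] by blast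
      then have "A \<in> \<Gamma>" "proj_act A x\<^sub>0 = pt (D *v u)" by (auto simp: u(2) proj_act_pt mv_minus_left pt_minus)
      ultimately show False using vO(2) by (metis image_eqI)
    qed
    have "eventually (\<lambda>n. pr (B n *v u) \<in> - {pr (D *v u)}) sequentially"
      using ne by (intro topological_tendstoD[OF prw]) (auto simp: open_Compl)
    then show ?thesis by (rule eventually_mono) auto
  qed
  have "filterlim (\<lambda>n. norm (B n)) at_top sequentially"
  proof (subst filterlim_at_top, intro allI)
    fix R :: real
    have "eventually (\<lambda>n. \<forall>D\<in>{A \<in> G. norm A \<le> R}. B n \<noteq> D) sequentially"
      using avoid by (intro eventually_ball_finite G_finite) auto
    then show "eventually (\<lambda>n. R \<le> norm (B n)) sequentially"
      by (rule eventually_mono) (use B in force)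
  qed
  then show ?thesis by (rule limit_coneI[OF B cpos u(1) _ lim v(2)])
qed

lemma \<Lambda>_limit_cone: "v \<in> \<Lambda> \<Longrightarrow> v \<in> limit_cone"
  using limit_set_limit_cone bd_pos by (auto simp: \<Lambda>_def)

lemma limit_set_invariant:
  assumes A: "A \<in> \<Gamma>" and v: "pt v \<in> limit_set \<Gamma> x\<^sub>0"
  shows "pt (A *v v) \<in> limit_set \<Gamma> x\<^sub>0"
proof -
  let ?O = "(\<lambda>A. proj_act A x\<^sub>0) ` \<Gamma>"
  let ?S = "{w. w \<noteq> 0 \<and> pt w \<in> ?O}"
  obtain u where u: "u \<in> C" "x\<^sub>0 = pt u" using \<Omega>_rep[OF x0_\<Omega>] by blast
  have inv: "B *v w \<noteq> 0 \<and> pt (B *v w) \<in> ?O" if B: "B \<in> \<Gamma>" and w: "w \<noteq> 0" "pt w \<in> ?O" for B w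
  proof -
    obtain D where D: "D \<in> \<Gamma>" "pt w = pt (D *v u)" using w(2) by (auto simp: u(2) proj_act_pt)
    have "pt (B *v w) = proj_act B (pt w)" by (simp add: proj_act_pt)
    also have "\<dots> = proj_act (B ** D) x\<^sub>0" by (simp add: D u(2) proj_act_pt matrix_vector_mul_assoc)
    finally have "pt (B *v w) \<in> ?O" using SL_subgroup_mult[OF subgroup_\<Gamma> B D(1)] by blast
    moreover have "B *v w \<noteq> 0"
      using matrix_inv_cancel(4)[OF SL_subgroup_invertible[OF subgroup_\<Gamma> B], of w] w by auto
    ultimately show ?thesis by simp
  qed
  have v0: "v \<noteq> 0"
  proof
    assume "v = 0"
    then have "pt v \<notin> topspace proj_space" using pt_eqD[of v] by (auto simp: topspace_proj)
    then show False using v closure_of_subset_topspace[of proj_space ?O] by (auto simp: limit_set_def)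
  qed
  have cancel: "matrix_inv A *v (A *v v) = v"
    by (rule matrix_inv_cancel(4)[OF SL_subgroup_invertible[OF subgroup_\<Gamma> A]])
  have Av0: "A *v v \<noteq> 0" using cancel v0 by auto
  have "v \<in> closure ?S" using v pt_in_closure_of[OF v0, of ?O] by (simp add: limit_set_def)
  then obtain f where f: "\<And>n. f n \<in> ?S" "f \<longlonglongrightarrow> v" unfolding closure_sequential by blast
  have "(\<lambda>n. A *v f n) \<longlonglongrightarrow> A *v v" by (intro tendsto_mv tendsto_const f)
  moreover have "A *v f n \<in> ?S" for n using f(1)[of n] inv[OF A] by simp
  ultimately have "A *v v \<in> closure ?S" by (intro closure_limI)
  then have "pt (A *v v) \<in> proj_space closure_of ?O" using pt_in_closure_of[OF Av0, of ?O] by simp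
  moreover have "pt (A *v v) \<notin> ?O"
  proof
    assume "pt (A *v v) \<in> ?O"
    then have "pt (matrix_inv A *v (A *v v)) \<in> ?O"
      using inv[OF SL_subgroup_inv[OF subgroup_\<Gamma> A] Av0] by blast
    then show False using v by (simp add: cancel limit_set_def)
  qed
  ultimately show ?thesis by (simp add: limit_set_def)
qed

lemma \<Lambda>_invariant: "g \<in> G \<Longrightarrow> v \<in> \<Lambda> \<Longrightarrow> g *v v \<in> \<Lambda>"
proof -
  assume g: "g \<in> G" and v: "v \<in> \<Lambda>"
  obtain A where A: "A \<in> \<Gamma>" "A = g \<or> A = - g" using G_\<Gamma>[OF g] by blast
  have "pt (A *v v) \<in> limit_set \<Gamma> x\<^sub>0" using limit_set_invariant[OF A(1)] v by (simp add: \<Lambda>_def)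
  moreover have "pt (A *v v) = pt (g *v v)" using A(2) by (auto simp: mv_minus_left pt_minus)
  ultimately show ?thesis using G_bd[OF g] v by (simp add: \<Lambda>_def)
qed

lemma \<Lambda>_scale: "v \<in> \<Lambda> \<Longrightarrow> c > 0 \<Longrightarrow> c *\<^sub>R v \<in> \<Lambda>"
  using bd_scale by (simp add: \<Lambda>_def pt_scaleR)

sublocale nonelementary_cone_group C a G
proof
  show "infinite {q \<in> limit_cone. a \<bullet> q = 1}"
  proof
    assume "finite {q \<in> limit_cone. a \<bullet> q = 1}"
    then have "finite (pt ` {q \<in> limit_cone. a \<bullet> q = 1})" by (rule finite_imageI)
    moreover have "limit_set \<Gamma> x\<^sub>0 \<subseteq> pt ` {q \<in> limit_cone. a \<bullet> q = 1}"
    proof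
      fix z assume z: "z \<in> limit_set \<Gamma> x\<^sub>0"
      then obtain v where "z = pt v" "a \<bullet> v = 1" by (rule limit_set_rep)
      moreover from this have "v \<in> limit_cone" using limit_set_limit_cone[of v] z by simp
      ultimately show "z \<in> pt ` {q \<in> limit_cone. a \<bullet> q = 1}" by blast
    qed
    ultimately show False using nonelem finite_subset by (auto simp: non_elementary_def)
  qed
qed

section \<open>Directions as pairs of boundary vectors\<close>

text \<open>The ray leaves \<open>C\<close>, because a direction parallel to the chart is not in the closed cone; the first
  parameter outside \<open>C\<close> gives the boundary point.\<close>

lemma exit_point:
  assumes v: "v \<in> C" "a \<bullet> v = 1" and \<xi>: "a \<bullet> \<xi> = 0" "\<xi> \<noteq> 0"
  shows "\<exists>s>0. v + s *\<^sub>R \<xi> \<in> bd \<and> a \<bullet> (v + s *\<^sub>R \<xi>) = 1"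
proof -
  define S where "S = {s. s \<ge> 0 \<and> v + s *\<^sub>R \<xi> \<notin> C}"
  have ne: "S \<noteq> {}"
  proof
    assume "S = {}"
    then have all: "v + s *\<^sub>R \<xi> \<in> C" if "s \<ge> 0" for s using that by (auto simp: S_def)
    have lim: "(\<lambda>n. inverse (real (Suc n)) *\<^sub>R v + \<xi>) \<longlonglongrightarrow> \<xi>"
      using tendsto_add[OF tendsto_scaleR[OF LIMSEQ_inverse_real_of_nat tendsto_const[of v]] tendsto_const[of \<xi>]] by simp
    have "inverse (real (Suc n)) *\<^sub>R v + \<xi> \<in> C" for n
    proof -
      have "inverse (real (Suc n)) *\<^sub>R (v + real (Suc n) *\<^sub>R \<xi>) \<in> C" by (intro C_scaleR all) simp_all
      then show ?thesis by (simp add: scaleR_add_right del: of_nat_Suc)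
    qed
    then have "\<xi> \<in> closure C" using lim by (rule closure_limI)
    then show False using a_pos_closure[of \<xi>] \<xi> by simp
  qed
  have "S = {0..} \<inter> (\<lambda>s. v + s *\<^sub>R \<xi>) -` (- C)" by (auto simp: S_def)
  moreover have "closed ((\<lambda>s. v + s *\<^sub>R \<xi>) -` (- C))"
    using openC by (intro closed_vimage) (auto simp: closed_Compl intro!: continuous_intros)
  ultimately have "closed S" by (simp add: closed_Int)
  moreover have bdd: "bdd_below S" by (intro bdd_belowI[of _ 0]) (simp add: S_def)
  ultimately have inS: "Inf S \<in> S" using ne by (intro closed_contains_Inf)
  define s where "s = Inf S"
  have s: "s \<ge> 0" "v + s *\<^sub>R \<xi> \<notin> C" using inS by (auto simp: S_def s_def)
  have s0: "s > 0" using s v by (cases "s = 0") auto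
  have less: "v + r *\<^sub>R \<xi> \<in> C" if r: "0 \<le> r" "r < s" for r
  proof (rule ccontr)
    assume "v + r *\<^sub>R \<xi> \<notin> C"
    then have "r \<in> S" using r by (simp add: S_def)
    then have "s \<le> r" using bdd by (simp add: s_def cInf_lower)
    then show False using r by simp
  qed
  have "(\<lambda>n. v + (s * (1 - inverse (real (Suc n)))) *\<^sub>R \<xi>) \<longlonglongrightarrow> v + (s * (1 - 0)) *\<^sub>R \<xi>"
    by (intro tendsto_intros LIMSEQ_inverse_real_of_nat)
  moreover have "v + (s * (1 - inverse (real (Suc n)))) *\<^sub>R \<xi> \<in> C" for n
  proof (rule less)
    have i: "0 < inverse (real (Suc n))" "inverse (real (Suc n)) \<le> 1" by (simp_all add: field_simps)
    show "0 \<le> s * (1 - inverse (real (Suc n)))" using s(1) i by simp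
    show "s * (1 - inverse (real (Suc n))) < s" using s0 i by (simp add: algebra_simps)
  qed
  ultimately have "v + s *\<^sub>R \<xi> \<in> closure C" by (intro closure_limI[where x="v + s *\<^sub>R \<xi>"]) auto
  moreover have "a \<bullet> (v + s *\<^sub>R \<xi>) = 1" using v \<xi> by (simp add: inner_add_right)
  ultimately show ?thesis using s s0 by (intro exI[of _ s]) (auto simp: bd_def)
qed

lemma topspace_H\<Omega>: "topspace (H\<Omega> \<Omega>) = {dir v \<xi> | v \<xi>. v \<noteq> 0 \<and> \<xi> \<notin> span {v} \<and> pt v \<in> \<Omega>}"
  by (auto simp: H\<Omega>_def topspace_subtopology dir_space_def topspace_quotient_topology base_point_dir) blast

text \<open>Write the base point as a convex combination of the two ends of its chord.\<close>

lemma H\<Omega>_ray: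
  assumes "w \<in> topspace (H\<Omega> \<Omega>)"
  obtains p q where "p \<in> bd" "q \<in> bd" "pr p \<noteq> pr q" "w = ray p q"
proof -
  obtain v0 \<xi>0 where w: "w = dir v0 \<xi>0" "\<xi>0 \<notin> span {v0}" "pt v0 \<in> \<Omega>"
    using assms by (auto simp: topspace_H\<Omega>)
  have n: "a \<bullet> v0 \<noteq> 0" using chart_nonzero[OF chart_a] w(3) \<Omega>_closure by blast
  define l where "l = 1 / (a \<bullet> v0)"
  have l: "l \<noteq> 0" using n by (simp add: l_def)
  define v where "v = l *\<^sub>R v0"
  define c where "c = - (a \<bullet> \<xi>0) / (a \<bullet> v0)"
  define \<xi> where "\<xi> = l *\<^sub>R (1 *\<^sub>R \<xi>0 + c *\<^sub>R v0)"
  have wd: "w = dir v \<xi>" unfolding w v_def \<xi>_def using l by (intro dir_rescale[symmetric]) auto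
  have av: "a \<bullet> v = 1" using n by (simp add: v_def l_def)
  have a\<xi>: "a \<bullet> \<xi> = 0" using n by (simp add: \<xi>_def c_def inner_add_right inner_diff_right)
  have vC: "v \<in> C" using av w(3) l by (simp add: C_def v_def pt_scaleR)
  have \<xi>0: "\<xi> \<noteq> 0"
  proof
    assume "\<xi> = 0"
    then have "\<xi>0 = (- c) *\<^sub>R v0" using l by (simp add: \<xi>_def add_eq_0_iff)
    then show False using w(2) by (metis span_base span_scale singletonI)
  qed
  obtain s where s: "s > 0" "v + s *\<^sub>R \<xi> \<in> bd" "a \<bullet> (v + s *\<^sub>R \<xi>) = 1" using exit_point[OF vC av a\<xi> \<xi>0] by blast
  obtain r where r: "r > 0" "v + r *\<^sub>R (- \<xi>) \<in> bd" "a \<bullet> (v + r *\<^sub>R (- \<xi>)) = 1"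
    using exit_point[OF vC av, of "- \<xi>"] a\<xi> \<xi>0 by auto
  define Q where "Q = v + s *\<^sub>R \<xi>"
  define P where "P = v + r *\<^sub>R (- \<xi>)"
  define p where "p = (s / (r + s)) *\<^sub>R P"
  define q where "q = (r / (r + s)) *\<^sub>R Q"
  have rs: "s / (r + s) > 0" "r / (r + s) > 0" using r s by auto
  have bd: "p \<in> bd" "q \<in> bd" using r s rs by (auto simp: p_def q_def P_def Q_def intro: bd_scale)
  have pr: "pr p = P" "pr q = Q" using rs r s by (auto simp: p_def q_def pr_scale pr_id P_def Q_def)
  have "P \<noteq> Q"
  proof
    assume "P = Q"
    then have "(r + s) *\<^sub>R \<xi> = 0" by (simp add: P_def Q_def algebra_simps)
    then show False using \<xi>0 r s by simp
  qed
  have sum1: "s / (r + s) + r / (r + s) = 1" using r s by (simp add: add_divide_distrib[symmetric])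
  have pq: "p + q = v"
  proof -
    have "p + q = (s / (r + s) + r / (r + s)) *\<^sub>R v + ((r / (r + s)) * s - (s / (r + s)) * r) *\<^sub>R \<xi>"
      by (simp add: p_def q_def P_def Q_def algebra_simps)
    then show ?thesis by (simp add: sum1)
  qed
  have "q = 1 *\<^sub>R ((r / (r + s) * s) *\<^sub>R \<xi> + (r / (r + s)) *\<^sub>R v)" by (simp add: q_def Q_def algebra_simps)
  then have "ray p q = dir (1 *\<^sub>R v) (1 *\<^sub>R ((r / (r + s) * s) *\<^sub>R \<xi> + (r / (r + s)) *\<^sub>R v))"
    unfolding ray_def pq by (simp only: scaleR_one)
  also have "\<dots> = dir v \<xi>" using mult_pos_pos[OF rs(2) s(1)] by (intro dir_rescale) auto
  finally show ?thesis using that[OF bd] pr \<open>P \<noteq> Q\<close> wd by simp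
qed

lemma ray_independent:
  assumes "p \<in> bd" "q \<in> bd" "pr p \<noteq> pr q"
  shows "p + q \<noteq> 0" "q \<notin> span {p + q}" "pt (p + q) \<in> \<Omega>"
proof -
  have C: "p + q \<in> C" using bd_add_C[OF assms] .
  then show "pt (p + q) \<in> \<Omega>" by (simp add: C_def)
  show "p + q \<noteq> 0" using a_pos[OF C] by auto
  show "q \<notin> span {p + q}"
  proof
    assume "q \<in> span {p + q}"
    then obtain c where c: "q = c *\<^sub>R (p + q)" by (auto simp: span_singleton)
    have "a \<bullet> q = c * (a \<bullet> (p + q))" using c by (metis inner_scaleR_right)
    then have "c > 0" using bd_pos[OF assms(2)] a_pos[OF C] by (simp add: zero_less_mult_iff)
    then have "q \<in> C" using C_scale[OF C] c by metis
    then show False using assms(2) by (simp add: bd_def)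
  qed
qed

lemma ray_in_H\<Omega>:
  assumes "p \<in> bd" "q \<in> bd" "pr p \<noteq> pr q"
  shows "ray p q \<in> topspace (H\<Omega> \<Omega>)"
  unfolding topspace_H\<Omega> ray_def using ray_independent[OF assms] by blast

lemma ray_continuous:
  assumes W: "openin (H\<Omega> \<Omega>) W" and pq: "p \<in> bd" "q \<in> bd" "pr p \<noteq> pr q" "ray p q \<in> W"
  obtains Np Nq where "open Np" "p \<in> Np" "open Nq" "q \<in> Nq"
    "\<forall>p'\<in>Np \<inter> bd. \<forall>q'\<in>Nq \<inter> bd. pr p' \<noteq> pr q' \<longrightarrow> ray p' q' \<in> W"
proof -
  let ?S = "{(v :: real^'m, \<xi>). v \<noteq> 0 \<and> \<xi> \<notin> span {v}}"
  let ?d = "\<lambda>(v :: real^'m, \<xi>). dir v \<xi>"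
  obtain T where T: "openin dir_space T" "W = T \<inter> {w. fst ` w \<in> \<Omega>}"
    using W by (auto simp: H\<Omega>_def openin_subtopology)
  have "openin (top_of_set ?S) {z \<in> ?S. ?d z \<in> T}"
    using T(1) by (simp add: dir_space_def openin_quotient_topology)
  then obtain U where U: "open U" "{z \<in> ?S. ?d z \<in> T} = ?S \<inter> U" unfolding openin_open by blast
  have "(p + q, q) \<in> {z \<in> ?S. ?d z \<in> T}"
    using ray_independent[OF pq(1-3)] pq(4) T(2) by (auto simp: ray_def)
  then have "(p + q, q) \<in> U" using U(2) by blast
  moreover have "((\<lambda>z. (fst z + snd z, snd z)) \<longlongrightarrow> (fst (p, q) + snd (p, q), snd (p, q))) (nhds (p, q))"
    by (intro tendsto_intros tendsto_fst tendsto_snd filterlim_ident)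
  ultimately have "eventually (\<lambda>z. (fst z + snd z, snd z) \<in> U) (nhds (p, q))"
    using U(1) by (intro topological_tendstoD) auto
  then obtain P Q where PQ: "eventually P (nhds p)" "eventually Q (nhds q)"
    "\<And>p' q'. P p' \<Longrightarrow> Q q' \<Longrightarrow> (p' + q', q') \<in> U"
    unfolding nhds_prod eventually_prod_filter by auto
  obtain Np where Np: "open Np" "p \<in> Np" "\<And>p'. p' \<in> Np \<Longrightarrow> P p'" using PQ(1) unfolding eventually_nhds by blast
  obtain Nq where Nq: "open Nq" "q \<in> Nq" "\<And>q'. q' \<in> Nq \<Longrightarrow> Q q'" using PQ(2) unfolding eventually_nhds by blast
  have "ray p' q' \<in> W" if h: "p' \<in> Np" "q' \<in> Nq" "p' \<in> bd" "q' \<in> bd" "pr p' \<noteq> pr q'" for p' q'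
  proof -
    note i = ray_independent[OF h(3-5)]
    have "(p' + q', q') \<in> ?S \<inter> U" using i PQ(3) Np(3) Nq(3) h by simp
    then have "(p' + q', q') \<in> {z \<in> ?S. ?d z \<in> T}" using U(2) by blast
    then have "ray p' q' \<in> T" by (simp add: ray_def)
    moreover have "fst ` ray p' q' \<in> \<Omega>" using i by (simp add: ray_def base_point_dir)
    ultimately show ?thesis using T(2) by blast
  qed
  then show ?thesis using Np Nq by (intro that[of Np Nq]) auto
qed

lemma dir_act_assoc: "dir_act A (dir_act B (dir v \<xi>)) = dir_act (A ** B) (dir v \<xi>)"
  by (simp add: dir_act_dir matrix_vector_mul_assoc)

lemma dir_orbit_translate:
  assumes A: "A \<in> \<Gamma>" shows "dir_orbit \<Gamma> (dir_act A (dir v \<xi>)) = dir_orbit \<Gamma> (dir v \<xi>)"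
proof -
  have "(\<lambda>B. B ** A) ` \<Gamma> = \<Gamma>"
  proof
    show "(\<lambda>B. B ** A) ` \<Gamma> \<subseteq> \<Gamma>" using SL_subgroup_mult[OF subgroup_\<Gamma> _ A] by blast
    show "\<Gamma> \<subseteq> (\<lambda>B. B ** A) ` \<Gamma>"
    proof
      fix B assume B: "B \<in> \<Gamma>"
      have "B = (B ** matrix_inv A) ** A"
        by (simp add: matrix_mul_assoc[symmetric] matrix_inv_cancel[OF SL_subgroup_invertible[OF subgroup_\<Gamma> A]])
      then show "B \<in> (\<lambda>B. B ** A) ` \<Gamma>"
        using SL_subgroup_mult[OF subgroup_\<Gamma> B SL_subgroup_inv[OF subgroup_\<Gamma> A]] by blast
    qed
  qed
  moreover have "dir_orbit \<Gamma> (dir_act A (dir v \<xi>)) = (\<lambda>D. dir_act D (dir v \<xi>)) ` (\<lambda>B. B ** A) ` \<Gamma>"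
    by (simp add: dir_orbit_def dir_act_assoc image_image)
  ultimately show ?thesis by (simp add: dir_orbit_def)
qed

lemma dir_orbit_ray_translate:
  assumes "g \<in> G" shows "dir_orbit \<Gamma> (ray (g *v p) (g *v q)) = dir_orbit \<Gamma> (ray p q)"
proof -
  obtain A where A: "A \<in> \<Gamma>" "A = g \<or> A = - g" using G_\<Gamma>[OF assms] by blast
  have "dir_act A (ray p q) = ray (g *v p) (g *v q)"
    using A(2) dir_act_ray_minus dir_act_ray by auto
  then show ?thesis using dir_orbit_translate[OF A(1)] by (metis ray_def)
qed

lemma geodesic_flow_HM_ray:
  assumes "p \<in> bd" "q \<in> bd" "pr p \<noteq> pr q"
  shows "geodesic_flow_HM a \<Omega> t (dir_orbit \<Gamma> (ray p q)) = dir_orbit \<Gamma> (ray (exp (- t) *\<^sub>R p) (exp t *\<^sub>R q))"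
proof -
  have "geodesic_flow a \<Omega> t (dir_act A (ray p q)) = dir_act A (ray (exp (- t) *\<^sub>R p) (exp t *\<^sub>R q))"
    if A: "A \<in> \<Gamma>" for A
  proof -
    obtain g where g: "g \<in> G" "A = g \<or> A = - g"
      using \<Gamma>_G[OF A] by (metis minus_minus)
    have act: "dir_act A (ray u w) = ray (g *v u) (g *v w)" for u w
      using g(2) dir_act_ray_minus dir_act_ray by auto
    have "geodesic_flow a \<Omega> t (ray (g *v p) (g *v q)) = ray (exp (- t) *\<^sub>R (g *v p)) (exp t *\<^sub>R (g *v q))"
      using assms pr_mult_eq_iff[OF g(1) assms(1,2)] by (intro geodesic_flow_ray G_bd g) auto
    then show ?thesis by (simp add: act matrix_vector_mult_scaleR)
  qed
  then show ?thesis by (simp add: geodesic_flow_HM_def dir_orbit_def image_image)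
qed

section \<open>Mixing on the non-wandering set\<close>

abbreviation NW_space where "NW_space \<equiv> subtopology (HM \<Omega> \<Gamma>) (NW a \<Omega> \<Gamma> x\<^sub>0)"

text \<open>Open subsets of the non-wandering set, seen upstairs: \<open>W\<close> is the preimage of an open set of the quotient
  that cuts out \<open>U\<close>.\<close>

lemma open_NW_rep:
  assumes U: "openin NW_space U" "U \<noteq> {}"
  obtains W p q where "openin (H\<Omega> \<Omega>) W" "p \<in> \<Lambda>" "q \<in> \<Lambda>" "pr p \<noteq> pr q" "ray p q \<in> W"
    "\<forall>p'\<in>\<Lambda>. \<forall>q'\<in>\<Lambda>. pr p' \<noteq> pr q' \<longrightarrow> ray p' q' \<in> W \<longrightarrow> dir_orbit \<Gamma> (ray p' q') \<in> U"
proof -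
  obtain U' where U': "openin (HM \<Omega> \<Gamma>) U'" "U = U' \<inter> NW a \<Omega> \<Gamma> x\<^sub>0" using U(1) by (auto simp: openin_subtopology)
  define W where "W = {w \<in> topspace (H\<Omega> \<Omega>). dir_orbit \<Gamma> w \<in> U'}"
  have W: "openin (H\<Omega> \<Omega>) W" using U'(1) by (simp add: HM_def openin_quotient_topology W_def)
  obtain w where w: "w \<in> topspace (H\<Omega> \<Omega>)" "fwd_end a \<Omega> w \<in> limit_set \<Gamma> x\<^sub>0" "bwd_end a \<Omega> w \<in> limit_set \<Gamma> x\<^sub>0"
    "dir_orbit \<Gamma> w \<in> U'" using U(2) U'(2) by (auto simp: NW_def)
  obtain p q where pq: "p \<in> bd" "q \<in> bd" "pr p \<noteq> pr q" "w = ray p q" by (rule H\<Omega>_ray[OF w(1)])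
  have "p \<in> \<Lambda>" "q \<in> \<Lambda>" using w ray_ends[OF pq(1-3)] pq by (auto simp: \<Lambda>_def)
  moreover have "ray p q \<in> W" using w pq by (simp add: W_def)
  moreover have "dir_orbit \<Gamma> (ray p' q') \<in> U"
    if h: "p' \<in> \<Lambda>" "q' \<in> \<Lambda>" "pr p' \<noteq> pr q'" "ray p' q' \<in> W" for p' q'
  proof -
    have b: "p' \<in> bd" "q' \<in> bd" using h by (auto simp: \<Lambda>_def)
    have "fwd_end a \<Omega> (ray p' q') \<in> limit_set \<Gamma> x\<^sub>0" "bwd_end a \<Omega> (ray p' q') \<in> limit_set \<Gamma> x\<^sub>0"
      using ray_ends[OF b h(3)] h by (auto simp: \<Lambda>_def)
    then have "dir_orbit \<Gamma> (ray p' q') \<in> NW a \<Omega> \<Gamma> x\<^sub>0"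
      using ray_in_H\<Omega>[OF b h(3)] by (auto simp: NW_def)
    then show ?thesis using h(4) U'(2) by (simp add: W_def)
  qed
  ultimately show ?thesis using pq(3) by (intro that[OF W, of p q]) auto
qed

text \<open>The factor 2 between the times comes from \<open>\<sigma> \<tau> = e\<^sup>2\<^sup>t\<close>.\<close>

theorem mixing: "topologically_mixing NW_space (geodesic_flow_HM a \<Omega>)"
  unfolding topologically_mixing_def
proof (intro allI impI)
  fix U V
  assume "openin NW_space U \<and> openin NW_space V \<and> U \<noteq> {} \<and> V \<noteq> {}"
  then have U: "openin NW_space U" "U \<noteq> {}" and V: "openin NW_space V" "V \<noteq> {}" by auto
  obtain W p q where W: "openin (H\<Omega> \<Omega>) W" and p: "p \<in> \<Lambda>" and q: "q \<in> \<Lambda>" and pq: "pr p \<noteq> pr q" "ray p q \<in> W"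
    and WU: "\<forall>p'\<in>\<Lambda>. \<forall>q'\<in>\<Lambda>. pr p' \<noteq> pr q' \<longrightarrow> ray p' q' \<in> W \<longrightarrow> dir_orbit \<Gamma> (ray p' q') \<in> U"
    by (rule open_NW_rep[OF U])
  obtain W' p' q' where W': "openin (H\<Omega> \<Omega>) W'" and p': "p' \<in> \<Lambda>" and q': "q' \<in> \<Lambda>" and pq': "pr p' \<noteq> pr q'" "ray p' q' \<in> W'"
    and WV: "\<forall>p\<in>\<Lambda>. \<forall>q\<in>\<Lambda>. pr p \<noteq> pr q \<longrightarrow> ray p q \<in> W' \<longrightarrow> dir_orbit \<Gamma> (ray p q) \<in> V"
    by (rule open_NW_rep[OF V])
  have bd: "p \<in> bd" "q \<in> bd" "p' \<in> bd" "q' \<in> bd" using p q p' q' by (auto simp: \<Lambda>_def)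
  obtain Np Nq where N: "open Np" "p \<in> Np" "open Nq" "q \<in> Nq"
    "\<forall>p'\<in>Np \<inter> bd. \<forall>q'\<in>Nq \<inter> bd. pr p' \<noteq> pr q' \<longrightarrow> ray p' q' \<in> W"
    by (rule ray_continuous[OF W bd(1,2) pq])
  obtain Np' Nq' where N': "open Np'" "p' \<in> Np'" "open Nq'" "q' \<in> Nq'"
    "\<forall>p\<in>Np' \<inter> bd. \<forall>q\<in>Nq' \<inter> bd. pr p \<noteq> pr q \<longrightarrow> ray p q \<in> W'"
    by (rule ray_continuous[OF W' bd(3,4) pq'])
  \<comment> \<open>Keep the new end point \<open>q1\<close> away from \<open>p\<close>, so that the two still span a direction.\<close>
  obtain M where M: "open M" "q \<in> M" "\<And>u. u \<in> M \<Longrightarrow> pr u \<noteq> pr p"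
    using pr_neq_nhd[OF bd(2), of "{pr p}"] pq(1) by auto
  have "open (Nq \<inter> M)" "q \<in> Nq \<inter> M" using N M by auto
  from all_large_times_realized[OF bd(1) \<Lambda>_limit_cone[OF q] pq(1) \<Lambda>_limit_cone[OF p'] bd(4) pq'(1) this N'(1,2)]
  obtain T where T: "\<And>t. t \<ge> T \<Longrightarrow> \<exists>g\<in>G. \<exists>\<sigma>>0. \<exists>\<tau>>0. \<sigma> * \<tau> = exp t \<and>
    (1 / \<sigma>) *\<^sub>R (g *v q') \<in> Nq \<inter> M \<and> (1 / \<tau>) *\<^sub>R (matrix_inv g *v p) \<in> Np'" by blast
  have "geodesic_flow_HM a \<Omega> t ` U \<inter> V \<noteq> {}" if t: "t \<ge> T / 2" for t
  proof -
    have "2 * t \<ge> T" using t by simp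
    from T[OF this] obtain g \<sigma> \<tau> where g: "g \<in> G" and \<sigma>: "\<sigma> > 0" and \<tau>: "\<tau> > 0" and \<sigma>\<tau>: "\<sigma> * \<tau> = exp (2 * t)"
      and in1: "(1 / \<sigma>) *\<^sub>R (g *v q') \<in> Nq \<inter> M" and in2: "(1 / \<tau>) *\<^sub>R (matrix_inv g *v p) \<in> Np'" by blast
    define q1 where "q1 = (1 / \<sigma>) *\<^sub>R (g *v q')"
    define p2 where "p2 = (1 / \<tau>) *\<^sub>R (matrix_inv g *v p)"
    have q1: "q1 \<in> \<Lambda>" unfolding q1_def using \<sigma> by (intro \<Lambda>_scale \<Lambda>_invariant g q') simp
    have p2: "p2 \<in> \<Lambda>" unfolding p2_def using \<tau> by (intro \<Lambda>_scale \<Lambda>_invariant G_inv g p) simp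
    have bd': "q1 \<in> bd" "p2 \<in> bd" using q1 p2 by (auto simp: \<Lambda>_def)
    have ne1: "pr p \<noteq> pr q1" using M(3)[of q1] in1 by (auto simp: q1_def)
    have gp2: "g *v p2 = (1 / \<tau>) *\<^sub>R p" by (simp add: p2_def matrix_vector_mult_scaleR G_cancel[OF g])
    have gq': "g *v q' = \<sigma> *\<^sub>R q1" using \<sigma> by (simp add: q1_def)
    have ne2: "pr p2 \<noteq> pr q'"
    proof
      assume "pr p2 = pr q'"
      then have "pr (g *v p2) = pr (g *v q')" using pr_mult_eq_iff[OF g bd'(2) bd(4)] by simp
      then show False using ne1 \<sigma> \<tau> by (simp add: gp2 gq' pr_scale)
    qed
    have inU: "dir_orbit \<Gamma> (ray p q1) \<in> U"
    proof -
      have "ray p q1 \<in> W" using N(2,5) in1 bd(1) bd'(1) ne1 by (simp add: q1_def)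
      then show ?thesis using WU p q1 ne1 by blast
    qed
    have inV: "dir_orbit \<Gamma> (ray p2 q') \<in> V"
    proof -
      have "ray p2 q' \<in> W'" using N'(4,5) in2 bd(4) bd'(2) ne2 by (simp add: p2_def)
      then show ?thesis using WV p2 q' ne2 by blast
    qed
    \<comment> \<open>Normalize the pair \<open>g (p2, q')\<close> such that its first vector is that of the flow line of \<open>(p, q1)\<close>.\<close>
    have "ray (g *v p2) (g *v q') = ray ((exp (- t) * \<tau>) *\<^sub>R (g *v p2)) ((exp (- t) * \<tau>) *\<^sub>R (g *v q'))"
      using \<tau> by (intro ray_scale[symmetric]) simp
    also have "(exp (- t) * \<tau>) *\<^sub>R (g *v p2) = exp (- t) *\<^sub>R p" using \<tau> by (simp add: gp2)
    also have "(exp (- t) * \<tau>) *\<^sub>R (g *v q') = exp t *\<^sub>R q1"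
    proof -
      have "exp (- t) * \<tau> * \<sigma> = exp (- t) * exp (2 * t)" using \<sigma>\<tau> by (simp add: mult.assoc mult.commute)
      also have "\<dots> = exp t" by (simp add: exp_add[symmetric])
      finally show ?thesis by (simp add: gq')
    qed
    finally have "dir_orbit \<Gamma> (ray (exp (- t) *\<^sub>R p) (exp t *\<^sub>R q1)) = dir_orbit \<Gamma> (ray p2 q')"
      using dir_orbit_ray_translate[OF g, of p2 q'] by simp
    then have "geodesic_flow_HM a \<Omega> t (dir_orbit \<Gamma> (ray p q1)) = dir_orbit \<Gamma> (ray p2 q')"
      using geodesic_flow_HM_ray[OF bd(1) bd'(1) ne1] by simp
    then show ?thesis using inU inV by blast
  qed
  then show "\<exists>T. \<forall>t\<ge>T. geodesic_flow_HM a \<Omega> t ` U \<inter> V \<noteq> {}" by blast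
qed

end

theorem proposition1p3:
  fixes \<Omega> :: "(real^'m) set set"
    and \<Gamma> :: "(real^'m^'m) set"
    and x\<^sub>0 :: "(real^'m) set"
    and a :: "real^'m"
  assumes "openin proj_space \<Omega>"
    and "properly_convex \<Omega>"
    and "proj_strictly_convex \<Omega>"
    and "C1_boundary \<Omega>"
    and "subgroup \<Gamma> SL" and "\<Gamma> \<subseteq> proj_Aut \<Omega>"
    and "discrete \<Gamma>"
    and "torsion_free \<Gamma>"
    and "x\<^sub>0 \<in> \<Omega>"
    and "non_elementary \<Gamma> x\<^sub>0"
    and "chart_contains_closure a \<Omega>"
  shows "topologically_mixing (subtopology (HM \<Omega> \<Gamma>) (NW a \<Omega> \<Gamma> x\<^sub>0)) (geodesic_flow_HM a \<Omega>)"
proof -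
  interpret convex_quotient \<Omega> \<Gamma> x\<^sub>0 a
    by (rule convex_quotient.intro[OF assms(1,2,3,5,6,7,9,10,11)])
  show ?thesis by (rule mixing)
qed

end
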